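(* Let $n\ge 1$, $(x_0,\xi_0)\in \mathbb{R}^n\times(\mathbb{R}^n\setminus\{0\})$ and $u\in\mathcal{S}'(\mathbb{R}^n)$. The following three conditions are equivalent. (i) $(x_0,\xi_0)\notin WF(u)$. (ii) There exist $\phi\in\mathcal{S}(\mathbb{R}^n)\setminus\{0\}$, a neighborhood $K$ of $x_0$ and a conic neighborhood $\Gamma$ of $\xi_0$ such that for every $N\in\mathbb{N}$ and every $a\ge 1$ there is a constant $C_{N,a}>0$ with $$|W_{\phi_\lambda}u(x,\lambda\xi)|\le C_{N,a}\lambda^{-N}$$ for all $\lambda\ge1$, $x\in K$ and $\xi\in\Gamma$ with $a^{-1}\le|\xi|\le a$. (iii) There exist a neighborhood $K$ of $x_0$ and a conic neighborhood $\Gamma$ of $\xi_0$ such that for every $\phi\in\mathcal{S}(\mathbb{R}^n)\setminus\{0\}$, every $N\in\mathbb{N}$ and every $a\ge1$ there is a constant $C_{N,a}>0$ (which may depend on $\phi$) with $$|W_{\phi_\lambda}u(x,\lambda\xi)|\le C_{N,a}\lambda^{-N}$$ for all $\lambda\ge1$, $x\in K$ and $\xi\in\Gamma$ with $a^{-1}\le|\xi|\le a$.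
   Context: Fourier transform: $\mathcal{F}[f](\xi)=\widehat f(\xi)=\int_{\mathbb{R}^n}f(x)e^{-ix\cdot\xi}dx$ (extended to $\mathcal{S}'$). For $\phi\in\mathcal{S}(\mathbb{R}^n)\setminus\{0\}$ and $f\in\mathcal{S}'(\mathbb{R}^n)$, the wave packet transform is $W_\phi f(x,\xi)=\int_{\mathbb{R}^n}\overline{\phi(y-x)}f(y)e^{-iy\cdot\xi}dy$, i.e. the action of $f$ on the Schwartz function $y\mapsto\overline{\phi(y-x)}e^{-iy\cdot\xi}$. For $\lambda\ge1$, $\phi_\lambda(x)=\lambda^{n/4}\phi(\lambda^{1/2}x)$. A conic neighborhood of $\xi_0$ is an open set $\Gamma\ni\xi_0$ with $t\xi\in\Gamma$ whenever $\xi\in\Gamma$, $t>0$. ($C^\infty$ wave front set) $(x_0,\xi_0)\notin WF(u)$ means: there exist $\chi\in C_0^\infty(\mathbb{R}^n)$ with $\chi\equiv1$ near $x_0$ and a conic neighborhood $\Gamma$ of $\xi_0$ such that for every $N\in\mathbb{N}$ there is $C_N>0$ with $|\mathcal{F}[\chi u](\xi)|\le C_N(1+|\xi|)^{-N}$ for all $\xi\in\Gamma$. *)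

theory Defs
  imports "HOL-Analysis.Analysis"
begin

fun dirderivs :: "'a::euclidean_space list \<Rightarrow> ('a \<Rightarrow> complex) \<Rightarrow> 'a \<Rightarrow> complex" where
  "dirderivs [] f = f"
| "dirderivs (b # bs) f = (\<lambda>x. vector_derivative (\<lambda>t. dirderivs bs f (x + t *\<^sub>R b)) (at 0))"

definition schwartz :: "('a::euclidean_space \<Rightarrow> complex) \<Rightarrow> bool" where
  "schwartz f \<longleftrightarrow>
     (\<forall>bs b x. set bs \<subseteq> Basis \<longrightarrow> b \<in> Basis \<longrightarrow>
        ((\<lambda>t. dirderivs bs f (x + t *\<^sub>R b)) has_vector_derivative dirderivs (b # bs) f x) (at 0)) \<and>
     (\<forall>(k::nat) bs. set bs \<subseteq> Basis \<longrightarrow>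
        (\<exists>C. \<forall>x. (1 + norm x) ^ k * norm (dirderivs bs f x) \<le> C))"

text \<open>Tempered distributions S'(R^n): linear functionals on S that are continuous, i.e.
  bounded by a Schwartz seminorm.\<close>
definition tempered :: "(('a::euclidean_space \<Rightarrow> complex) \<Rightarrow> complex) \<Rightarrow> bool" where
  "tempered u \<longleftrightarrow>
     (\<forall>f g. schwartz f \<longrightarrow> schwartz g \<longrightarrow> u (\<lambda>x. f x + g x) = u f + u g) \<and>
     (\<forall>c f. schwartz f \<longrightarrow> u (\<lambda>x. c * f x) = c * u f) \<and>
     (\<exists>C (k::nat) (m::nat). \<forall>f. schwartz f \<longrightarrow>
        (\<forall>M. (\<forall>x bs. set bs \<subseteq> Basis \<and> length bs \<le> m \<longrightarrow>
                 (1 + norm x) ^ k * norm (dirderivs bs f x) \<le> M)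
             \<longrightarrow> norm (u f) \<le> C * M))"

definition test_fun :: "('a::euclidean_space \<Rightarrow> complex) \<Rightarrow> bool" where
  "test_fun chi \<longleftrightarrow> schwartz chi \<and> bounded {x. chi x \<noteq> 0}"

text \<open>Fourier transform of the compactly supported distribution chiu, evaluated at \<xi>:
  F[chiu](\<xi>) = u(y \<mapsto> chi(y) e^{-i y\<cdot>\<xi>}).\<close>
definition fourier_cutoff ::
  "(('a::euclidean_space \<Rightarrow> complex) \<Rightarrow> complex) \<Rightarrow> ('a \<Rightarrow> complex) \<Rightarrow> 'a \<Rightarrow> complex" where
  "fourier_cutoff u chi \<xi> = u (\<lambda>y. chi y * exp (- \<i> * complex_of_real (y \<bullet> \<xi>)))"

definition conic_nbhd :: "'a::euclidean_space set \<Rightarrow> 'a \<Rightarrow> bool" where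
  "conic_nbhd \<Gamma> \<xi>0 \<longleftrightarrow> open \<Gamma> \<and> \<xi>0 \<in> \<Gamma> \<and> (\<forall>\<xi>\<in>\<Gamma>. \<forall>t>0. t *\<^sub>R \<xi> \<in> \<Gamma>)"

definition not_in_WF :: "(('a::euclidean_space \<Rightarrow> complex) \<Rightarrow> complex) \<Rightarrow> 'a \<Rightarrow> 'a \<Rightarrow> bool" where
  "not_in_WF u x0 \<xi>0 \<longleftrightarrow>
     (\<exists>chi \<Gamma>. test_fun chi \<and> (\<exists>e>0. \<forall>y\<in>ball x0 e. chi y = 1) \<and> conic_nbhd \<Gamma> \<xi>0 \<and>
        (\<forall>N::nat. \<exists>C>0. \<forall>\<xi>\<in>\<Gamma>. norm (fourier_cutoff u chi \<xi>) \<le> C * (1 + norm \<xi>) powr (- real N)))"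

definition wave_packet ::
  "('a::euclidean_space \<Rightarrow> complex) \<Rightarrow> (('a \<Rightarrow> complex) \<Rightarrow> complex) \<Rightarrow> 'a \<Rightarrow> 'a \<Rightarrow> complex" where
  "wave_packet \<phi> u x \<xi> = u (\<lambda>y. cnj (\<phi> (y - x)) * exp (- \<i> * complex_of_real (y \<bullet> \<xi>)))"

definition scaled :: "real \<Rightarrow> ('a::euclidean_space \<Rightarrow> complex) \<Rightarrow> 'a \<Rightarrow> complex" where
  "scaled lam \<phi> x = complex_of_real (lam powr (real DIM('a) / 4)) * \<phi> (sqrt lam *\<^sub>R x)"

definition wp_decay :: "('a::euclidean_space \<Rightarrow> complex) \<Rightarrow> (('a \<Rightarrow> complex) \<Rightarrow> complex)
    \<Rightarrow> 'a set \<Rightarrow> 'a set \<Rightarrow> bool" where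
  "wp_decay \<phi> u K \<Gamma> \<longleftrightarrow>
     (\<forall>(N::nat) (a::real). a \<ge> 1 \<longrightarrow> (\<exists>C>0. \<forall>lam x \<xi>. lam \<ge> 1 \<longrightarrow> x \<in> K \<longrightarrow> \<xi> \<in> \<Gamma> \<longrightarrow>
         inverse a \<le> norm \<xi> \<longrightarrow> norm \<xi> \<le> a \<longrightarrow>
         norm (wave_packet (scaled lam \<phi>) u x (lam *\<^sub>R \<xi>)) \<le> C * lam powr (- real N)))"

end

theory Submission
  imports Defs
begin

text \<open>
  Write \<open>shift f x \<zeta>\<close> for the function \<open>y \<mapsto> f (y - x) e\<^sup>-\<^sup>i\<^sup>y\<^sup>\<zeta>\<close>.  Both the wave packet transform
  and the Fourier transform of \<open>chi u\<close> are values of \<open>u\<close> on such shifts, and \<open>u\<close> commutes with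
  integrals of families of shifts against rapidly decreasing weights.

  (i) implies (iii): away from \<open>x0\<close> the scaled window is \<open>O(\<lambda>\<^sup>-\<^sup>N)\<close> in every Schwartz seminorm.
  On the support of \<open>chi\<close>, Fourier inversion of the window writes the wave packet as an integral over
  \<open>\<eta>\<close> of \<open>F[chi u](\<lambda>\<xi> - \<surd>\<lambda> \<eta>)\<close> against the rapidly decreasing Fourier transform of the window; the
  frequency stays in \<open>\<Gamma>\<close> as long as \<open>|\<eta>| \<le> \<epsilon> \<surd>\<lambda>\<close>.

  (ii) implies (i): a modulation of the window moves the frequency by \<open>O(\<surd>\<lambda>)\<close> only, so, as the
  Fourier transform is injective, the window \<open>k\<close> may be assumed to have nonzero integral \<open>c\<close>.
  For \<open>m\<close> supported near \<open>x0\<close>, averaging the window against \<open>m\<close> gives a negligible quantity, while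
  it differs from \<open>c m\<close> by an integral of differences \<open>m(y) - m(y - z/\<surd>\<lambda>)\<close>.  These are
  \<open>\<lambda>\<^sup>-\<^sup>1\<^sup>/\<^sup>2\<close> times derivatives of \<open>m\<close>, so each step of an induction gains a factor \<open>\<lambda>\<^sup>-\<^sup>1\<^sup>/\<^sup>2\<close>
  for all such \<open>m\<close> at once.
\<close>

text \<open>The obstacle in (ii) implies (i) is that decay is known only for \<open>x\<close> near
  \<open>x0\<close> and for frequencies in a cone, so an inversion formula over the whole phase
  space cannot be used. The averaging argument stays at one frequency and uses only positions near
  \<open>x0\<close>; a nonzero integral is what makes \<open>R ^ n * k (R y)\<close> act like a
  multiple of the delta function at scale \<open>1 / R\<close>, where \<open>R = sqrt lam\<close>
  and \<open>n\<close> is the dimension. Frequencies have size \<open>R ^ 2\<close>, while the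
  window blurs them by \<open>R\<close> only, so relative to the cone a modulation is of size
  \<open>1 / R\<close>. The normalisation \<open>lam powr (n / 4)\<close> lies between 1 and
  \<open>R ^ n\<close> and disappears in the freedom to choose \<open>N\<close>. Since
  \<open>u\<close> is a linear functional bounded by a single seminorm, crude estimates lose fixed
  powers of \<open>R\<close>; these depend on the order of \<open>u\<close> and on the dimension
  alone and are paid for by taking more decay. Derivatives are iterated one-dimensional derivatives
  along the axes, so estimates of differences run along axis-parallel paths.\<close>

section \<open>Smooth functions\<close>

text \<open>Only partial derivatives along the basis are required to exist, so a smooth function in this
  sense need not be continuous; continuity is only available for Schwartz functions.\<close>

definition smooth :: "('a::euclidean_space \<Rightarrow> complex) \<Rightarrow> bool" where
  "smooth f \<longleftrightarrow> (\<forall>bs b x. set bs \<subseteq> Basis \<longrightarrow> b \<in> Basis \<longrightarrow>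
     ((\<lambda>t. dirderivs bs f (x + t *\<^sub>R b)) has_vector_derivative dirderivs (b # bs) f x) (at 0))"

text \<open>The derivative is named by a witness \<open>g\<close> for all points at once, so that
  the rules below compose like equations; \<open>has_partialD\<close> converts back to
  \<open>dirderivs\<close>.\<close>

definition has_partial :: "('a::euclidean_space \<Rightarrow> complex) \<Rightarrow> 'a \<Rightarrow> ('a \<Rightarrow> complex) \<Rightarrow> bool" where
  "has_partial f b g \<longleftrightarrow> (\<forall>x. ((\<lambda>t. f (x + t *\<^sub>R b)) has_vector_derivative g x) (at 0))"

text \<open>The bound is pointwise in \<open>y\<close>, so that weights such as
  \<open>(1 + norm y) ^ k\<close> can be carried inside \<open>M\<close> and Schwartz seminorms need
  no suprema.\<close>

definition jet_bound :: "nat \<Rightarrow> ('a::euclidean_space \<Rightarrow> complex) \<Rightarrow> 'a \<Rightarrow> real \<Rightarrow> bool" where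
  "jet_bound m f y M \<longleftrightarrow> (\<forall>bs. set bs \<subseteq> Basis \<and> length bs \<le> m \<longrightarrow> norm (dirderivs bs f y) \<le> M)"

lemma has_partialD: "has_partial f b g \<Longrightarrow> dirderivs [b] f = g"
  by (auto simp: has_partial_def vector_derivative_at fun_eq_iff)

text \<open>Differentiability at 0 is required for every base point, so moving the base point along
  the line gives the derivative at every \<open>s\<close>.\<close>

lemma has_partial_line:
  assumes "has_partial f b g"
  shows "((\<lambda>t. f (x + t *\<^sub>R b)) has_vector_derivative g (x + s *\<^sub>R b)) (at s within T)"
proof -
  have *: "((\<lambda>t. f ((x + s *\<^sub>R b) + t *\<^sub>R b)) has_vector_derivative g (x + s *\<^sub>R b)) (at 0)"
    using assms by (simp add: has_partial_def)
  have "((\<lambda>t. t - s) has_vector_derivative 1) (at s)"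
    by (auto intro!: derivative_eq_intros)
  from vector_diff_chain_at[OF this, of "\<lambda>t. f ((x + s *\<^sub>R b) + t *\<^sub>R b)"] *
  have "((\<lambda>t. f (x + t *\<^sub>R b)) has_vector_derivative g (x + s *\<^sub>R b)) (at s)"
    by (simp add: o_def algebra_simps)
  then show ?thesis by (rule has_vector_derivative_at_within)
qed

lemma dirderivs_append: "dirderivs (bs @ cs) f = dirderivs bs (dirderivs cs f)"
  by (induction bs) auto

lemma smooth_dirderivs: "smooth f \<Longrightarrow> set cs \<subseteq> Basis \<Longrightarrow> smooth (dirderivs cs f)"
  unfolding smooth_def dirderivs_append[symmetric] append_Cons[symmetric] by (metis set_append Un_least append_Cons)

lemma smooth_has_partial:
  assumes "smooth f" "b \<in> Basis" shows "has_partial f b (dirderivs [b] f)"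
proof -
  have "((\<lambda>t. dirderivs [] f (x + t *\<^sub>R b)) has_vector_derivative dirderivs [b] f x) (at 0)" for x
    using assms unfolding smooth_def by (metis empty_set empty_subsetI)
  then show ?thesis by (simp add: has_partial_def)
qed

text \<open>Smoothness is the largest property passed on to partial derivatives: membership in a
  class closed under them suffices, and iterated derivatives never have to be computed.\<close>

lemma smooth_coinduct:
  assumes "X f" and step: "\<And>f b. X f \<Longrightarrow> b \<in> Basis \<Longrightarrow> \<exists>g. X g \<and> has_partial f b g"
  shows "smooth f"
proof -
  have X: "X (dirderivs bs f)" if "set bs \<subseteq> Basis" for bs
    using that
  proof (induction bs)
    case Nil then show ?case using assms(1) by simp
  next
    case (Cons b bs)
    then obtain g where "X g" "has_partial (dirderivs bs f) b g" using step by force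
    then show ?case using has_partialD[of "dirderivs bs f" b g] by simp
  qed
  show ?thesis unfolding smooth_def
  proof (intro allI impI)
    fix bs :: "'a list" and b x :: 'a assume "set bs \<subseteq> Basis" "b \<in> Basis"
    with X step obtain g where g: "has_partial (dirderivs bs f) b g" by meson
    then show "((\<lambda>t. dirderivs bs f (x + t *\<^sub>R b)) has_vector_derivative dirderivs (b # bs) f x) (at 0)"
      using has_partialD[OF g] by (simp add: has_partial_def)
  qed
qed

section \<open>Calculus of partial derivatives\<close>

lemma has_partial_add:
  "has_partial f b f' \<Longrightarrow> has_partial g b g' \<Longrightarrow> has_partial (\<lambda>x. f x + g x) b (\<lambda>x. f' x + g' x)"
  by (auto simp: has_partial_def intro!: has_vector_derivative_add)

lemma has_partial_mult:
  assumes "has_partial f b f'" "has_partial g b g'"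
  shows "has_partial (\<lambda>x. f x * g x) b (\<lambda>x. f' x * g x + f x * g' x)"
  unfolding has_partial_def
proof
  fix x
  show "((\<lambda>t. f (x + t *\<^sub>R b) * g (x + t *\<^sub>R b)) has_vector_derivative f' x * g x + f x * g' x) (at 0)"
    using has_vector_derivative_mult[OF assms(1)[unfolded has_partial_def, rule_format, of x]
      assms(2)[unfolded has_partial_def, rule_format, of x]]
    by (simp add: algebra_simps)
qed

lemma has_partial_const: "has_partial (\<lambda>x. c) b (\<lambda>x. 0)"
  by (simp add: has_partial_def)

lemma has_partial_cmult: "has_partial f b f' \<Longrightarrow> has_partial (\<lambda>x. c * f x) b (\<lambda>x. c * f' x)"
  using has_partial_mult[OF has_partial_const] by simp

lemma has_partial_cnj: "has_partial f b f' \<Longrightarrow> has_partial (\<lambda>x. cnj (f x)) b (\<lambda>x. cnj (f' x))"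
  by (simp add: has_partial_def has_vector_derivative_cnj)

lemma has_partial_translate:
  assumes "has_partial f b f'" shows "has_partial (\<lambda>y. f (y - x)) b (\<lambda>y. f' (y - x))"
  unfolding has_partial_def
proof
  fix y
  show "((\<lambda>t. f (y + t *\<^sub>R b - x)) has_vector_derivative f' (y - x)) (at 0)"
    using assms[unfolded has_partial_def, rule_format, of "y - x"] by (simp add: algebra_simps)
qed

lemma has_partial_dilate:
  assumes "has_partial f b f'" shows "has_partial (\<lambda>y. f (R *\<^sub>R y)) b (\<lambda>y. of_real R * f' (R *\<^sub>R y))"
  unfolding has_partial_def
proof
  fix y
  have 1: "((\<lambda>t. f (R *\<^sub>R y + t *\<^sub>R b)) has_vector_derivative f' (R *\<^sub>R y)) (at (R * 0))"
    using assms by (simp add: has_partial_def)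
  have 2: "((\<lambda>t. R * t) has_vector_derivative R) (at 0)"
    by (auto intro!: derivative_eq_intros simp: has_real_derivative_iff_has_vector_derivative[symmetric])
  show "((\<lambda>t. f (R *\<^sub>R (y + t *\<^sub>R b))) has_vector_derivative of_real R * f' (R *\<^sub>R y)) (at 0)"
    using vector_diff_chain_at[OF 2 1] by (simp add: o_def algebra_simps scaleR_conv_of_real)
qed

section \<open>Closure properties of smooth functions\<close>

lemma smooth_add:
  fixes f g :: "'a::euclidean_space \<Rightarrow> complex"
  assumes "smooth f" "smooth g" shows "smooth (\<lambda>x. f x + g x)"
proof (rule smooth_coinduct[where X="\<lambda>h::'a \<Rightarrow> complex. \<exists>f g. smooth f \<and> smooth g \<and> h = (\<lambda>x. f x + g x)"])
  show "\<exists>f' g'. smooth f' \<and> smooth g' \<and> (\<lambda>x. f x + g x) = (\<lambda>x. f' x + g' x)" using assms by blast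
next
  fix h :: "'a \<Rightarrow> complex" and b :: 'a assume "\<exists>f g. smooth f \<and> smooth g \<and> h = (\<lambda>x. f x + g x)" and b: "b \<in> Basis"
  then obtain f g where "smooth f" "smooth g" and h: "h = (\<lambda>x. f x + g x)" by blast
  then have "has_partial h b (\<lambda>x. dirderivs [b] f x + dirderivs [b] g x)"
    using b by (auto intro!: has_partial_add smooth_has_partial simp del: dirderivs.simps)
  then show "\<exists>g. (\<exists>f ga. smooth f \<and> smooth ga \<and> g = (\<lambda>x. f x + ga x)) \<and> has_partial h b g"
    using smooth_dirderivs[OF \<open>smooth f\<close>, of "[b]"] smooth_dirderivs[OF \<open>smooth g\<close>, of "[b]"] b
    by (metis empty_set empty_subsetI insert_subset list.simps(15))
qed

text \<open>By the Leibniz rule the partial derivatives of a product are sums of products, so this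
  class is closed under differentiation: it is the invariant for \<open>smooth_mult\<close>.\<close>

inductive product_sum :: "('a::euclidean_space \<Rightarrow> complex) \<Rightarrow> bool" where
  mult: "smooth f \<Longrightarrow> smooth g \<Longrightarrow> product_sum (\<lambda>x. f x * g x)"
| add: "product_sum f \<Longrightarrow> product_sum g \<Longrightarrow> product_sum (\<lambda>x. f x + g x)"

lemma smooth_partial: "smooth f \<Longrightarrow> b \<in> Basis \<Longrightarrow> smooth (dirderivs [b] f)"
  by (rule smooth_dirderivs) auto

lemma smooth_mult:
  fixes f g :: "'a::euclidean_space \<Rightarrow> complex"
  assumes "smooth f" "smooth g" shows "smooth (\<lambda>x. f x * g x)"
proof (rule smooth_coinduct[where X="product_sum :: ('a \<Rightarrow> complex) \<Rightarrow> bool"])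
  show "product_sum (\<lambda>x. f x * g x)" using assms by (rule product_sum.mult)
next
  fix h :: "'a \<Rightarrow> complex" and b :: 'a assume "product_sum h" and b: "b \<in> Basis"
  then show "\<exists>g. product_sum g \<and> has_partial h b g"
  proof induction
    case (mult f g)
    have "has_partial (\<lambda>x. f x * g x) b (\<lambda>x. dirderivs [b] f x * g x + f x * dirderivs [b] g x)"
      by (intro has_partial_mult smooth_has_partial mult b)
    moreover have "product_sum (\<lambda>x. dirderivs [b] f x * g x + f x * dirderivs [b] g x)"
      by (intro product_sum.intros smooth_partial mult b)
    ultimately show ?case by blast
  next
    case (add f g)
    then obtain f' g' where "product_sum f'" "has_partial f b f'" "product_sum g'" "has_partial g b g'"
      using b by auto
    then show ?case by (intro exI[of _ "\<lambda>x. f' x + g' x"] conjI product_sum.add has_partial_add)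
  qed
qed

text \<open>The image of the smooth functions under \<open>T\<close> is the invariant class. The
  step may return any smooth \<open>g\<close>, which leaves room for the factor \<open>R\<close>
  that a dilation produces.\<close>

lemma smooth_transfer:
  fixes f :: "'a::euclidean_space \<Rightarrow> complex" and T :: "('a \<Rightarrow> complex) \<Rightarrow> 'a \<Rightarrow> complex"
  assumes "smooth f"
    and step: "\<And>f b. smooth f \<Longrightarrow> b \<in> Basis \<Longrightarrow> \<exists>g. smooth g \<and> has_partial (T f) b (T g)"
  shows "smooth (T f)"
proof (rule smooth_coinduct[where X="\<lambda>h. h \<in> T ` Collect smooth" and f="T f"])
  show "T f \<in> T ` Collect smooth" by (simp add: assms(1))
  show "\<exists>g. g \<in> T ` Collect smooth \<and> has_partial h b g" if "h \<in> T ` Collect smooth" "b \<in> Basis" for h b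
    using that step by (auto simp: image_iff; metis)
qed

lemma smooth_const: "smooth (\<lambda>x::'a::euclidean_space. c)"
proof (rule smooth_coinduct[where X="\<lambda>h. h \<in> range (\<lambda>c x::'a. c)"])
  show "\<exists>g. g \<in> range (\<lambda>c x::'a. c) \<and> has_partial h b g" if "h \<in> range (\<lambda>c x::'a. c)" for h b
    using that by (auto simp: image_iff intro!: exI[of _ "\<lambda>x. 0"] has_partial_const)
qed simp

lemma smooth_cmult: "smooth f \<Longrightarrow> smooth (\<lambda>x. c * f x)"
  by (rule smooth_mult[OF smooth_const])

lemma smooth_diff: "smooth f \<Longrightarrow> smooth g \<Longrightarrow> smooth (\<lambda>x. f x - g x)"
  using smooth_add[OF _ smooth_cmult[of g "-1"], of f] by simp

lemma smooth_cnj: "smooth f \<Longrightarrow> smooth (\<lambda>x. cnj (f x))"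
  by (rule smooth_transfer[where T="\<lambda>f x. cnj (f x)"])
    (use has_partial_cnj smooth_has_partial smooth_partial in blast)+

text \<open>For operators that commute exactly with partial derivatives: translation, conjugation,
  multiplication by a constant. Dilation collects powers of \<open>R\<close> and has its own
  induction.\<close>

lemma dirderivs_eq:
  assumes "smooth f" and step: "\<And>f b. smooth f \<Longrightarrow> b \<in> Basis \<Longrightarrow> has_partial (T f) b (T (dirderivs [b] f))"
    and "set bs \<subseteq> Basis"
  shows "dirderivs bs (T f) = T (dirderivs bs f)"
  using assms(3)
proof (induction bs)
  case (Cons b bs)
  then show ?case
    using has_partialD[OF step[OF smooth_dirderivs[OF assms(1), of bs], of b]] by simp
qed simp

section \<open>Iterated derivatives of transformed functions\<close>

lemma dirderivs_translate:
  assumes "smooth f" "set bs \<subseteq> Basis"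
  shows "dirderivs bs (\<lambda>y. f (y - x)) = (\<lambda>y. dirderivs bs f (y - x))"
  by (rule dirderivs_eq[where T="\<lambda>f y. f (y - x)", OF assms(1) _ assms(2)])
    (rule has_partial_translate, rule smooth_has_partial)

lemma dirderivs_cnj:
  assumes "smooth f" "set bs \<subseteq> Basis"
  shows "dirderivs bs (\<lambda>y. cnj (f y)) = (\<lambda>y. cnj (dirderivs bs f y))"
  by (rule dirderivs_eq[where T="\<lambda>f y. cnj (f y)", OF assms(1) _ assms(2)])
    (rule has_partial_cnj, rule smooth_has_partial)

lemma dirderivs_cmult:
  assumes "smooth f" "set bs \<subseteq> Basis"
  shows "dirderivs bs (\<lambda>y. c * f y) = (\<lambda>y. c * dirderivs bs f y)"
  by (rule dirderivs_eq[where T="\<lambda>f y. c * f y", OF assms(1) _ assms(2)])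
    (rule has_partial_cmult, rule smooth_has_partial)

lemma dirderivs_add:
  assumes "smooth f" "smooth g" "set bs \<subseteq> Basis"
  shows "dirderivs bs (\<lambda>y. f y + g y) = (\<lambda>y. dirderivs bs f y + dirderivs bs g y)"
  using assms(3)
proof (induction bs)
  case (Cons b bs)
  then show ?case
    using has_partialD[OF has_partial_add[OF smooth_has_partial[OF smooth_dirderivs[OF assms(1), of bs], of b]
       smooth_has_partial[OF smooth_dirderivs[OF assms(2), of bs], of b]]] by simp
qed simp

lemma dirderivs_diff:
  assumes "smooth f" "smooth g" "set bs \<subseteq> Basis"
  shows "dirderivs bs (\<lambda>y. f y - g y) = (\<lambda>y. dirderivs bs f y - dirderivs bs g y)"
  using dirderivs_add[OF assms(1) smooth_cmult[OF assms(2), of "-1"] assms(3)]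
    dirderivs_cmult[OF assms(2,3), of "-1"] by simp

lemma dirderivs_dilate:
  assumes "smooth f" "set bs \<subseteq> Basis"
  shows "dirderivs bs (\<lambda>y. f (R *\<^sub>R y)) = (\<lambda>y. of_real R ^ length bs * dirderivs bs f (R *\<^sub>R y))"
  using assms(2)
proof (induction bs)
  case (Cons b bs)
  then have "has_partial (\<lambda>y. of_real R ^ length bs * dirderivs bs f (R *\<^sub>R y)) b
     (\<lambda>y. of_real R ^ length bs * (of_real R * dirderivs (b # bs) f (R *\<^sub>R y)))"
    using smooth_has_partial[OF smooth_dirderivs[OF assms(1), of bs], of b]
    by (intro has_partial_cmult has_partial_dilate) auto
  from has_partialD[OF this] Cons show ?case by (simp add: algebra_simps)
qed simp

lemma smooth_translate: "smooth f \<Longrightarrow> smooth (\<lambda>y. f (y - x))"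
  by (rule smooth_transfer[where T="\<lambda>f y. f (y - x)"])
    (use has_partial_translate smooth_has_partial smooth_partial in blast)+

lemma smooth_dilate:
  fixes f :: "'a::euclidean_space \<Rightarrow> complex"
  assumes "smooth f" shows "smooth (\<lambda>y. f (R *\<^sub>R y))"
proof (rule smooth_transfer[where T="\<lambda>f y. f (R *\<^sub>R y)", OF assms])
  fix f :: "'a \<Rightarrow> complex" and b :: 'a assume "smooth f" "b \<in> Basis"
  then show "\<exists>g. smooth g \<and> has_partial (\<lambda>y. f (R *\<^sub>R y)) b (\<lambda>y. g (R *\<^sub>R y))"
    by (intro exI[of _ "\<lambda>y. of_real R * dirderivs [b] f y"] conjI smooth_cmult smooth_partial
        has_partial_dilate smooth_has_partial)
qed

section \<open>Jets\<close>

lemma jet_boundD: "jet_bound m f y M \<Longrightarrow> set bs \<subseteq> Basis \<Longrightarrow> length bs \<le> m \<Longrightarrow> norm (dirderivs bs f y) \<le> M"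
  by (simp add: jet_bound_def)

lemma jet_bound_norm: "jet_bound m f y M \<Longrightarrow> norm (f y) \<le> M"
  using jet_boundD[of m f y M "[]"] by simp

lemma jet_bound_nonneg: "jet_bound m f y M \<Longrightarrow> 0 \<le> M"
  using jet_bound_norm norm_ge_zero order_trans by blast

lemma jet_bound_mono: "jet_bound m f y M \<Longrightarrow> m' \<le> m \<Longrightarrow> M \<le> M' \<Longrightarrow> jet_bound m' f y M'"
  by (force simp: jet_bound_def)

lemma jet_bound_0: "jet_bound 0 f y M \<longleftrightarrow> norm (f y) \<le> M"
  by (auto simp: jet_bound_def)

text \<open>Derivatives are split off at the inner end of the list, the one applied to
  \<open>f\<close> first. Bounds on \<open>f\<close> thus reduce to bounds on its first partials,
  with no appeal to the symmetry of mixed derivatives.\<close>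

lemma jet_bound_Suc:
  "jet_bound (Suc m) f y M \<longleftrightarrow> norm (f y) \<le> M \<and> (\<forall>b\<in>Basis. jet_bound m (dirderivs [b] f) y M)"
proof
  assume *: "jet_bound (Suc m) f y M"
  have "jet_bound m (dirderivs [b] f) y M" if "b \<in> Basis" for b
    unfolding jet_bound_def dirderivs_append[symmetric]
    using * that by (auto intro!: jet_boundD)
  with * show "norm (f y) \<le> M \<and> (\<forall>b\<in>Basis. jet_bound m (dirderivs [b] f) y M)"
    using jet_bound_norm by blast
next
  assume *: "norm (f y) \<le> M \<and> (\<forall>b\<in>Basis. jet_bound m (dirderivs [b] f) y M)"
  show "jet_bound (Suc m) f y M" unfolding jet_bound_def
  proof (intro allI impI)
    fix bs :: "'a list" assume bs: "set bs \<subseteq> Basis \<and> length bs \<le> Suc m"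
    show "norm (dirderivs bs f y) \<le> M"
    proof (cases bs rule: rev_cases)
      case Nil then show ?thesis using * by simp
    next
      case (snoc cs c)
      then show ?thesis using * bs jet_boundD[of m "dirderivs [c] f" y M cs]
        by (auto simp: dirderivs_append)
    qed
  qed
qed

lemma jet_bound_add:
  "smooth f \<Longrightarrow> smooth g \<Longrightarrow> jet_bound m f y A \<Longrightarrow> jet_bound m g y B \<Longrightarrow> jet_bound m (\<lambda>y. f y + g y) y (A + B)"
  unfolding jet_bound_def by (auto simp: dirderivs_add intro!: norm_triangle_mono)

lemma jet_bound_diff:
  "smooth f \<Longrightarrow> smooth g \<Longrightarrow> jet_bound m f y A \<Longrightarrow> jet_bound m g y B \<Longrightarrow> jet_bound m (\<lambda>y. f y - g y) y (A + B)"
  unfolding jet_bound_def by (auto simp: dirderivs_diff intro!: order_trans[OF norm_triangle_ineq4] add_mono)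

lemma jet_bound_cmult:
  "smooth f \<Longrightarrow> jet_bound m f y A \<Longrightarrow> jet_bound m (\<lambda>y. c * f y) y (norm c * A)"
  unfolding jet_bound_def by (auto simp: dirderivs_cmult norm_mult intro!: mult_left_mono)

text \<open>Every application of the Leibniz rule doubles the number of terms, whence
  \<open>2 ^ m\<close>; no binomial coefficients are tracked.\<close>

lemma jet_bound_mult:
  assumes "smooth f" "smooth g" "jet_bound m f y A" "jet_bound m g y B"
  shows "jet_bound m (\<lambda>y. f y * g y) y (2 ^ m * A * B)"
  using assms
proof (induction m arbitrary: f g)
  case 0
  then show ?case by (auto simp: jet_bound_0 norm_mult intro!: mult_mono intro: order_trans[OF norm_ge_zero])
next
  case (Suc m)
  note nn = jet_bound_nonneg[OF Suc.prems(3)] jet_bound_nonneg[OF Suc.prems(4)]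
  have "norm (f y * g y) \<le> 1 * (A * B)"
    using Suc.prems nn by (simp add: norm_mult mult_mono jet_bound_norm)
  also have "\<dots> \<le> 2 ^ Suc m * (A * B)" using nn by (intro mult_right_mono one_le_power) auto
  finally have 1: "norm (f y * g y) \<le> 2 ^ Suc m * A * B" by (simp add: mult_ac)
  have "jet_bound m (dirderivs [b] (\<lambda>y. f y * g y)) y (2 ^ Suc m * A * B)" if b: "b \<in> Basis" for b
  proof -
    have eq: "dirderivs [b] (\<lambda>y. f y * g y) = (\<lambda>y. dirderivs [b] f y * g y + f y * dirderivs [b] g y)"
      by (rule has_partialD, rule has_partial_mult; rule smooth_has_partial; fact)
    have "jet_bound m (\<lambda>y. dirderivs [b] f y * g y) y (2 ^ m * A * B)"
      "jet_bound m (\<lambda>y. f y * dirderivs [b] g y) y (2 ^ m * A * B)"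
      using Suc.prems b by (intro Suc.IH smooth_partial; auto simp: jet_bound_Suc simp del: dirderivs.simps
        intro: jet_bound_mono[of "Suc m" _ _ _ m])+
    then have "jet_bound m (\<lambda>y. dirderivs [b] f y * g y + f y * dirderivs [b] g y) y (2 ^ m * A * B + 2 ^ m * A * B)"
      using Suc.prems(1,2) b by (intro jet_bound_add smooth_mult smooth_partial) auto
    then show ?thesis unfolding eq by (simp add: mult_ac)
  qed
  with 1 show ?case by (auto simp: jet_bound_Suc simp del: dirderivs.simps)
qed

lemma jet_bound_translate: "smooth f \<Longrightarrow> jet_bound m (\<lambda>y. f (y - x)) y M \<longleftrightarrow> jet_bound m f (y - x) M"
  by (auto simp: jet_bound_def dirderivs_translate)

lemma jet_bound_cnj: "smooth f \<Longrightarrow> jet_bound m (\<lambda>y. cnj (f y)) y M \<longleftrightarrow> jet_bound m f y M"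
  by (auto simp: jet_bound_def dirderivs_cnj)

lemma jet_bound_dilate:
  assumes "smooth f" "1 \<le> R" "jet_bound m f (R *\<^sub>R y) M"
  shows "jet_bound m (\<lambda>y. f (R *\<^sub>R y)) y (R ^ m * M)"
  unfolding jet_bound_def
proof (intro allI impI)
  fix bs :: "'a list" assume bs: "set bs \<subseteq> Basis \<and> length bs \<le> m"
  have "R ^ length bs * norm (dirderivs bs f (R *\<^sub>R y)) \<le> R ^ m * M"
    using assms bs by (intro mult_mono power_increasing jet_boundD) auto
  then show "norm (dirderivs bs (\<lambda>y. f (R *\<^sub>R y)) y) \<le> R ^ m * M"
    using assms bs by (simp add: dirderivs_dilate norm_mult norm_power)
qed

text \<open>Since \<open>S\<close> is open, a line through a point of \<open>S\<close> stays in
  \<open>S\<close> near that point, and each derivative is again zero on all of \<open>S\<close>.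
  This is the locality used for the supports of cutoffs.\<close>

lemma jet_bound_vanishing:
  assumes "open S" "y \<in> S" "\<And>y. y \<in> S \<Longrightarrow> f y = 0" "0 \<le> M"
  shows "jet_bound m f y M"
proof -
  have "dirderivs bs f y = 0" if "y \<in> S" "set bs \<subseteq> Basis" for bs y
    using that
  proof (induction bs arbitrary: y)
    case Nil then show ?case using assms by simp
  next
    case (Cons b bs)
    have "open ((\<lambda>t. y + t *\<^sub>R b) -` S)" by (intro continuous_open_vimage assms continuous_intros)
    moreover have "0 \<in> (\<lambda>t. y + t *\<^sub>R b) -` S" using Cons by simp
    moreover have "((\<lambda>t::real. 0::complex) has_vector_derivative 0) (at 0)" by simp
    ultimately have "((\<lambda>t. dirderivs bs f (y + t *\<^sub>R b)) has_vector_derivative 0) (at 0)"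
      using Cons by (elim has_vector_derivative_transform_within_open) auto
    then show ?case by (simp add: vector_derivative_at)
  qed
  then show ?thesis using assms by (auto simp: jet_bound_def)
qed

section \<open>Schwartz functions\<close>

lemma finite_basis_lists: "finite {bs. set bs \<subseteq> (Basis :: 'a::euclidean_space set) \<and> length bs \<le> m}"
  by (rule finite_lists_length_le) simp

lemma schwartz_smooth: "schwartz f \<Longrightarrow> smooth f"
  by (auto simp: schwartz_def smooth_def)

text \<open>There are finitely many derivative lists of length at most \<open>m\<close>, so the sum
  of their individual constants serves for all of them.\<close>

lemma schwartz_jet:
  fixes f :: "'a::euclidean_space \<Rightarrow> complex"
  assumes "schwartz f"
  obtains C where "0 \<le> C" "\<And>y. jet_bound m f y (C / (1 + norm y) ^ k)"
proof -
  let ?B = "{bs. set bs \<subseteq> (Basis :: 'a set) \<and> length bs \<le> m}"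
  have "\<forall>bs\<in>?B. \<exists>C. \<forall>x. (1 + norm x) ^ k * norm (dirderivs bs f x) \<le> C"
    using assms by (auto simp: schwartz_def)
  then obtain C where C: "\<And>bs x. bs \<in> ?B \<Longrightarrow> (1 + norm x) ^ k * norm (dirderivs bs f x) \<le> C bs"
    by metis
  have nn: "0 \<le> C bs" if "bs \<in> ?B" for bs
    by (rule order_trans[OF _ C[OF that, of 0]]) simp
  have "(1 + norm x) ^ k * norm (dirderivs bs f x) \<le> sum C ?B" if "bs \<in> ?B" for bs x
    using C[OF that, of x] member_le_sum[of bs ?B C, OF that _ finite_basis_lists] nn
    by (meson DiffD1 order_trans)
  then have "jet_bound m f y (sum C ?B / (1 + norm y) ^ k)" for y
    unfolding jet_bound_def by (simp add: pos_le_divide_eq add_pos_nonneg mult.commute)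
  moreover have "0 \<le> sum C ?B" by (intro sum_nonneg nn)
  ultimately show thesis using that by blast
qed

lemma schwartzI:
  assumes "smooth f" "\<And>m k. \<exists>C. \<forall>y. jet_bound m f y (C / (1 + norm y) ^ k)"
  shows "schwartz f"
  unfolding schwartz_def
proof (intro conjI allI impI)
  fix k and bs :: "'a list" assume bs: "set bs \<subseteq> Basis"
  obtain C where "jet_bound (length bs) f y (C / (1 + norm y) ^ k)" for y using assms(2) by blast
  then have "norm (dirderivs bs f y) \<le> C / (1 + norm y) ^ k" for y
    using bs by (auto intro: jet_boundD)
  then have "(1 + norm y) ^ k * norm (dirderivs bs f y) \<le> C" for y
    by (simp add: pos_le_divide_eq add_pos_nonneg mult.commute)
  then show "\<exists>C. \<forall>x. (1 + norm x) ^ k * norm (dirderivs bs f x) \<le> C" by blast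
qed (use assms(1) in \<open>auto simp: smooth_def\<close>)

section \<open>Phase-space shifts\<close>

definition wave :: "'a::euclidean_space \<Rightarrow> 'a \<Rightarrow> complex" where
  "wave \<zeta> y = exp (- \<i> * complex_of_real (y \<bullet> \<zeta>))"

definition shift :: "('a::euclidean_space \<Rightarrow> complex) \<Rightarrow> 'a \<Rightarrow> 'a \<Rightarrow> 'a \<Rightarrow> complex" where
  "shift f x \<zeta> y = f (y - x) * wave \<zeta> y"

lemma norm_wave [simp]: "norm (wave \<zeta> y) = 1"
  by (simp add: wave_def norm_exp_eq_Re)

lemma wave_add: "wave (\<zeta> + \<eta>) y = wave \<zeta> y * wave \<eta> y"
  by (simp add: wave_def inner_add_right exp_add[symmetric] algebra_simps)

lemma wave_0 [simp]: "wave 0 y = 1" "wave \<zeta> 0 = 1"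
  by (simp_all add: wave_def)

lemma has_partial_wave: "has_partial (wave \<zeta>) b (\<lambda>y. (- \<i> * of_real (b \<bullet> \<zeta>)) * wave \<zeta> y)"
  unfolding has_partial_def
proof
  fix x
  have "((\<lambda>z. exp (- \<i> * (of_real (x \<bullet> \<zeta>) + z * of_real (b \<bullet> \<zeta>)))) has_field_derivative
      (- \<i> * of_real (b \<bullet> \<zeta>)) * wave \<zeta> x) (at (of_real 0))"
    by (auto intro!: derivative_eq_intros simp: wave_def)
  from has_vector_derivative_real_field[OF this]
  show "((\<lambda>t. wave \<zeta> (x + t *\<^sub>R b)) has_vector_derivative (- \<i> * of_real (b \<bullet> \<zeta>)) * wave \<zeta> x) (at 0)"
    by (simp add: wave_def inner_add_left)
qed

lemma smooth_wave: "smooth (wave (\<zeta>::'a::euclidean_space))"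
proof (rule smooth_coinduct[where X="\<lambda>h. h \<in> range (\<lambda>c y. c * wave \<zeta> y)"])
  show "wave \<zeta> \<in> range (\<lambda>c y. c * wave \<zeta> y)" by (rule image_eqI[of _ _ 1]) auto
  show "\<exists>g. g \<in> range (\<lambda>c y. c * wave \<zeta> y) \<and> has_partial h b g" if h: "h \<in> range (\<lambda>c y. c * wave \<zeta> y)" for h b
  proof -
    obtain c where "h = (\<lambda>y. c * wave \<zeta> y)" using h by auto
    then have "has_partial h b (\<lambda>y. (c * (- \<i> * of_real (b \<bullet> \<zeta>))) * wave \<zeta> y)"
      using has_partial_cmult[OF has_partial_wave, of c \<zeta> b] by (simp add: mult.assoc)
    then show ?thesis by blast
  qed
qed

lemma norm_partial_wave: "b \<in> Basis \<Longrightarrow> norm (- \<i> * of_real (b \<bullet> \<zeta>) :: complex) \<le> norm \<zeta>"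
  using Basis_le_norm[of b \<zeta>] by (simp add: norm_mult inner_commute)

lemma jet_bound_wave: "jet_bound m (wave \<zeta>) y ((1 + norm \<zeta>) ^ m)"
proof (induction m)
  case (Suc m)
  have "jet_bound m (dirderivs [b] (wave \<zeta>)) y ((1 + norm \<zeta>) ^ Suc m)" if "b \<in> Basis" for b
  proof -
    have "jet_bound m (\<lambda>y. (- \<i> * of_real (b \<bullet> \<zeta>)) * wave \<zeta> y) y (norm (- \<i> * of_real (b \<bullet> \<zeta>) :: complex) * (1 + norm \<zeta>) ^ m)"
      by (rule jet_bound_cmult[OF smooth_wave Suc])
    moreover have "norm (- \<i> * of_real (b \<bullet> \<zeta>) :: complex) * (1 + norm \<zeta>) ^ m \<le> (1 + norm \<zeta>) * (1 + norm \<zeta>) ^ m"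
      using norm_partial_wave[OF that, of \<zeta>] by (intro mult_right_mono) auto
    ultimately show ?thesis
      unfolding has_partialD[OF has_partial_wave] by (auto intro: jet_bound_mono)
  qed
  then show ?case by (auto simp: jet_bound_Suc one_le_power simp del: dirderivs.simps power_Suc)
qed (simp add: jet_bound_0)

text \<open>The left side is a chord of the unit circle, bounded by the arc
  \<open>\<bar>y \<bullet> \<delta>\<bar>\<close>.\<close>

lemma norm_wave_diff: "norm (wave \<delta> y - 1) \<le> norm \<delta> * norm y"
proof -
  have "norm (wave \<delta> y - 1) = 2 * \<bar>sin (- (y \<bullet> \<delta>) / 2)\<bar>"
    using dist_exp_i_1[of "- (y \<bullet> \<delta>)"] by (simp add: wave_def)
  also have "\<dots> \<le> \<bar>y \<bullet> \<delta>\<bar>" using abs_sin_x_le_abs_x[of "- (y \<bullet> \<delta>) / 2"] by simp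
  also have "\<dots> \<le> norm \<delta> * norm y" using Cauchy_Schwarz_ineq2[of y \<delta>] by (simp add: mult.commute)
  finally show ?thesis .
qed

text \<open>Every term carries a factor \<open>norm \<delta>\<close>: the undifferentiated one by
  the chord bound, at the price of \<open>norm y\<close>, the differentiated ones because each
  derivative of a wave brings down its frequency. The weight \<open>1 + norm y\<close> is later paid
  with one more power of decay.\<close>

lemma jet_bound_wave_diff: "jet_bound m (\<lambda>y. wave \<delta> y - 1) y (norm \<delta> * (1 + norm y) * (1 + norm \<delta>) ^ m)"
proof (cases m)
  case 0
  have "norm \<delta> * norm y \<le> norm \<delta> * (1 + norm y)" by (simp add: mult_left_mono)
  then show ?thesis using norm_wave_diff[of \<delta> y] 0 by (simp add: jet_bound_0)
next
  case (Suc l)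
  have ge: "norm \<delta> * a \<le> norm \<delta> * (1 + norm y) * (1 + norm \<delta>) ^ m" if "0 \<le> a" "a \<le> (1 + norm y) * (1 + norm \<delta>) ^ m" for a
    using that by (simp add: mult.assoc mult_left_mono)
  have p: "1 \<le> (1 + norm \<delta>) ^ m" by (simp add: one_le_power)
  have "norm y * 1 \<le> (1 + norm y) * (1 + norm \<delta>) ^ m"
    using p by (intro mult_mono) auto
  then have 1: "norm (wave \<delta> y - 1) \<le> norm \<delta> * (1 + norm y) * (1 + norm \<delta>) ^ m"
    using order_trans[OF norm_wave_diff ge[of "norm y"]] by simp
  have 2: "jet_bound l (dirderivs [b] (\<lambda>y. wave \<delta> y - 1)) y (norm \<delta> * (1 + norm y) * (1 + norm \<delta>) ^ m)" if "b \<in> Basis" for b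
  proof -
    have "has_partial (\<lambda>y. wave \<delta> y + (-1)) b (\<lambda>y. (- \<i> * of_real (b \<bullet> \<delta>)) * wave \<delta> y + 0)"
      by (intro has_partial_add has_partial_wave has_partial_const)
    then have eq: "dirderivs [b] (\<lambda>y. wave \<delta> y - 1) = (\<lambda>y. (- \<i> * of_real (b \<bullet> \<delta>)) * wave \<delta> y)"
      using has_partialD by fastforce
    have "norm (- \<i> * of_real (b \<bullet> \<delta>) :: complex) * (1 + norm \<delta>) ^ l \<le> norm \<delta> * (1 + norm \<delta>) ^ l"
      using norm_partial_wave[OF that, of \<delta>] by (intro mult_right_mono) auto
    also have "\<dots> \<le> norm \<delta> * (1 + norm y) * (1 + norm \<delta>) ^ m"
    proof (rule ge)
      have "1 * (1 + norm \<delta>) ^ l \<le> (1 + norm y) * (1 + norm \<delta>) ^ m"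
        using Suc by (intro mult_mono power_increasing) auto
      then show "(1 + norm \<delta>) ^ l \<le> (1 + norm y) * (1 + norm \<delta>) ^ m" by simp
    qed simp
    finally show ?thesis unfolding eq
      using jet_bound_cmult[OF smooth_wave jet_bound_wave, of l "- \<i> * of_real (b \<bullet> \<delta>)" \<delta> y] jet_bound_mono by blast
  qed
  show ?thesis using 1 2 by (auto simp: Suc jet_bound_Suc simp del: dirderivs.simps)
qed

text \<open>Peetre's inequality for the weights \<open>1 + norm y\<close>: translating a weighted
  bound by \<open>x\<close> costs only a power of \<open>1 + norm x\<close>.\<close>

lemma weight_triangle: "1 + norm (y::'a::real_normed_vector) \<le> (1 + norm (y - x)) * (1 + norm x)"
proof -
  have "norm y \<le> norm (y - x) + norm x" using norm_triangle_ineq[of "y - x" x] by simp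
  moreover have "0 \<le> norm (y - x) * norm x" by simp
  ultimately show ?thesis unfolding distrib_left distrib_right by linarith
qed

lemma weight_shift:
  fixes y :: "'a::real_normed_vector"
  assumes "0 \<le> A" shows "A / (1 + norm (y - x)) ^ k \<le> (1 + norm x) ^ k * A / (1 + norm y) ^ k"
proof -
  have "(1 + norm y) ^ k \<le> ((1 + norm (y - x)) * (1 + norm x)) ^ k"
    by (intro power_mono weight_triangle) simp
  then have "A * (1 + norm y) ^ k \<le> A * ((1 + norm (y - x)) * (1 + norm x)) ^ k"
    using assms by (rule mult_left_mono)
  then show ?thesis
    by (simp add: divide_le_eq le_divide_eq add_pos_nonneg power_mult_distrib mult_ac)
qed

lemma smooth_shift: "smooth f \<Longrightarrow> smooth (shift f x \<zeta>)"
  unfolding shift_def[abs_def] by (intro smooth_mult smooth_translate smooth_wave)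

lemma jet_bound_shift_local:
  assumes "smooth f" "jet_bound m f (y - x) M"
  shows "jet_bound m (shift f x \<zeta>) y (2 ^ m * M * (1 + norm \<zeta>) ^ m)"
  unfolding shift_def[abs_def]
  by (rule jet_bound_mult[OF smooth_translate smooth_wave]) (use assms jet_bound_wave jet_bound_translate in blast)+

lemma jet_bound_shift:
  assumes "smooth f" "\<And>y. jet_bound m f y (A / (1 + norm y) ^ k)" "0 \<le> A"
  shows "jet_bound m (shift f x \<zeta>) y (2 ^ m * (1 + norm \<zeta>) ^ m * (1 + norm x) ^ k * A / (1 + norm y) ^ k)"
proof (rule jet_bound_mono[OF jet_bound_shift_local[OF assms(1,2)] order_refl])
  have "2 ^ m * (A / (1 + norm (y - x)) ^ k) * (1 + norm \<zeta>) ^ m \<le>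
      2 ^ m * ((1 + norm x) ^ k * A / (1 + norm y) ^ k) * (1 + norm \<zeta>) ^ m"
    by (intro mult_right_mono mult_left_mono weight_shift assms) auto
  then show "2 ^ m * (A / (1 + norm (y - x)) ^ k) * (1 + norm \<zeta>) ^ m \<le>
      2 ^ m * (1 + norm \<zeta>) ^ m * (1 + norm x) ^ k * A / (1 + norm y) ^ k"
    by (simp add: mult_ac)
qed

lemma schwartz_shift:
  fixes f :: "'a::euclidean_space \<Rightarrow> complex"
  assumes "schwartz f" shows "schwartz (shift f x \<zeta>)"
proof (rule schwartzI)
  fix m k
  obtain A where "0 \<le> A" "\<And>y. jet_bound m f y (A / (1 + norm y) ^ k)" using schwartz_jet[OF assms] by metis
  then show "\<exists>C. \<forall>y. jet_bound m (shift f x \<zeta>) y (C / (1 + norm y) ^ k)"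
    using jet_bound_shift[OF schwartz_smooth[OF assms], of m A k x \<zeta>] by blast
qed (intro smooth_shift schwartz_smooth assms)

lemma schwartz_mult:
  assumes "schwartz f" "smooth g" "\<And>m. \<exists>B. \<forall>y. jet_bound m g y B"
  shows "schwartz (\<lambda>y. f y * g y)"
proof (rule schwartzI)
  fix m k
  obtain A where A: "0 \<le> A" "\<And>y. jet_bound m f y (A / (1 + norm y) ^ k)" using schwartz_jet[OF assms(1)] by metis
  obtain B where B: "\<And>y. jet_bound m g y B" using assms(3) by blast
  have "jet_bound m (\<lambda>y. f y * g y) y ((2 ^ m * A * B) / (1 + norm y) ^ k)" for y
    using jet_bound_mult[OF schwartz_smooth[OF assms(1)] assms(2) A(2) B] by simp
  then show "\<exists>C. \<forall>y. jet_bound m (\<lambda>y. f y * g y) y (C / (1 + norm y) ^ k)" by blast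
qed (intro smooth_mult schwartz_smooth assms)

lemma schwartz_bounded_jets:
  assumes "schwartz f" shows "\<exists>B. \<forall>y. jet_bound m f y B"
  using schwartz_jet[OF assms, of m 0] by (metis div_by_1 power_0)

lemma schwartz_add:
  assumes "schwartz f" "schwartz g" shows "schwartz (\<lambda>y. f y + g y)"
proof (rule schwartzI)
  fix m k
  obtain A where A: "\<And>y. jet_bound m f y (A / (1 + norm y) ^ k)" using schwartz_jet[OF assms(1)] by metis
  obtain B where B: "\<And>y. jet_bound m g y (B / (1 + norm y) ^ k)" using schwartz_jet[OF assms(2)] by metis
  have "jet_bound m (\<lambda>y. f y + g y) y ((A + B) / (1 + norm y) ^ k)" for y
    using jet_bound_add[OF assms[THEN schwartz_smooth] A B] by (simp add: add_divide_distrib)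
  then show "\<exists>C. \<forall>y. jet_bound m (\<lambda>y. f y + g y) y (C / (1 + norm y) ^ k)" by blast
qed (intro smooth_add schwartz_smooth assms)

lemma schwartz_cmult:
  fixes f :: "'a::euclidean_space \<Rightarrow> complex"
  assumes "schwartz f" shows "schwartz (\<lambda>y. c * f y)"
proof -
  have "schwartz (\<lambda>y. f y * c)"
  proof (rule schwartz_mult[OF assms smooth_const])
    fix m
    have "dirderivs bs (\<lambda>y::'a. c) y = (if bs = [] then c else 0)" if "set bs \<subseteq> Basis" for bs y
      using that by (induction bs arbitrary: y) (auto simp: fun_eq_iff)
    then show "\<exists>B. \<forall>y::'a. jet_bound m (\<lambda>y. c) y B"
      by (auto simp: jet_bound_def intro!: exI[of _ "norm c"])
  qed
  then show ?thesis by (simp add: mult.commute)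
qed

lemma schwartz_diff: "schwartz f \<Longrightarrow> schwartz g \<Longrightarrow> schwartz (\<lambda>y. f y - g y)"
  using schwartz_add[OF _ schwartz_cmult[of g "-1"], of f] by simp

lemma schwartz_cnj:
  assumes "schwartz f" shows "schwartz (\<lambda>y. cnj (f y))"
  by (rule schwartzI, intro smooth_cnj schwartz_smooth assms)
    (metis assms jet_bound_cnj schwartz_jet schwartz_smooth)

lemma schwartz_partial:
  assumes "schwartz f" "b \<in> Basis" shows "schwartz (dirderivs [b] f)"
proof (rule schwartzI)
  fix m k
  obtain A where A: "\<And>y. jet_bound (Suc m) f y (A / (1 + norm y) ^ k)" using schwartz_jet[OF assms(1)] by metis
  then have "\<And>y. jet_bound m (dirderivs [b] f) y (A / (1 + norm y) ^ k)"
    using assms(2) by (meson jet_bound_Suc)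
  then show "\<exists>C. \<forall>y. jet_bound m (dirderivs [b] f) y (C / (1 + norm y) ^ k)" by blast
qed (intro smooth_partial schwartz_smooth assms)

text \<open>For \<open>1 \<le> R\<close> a dilation moves points outward, so the weight is not
  worsened and only derivatives cost powers of \<open>R\<close>.\<close>

lemma jet_bound_dilate_weight:
  assumes f: "smooth f" "\<And>y. jet_bound m f y (A / (1 + norm y) ^ k)" and R: "1 \<le> R"
  shows "jet_bound m (\<lambda>y. f (R *\<^sub>R y)) y (R ^ m * A / (1 + norm y) ^ k)"
proof (rule jet_bound_mono[OF jet_bound_dilate[OF f(1) R f(2)] order_refl])
  have A: "0 \<le> A" using jet_bound_nonneg[OF f(2)[of 0]] by simp
  have "norm y \<le> norm (R *\<^sub>R y)" using R mult_right_mono[of 1 R "norm y"] by simp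
  then have "A / (1 + norm (R *\<^sub>R y)) ^ k \<le> A / (1 + norm y) ^ k"
    using A by (intro divide_left_mono power_mono mult_pos_pos zero_less_power add_pos_nonneg) auto
  then show "R ^ m * (A / (1 + norm (R *\<^sub>R y)) ^ k) \<le> R ^ m * A / (1 + norm y) ^ k"
    using R mult_left_mono[of _ _ "R ^ m"] by fastforce
qed

lemma schwartz_dilate:
  assumes "schwartz f" "1 \<le> R" shows "schwartz (\<lambda>y. f (R *\<^sub>R y))"
proof (rule schwartzI)
  fix m k
  obtain A where "\<And>y. jet_bound m f y (A / (1 + norm y) ^ k)" using schwartz_jet[OF assms(1)] by metis
  then show "\<exists>C. \<forall>y. jet_bound m (\<lambda>y. f (R *\<^sub>R y)) y (C / (1 + norm y) ^ k)"
    using jet_bound_dilate_weight[OF schwartz_smooth[OF assms(1)] _ assms(2)] by blast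
qed (intro smooth_dilate schwartz_smooth assms)

section \<open>Coordinatewise mean value estimates\<close>

lemma has_vector_derivative_bound:
  fixes f :: "real \<Rightarrow> 'b::real_normed_vector"
  assumes f: "\<And>s. s \<in> closed_segment 0 t \<Longrightarrow> (f has_vector_derivative f' s) (at s)"
    and B: "\<And>s. s \<in> closed_segment 0 t \<Longrightarrow> norm (f' s) \<le> B"
  shows "norm (f t - f 0) \<le> B * \<bar>t\<bar>"
proof -
  have "norm (f t - f 0) \<le> B * norm (t - 0)"
  proof (rule differentiable_bound[of "closed_segment 0 t" f "\<lambda>s h. h *\<^sub>R f' s"])
    fix s assume s: "s \<in> closed_segment 0 t"
    show "(f has_derivative (\<lambda>h. h *\<^sub>R f' s)) (at s within closed_segment 0 t)"
      using f[OF s] by (simp add: has_vector_derivative_def has_derivative_at_withinI)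
    show "onorm (\<lambda>h. h *\<^sub>R f' s) \<le> B"
      using B[OF s] by (intro onorm_le) (metis abs_ge_zero mult.commute mult_right_mono norm_scaleR real_norm_def)
  qed auto
  then show ?thesis by simp
qed

lemma has_partial_bound:
  assumes "has_partial f b g" "\<And>s. s \<in> closed_segment 0 t \<Longrightarrow> norm (g (x + s *\<^sub>R b)) \<le> B"
  shows "norm (f (x + t *\<^sub>R b) - f x) \<le> B * \<bar>t\<bar>"
  using has_vector_derivative_bound[OF has_partial_line[OF assms(1)], of t x B] assms(2) by simp

text \<open>Projections onto coordinate subspaces do not increase the norm. So the corners of the
  axis-parallel path from \<open>s\<close> to \<open>s + h\<close> stay within distance
  \<open>norm h\<close> of \<open>s\<close>.\<close>

lemma norm_partial_sum_le:
  fixes h :: "'a::euclidean_space"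
  assumes "S \<subseteq> Basis" shows "norm (\<Sum>b\<in>S. (h \<bullet> b) *\<^sub>R b) \<le> norm h"
proof -
  let ?p = "\<Sum>b\<in>S. (h \<bullet> b) *\<^sub>R b"
  have fin: "finite S" by (rule finite_subset[OF assms finite_Basis])
  have "?p \<bullet> b = h \<bullet> b" if "b \<in> S" for b
  proof -
    have "?p \<bullet> b = (\<Sum>c\<in>S. (h \<bullet> c) * (if c = b then 1 else 0))"
      unfolding inner_sum_left inner_scaleR_left
      by (intro sum.cong refl arg_cong2[where f="(*)"] inner_Basis) (use assms that in auto)
    also have "\<dots> = (\<Sum>c\<in>S. if c = b then h \<bullet> c else 0)" by (intro sum.cong) auto
    finally show ?thesis using fin that by simp
  qed
  then have "?p \<bullet> ?p = h \<bullet> ?p"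
    by (simp add: inner_sum_right[of ?p] inner_sum_right[of h])
  then have "norm ?p ^ 2 \<le> norm h * norm ?p"
    using Cauchy_Schwarz_ineq2[of h ?p] by (simp add: dot_square_norm[symmetric])
  then show ?thesis
    by (cases "norm ?p = 0") (auto simp: power2_eq_square)
qed

text \<open>Only derivatives along the axes are available, so \<open>s\<close> and
  \<open>s + h\<close> are joined by an axis-parallel path whose corners remain in the ball of
  radius \<open>r\<close>. Keeping \<open>step\<close> local to that ball matters when
  \<open>G\<close> is a value of \<open>u\<close> that is controlled only there.\<close>

lemma coordinatewise_bound:
  fixes G :: "'a::euclidean_space \<Rightarrow> 'b::real_normed_vector" and B r :: real
  assumes step: "\<And>x t b. b \<in> Basis \<Longrightarrow> norm (x - s) \<le> r \<Longrightarrow> norm (x + t *\<^sub>R b - s) \<le> r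
      \<Longrightarrow> norm (G (x + t *\<^sub>R b) - G x) \<le> B * \<bar>t\<bar>"
    and "norm h \<le> r" "0 \<le> B"
  shows "norm (G (s + h) - G s) \<le> DIM('a) * B * norm h"
proof -
  have "norm (G (s + (\<Sum>b\<in>S. (h \<bullet> b) *\<^sub>R b)) - G s) \<le> card S * (B * norm h)" if "S \<subseteq> Basis" for S
    using finite_subset[OF that finite_Basis] that
  proof (induction S rule: finite_induct)
    case (insert b S)
    let ?x = "s + (\<Sum>b\<in>S. (h \<bullet> b) *\<^sub>R b)"
    have e: "s + (\<Sum>b\<in>insert b S. (h \<bullet> b) *\<^sub>R b) = ?x + (h \<bullet> b) *\<^sub>R b"
      using insert by (simp add: algebra_simps)
    have n1: "norm (?x - s) \<le> r"
      using norm_partial_sum_le[of S h] insert assms(2) by auto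
    have "norm (\<Sum>b\<in>insert b S. (h \<bullet> b) *\<^sub>R b) \<le> r"
      using norm_partial_sum_le[of "insert b S" h] insert.prems assms(2) by linarith
    then have n2: "norm (?x + (h \<bullet> b) *\<^sub>R b - s) \<le> r" unfolding e[symmetric] by simp
    have "norm (G (?x + (h \<bullet> b) *\<^sub>R b) - G ?x) \<le> B * \<bar>h \<bullet> b\<bar>"
      using insert n1 n2 by (intro step) auto
    also have "\<dots> \<le> B * norm h" using insert assms(3) Basis_le_norm[of b h] by (intro mult_left_mono) auto
    finally have "norm (G (?x + (h \<bullet> b) *\<^sub>R b) - G s) \<le> B * norm h + card S * (B * norm h)"
      using insert by (intro norm_diff_triangle_le[of _ "G ?x"]) auto
    then show ?case unfolding e using insert by (simp add: algebra_simps)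
  qed simp
  from this[of Basis] show ?thesis by (simp add: euclidean_representation mult.assoc)
qed

lemma segment_in_cball:
  assumes "norm (x - s) \<le> r" "norm (x + t *\<^sub>R b - s) \<le> r" "\<tau> \<in> closed_segment 0 t"
  shows "norm (x + \<tau> *\<^sub>R b - s) \<le> (r::real)"
proof -
  obtain u where u: "0 \<le> u" "u \<le> 1" "\<tau> = u * t" using assms(3) by (auto simp: closed_segment_def)
  have "x + \<tau> *\<^sub>R b = (1 - u) *\<^sub>R x + u *\<^sub>R (x + t *\<^sub>R b)" by (simp add: u algebra_simps)
  moreover have "(1 - u) *\<^sub>R x + u *\<^sub>R (x + t *\<^sub>R b) \<in> cball s r"
    using convexD_alt[OF convex_cball, of x s r "x + t *\<^sub>R b" u] assms u
    by (auto simp: dist_norm norm_minus_commute)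
  ultimately show ?thesis by (simp add: dist_norm norm_minus_commute)
qed

text \<open>Mean value estimate for each derivative of order at most \<open>m\<close>, hence the
  hypothesis of order \<open>Suc m\<close>. Intermediate points differ from \<open>y - x\<close> by
  at most \<open>norm (x - x')\<close>, and Peetre's inequality is applied twice to bring the weight
  back to \<open>y\<close>.\<close>

lemma jet_bound_translate_diff:
  fixes f :: "'a::euclidean_space \<Rightarrow> complex" and A :: real
  assumes f: "smooth f" and A: "\<And>y. jet_bound (Suc m) f y (A / (1 + norm y) ^ k)" "0 \<le> A"
  shows "jet_bound m (\<lambda>y. f (y - x) - f (y - x')) y
    (DIM('a) * ((1 + norm x) ^ k * (1 + norm (x - x')) ^ k * A / (1 + norm y) ^ k) * norm (x - x'))"
  unfolding jet_bound_def
proof (intro allI impI)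
  fix bs :: "'a list" assume bs: "set bs \<subseteq> Basis \<and> length bs \<le> m"
  let ?g = "dirderivs bs f" and ?h = "x - x'" and ?s = "y - x"
  let ?B = "(1 + norm x) ^ k * (1 + norm (x - x')) ^ k * A / (1 + norm y) ^ k"
  have "norm (?g (?s + ?h) - ?g ?s) \<le> DIM('a) * ?B * norm ?h"
  proof (rule coordinatewise_bound[where r="norm ?h" and G="?g" and s="?s" and h="?h" and B="?B"])
    fix v b :: 'a and t :: real
    assume b: "b \<in> Basis" and v: "norm (v - ?s) \<le> norm ?h" "norm (v + t *\<^sub>R b - ?s) \<le> norm ?h"
    show "norm (?g (v + t *\<^sub>R b) - ?g v) \<le> ?B * \<bar>t\<bar>"
    proof (rule has_partial_bound)
      show "has_partial ?g b (dirderivs (b # bs) f)"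
        using smooth_has_partial[OF smooth_dirderivs[OF f, of bs] b] bs by simp
      fix \<tau> assume "\<tau> \<in> closed_segment 0 t"
      from segment_in_cball[OF v this] have n: "norm (v + \<tau> *\<^sub>R b - ?s) \<le> norm ?h" .
      let ?v = "v + \<tau> *\<^sub>R b"
      have "norm (dirderivs (b # bs) f ?v) \<le> A / (1 + norm ?v) ^ k"
        using bs b by (intro jet_boundD[OF A(1)]) auto
      also have "\<dots> = A / (1 + norm (?s - (?s - ?v))) ^ k" by (subst diff_diff_eq2) (simp add: add.commute)
      also have "\<dots> \<le> (1 + norm (?s - ?v)) ^ k * A / (1 + norm ?s) ^ k" by (rule weight_shift[OF A(2)])
      also have "\<dots> \<le> (1 + norm x) ^ k * ((1 + norm (?s - ?v)) ^ k * A) / (1 + norm y) ^ k"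
        by (rule weight_shift) (use A in auto)
      also have "\<dots> \<le> (1 + norm x) ^ k * ((1 + norm ?h) ^ k * A) / (1 + norm y) ^ k"
        using n A by (intro divide_right_mono mult_left_mono mult_right_mono power_mono)
          (auto simp: norm_minus_commute)
      finally show "norm (dirderivs (b # bs) f ?v) \<le> ?B" by (simp add: mult_ac)
    qed
  qed (use A in auto)
  moreover have "dirderivs bs (\<lambda>y. f (y - x) - f (y - x')) y = ?g (y - x) - ?g (y - x')"
    using bs by (simp add: dirderivs_diff[OF smooth_translate smooth_translate, OF f f] dirderivs_translate[OF f])
  ultimately show "norm (dirderivs bs (\<lambda>y. f (y - x) - f (y - x')) y) \<le> DIM('a) * ?B * norm ?h"
    by (simp add: norm_minus_commute)
qed

section \<open>Tame families of Schwartz functions\<close>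

text \<open>Families that are polynomially bounded and Lipschitz in the parameter, with respect to every
  Schwartz seminorm: the Lipschitz bound is what lets an integral over the parameter be
  approximated by finite sums in the topology of the Schwartz space.\<close>

definition tame :: "('s::euclidean_space \<Rightarrow> 'a::euclidean_space \<Rightarrow> complex) \<Rightarrow> bool" where
  "tame F \<longleftrightarrow> (\<forall>s. smooth (F s)) \<and>
    (\<forall>k m. \<exists>C\<ge>0. \<exists>q. \<forall>s y. jet_bound m (F s) y (C * (1 + norm s) ^ q / (1 + norm y) ^ k)) \<and>
    (\<forall>k m. \<exists>C\<ge>0. \<exists>q. \<forall>s s' y. jet_bound m (\<lambda>y. F s y - F s' y) y
        (C * norm (s - s') * (1 + norm s + norm s') ^ q / (1 + norm y) ^ k))"

text \<open>Position and frequency are changed one after the other. The frequency change brings the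
  weight \<open>1 + norm y\<close> of \<open>jet_bound_wave_diff\<close>, which is why
  \<open>f\<close> decays with exponent \<open>Suc k\<close>. \<open>T\<close> dominates all
  parameters, so that a power of one quantity remains.\<close>

lemma jet_bound_shift_diff:
  fixes f :: "'a::euclidean_space \<Rightarrow> complex" and A d T :: real
  assumes f: "smooth f" and A: "\<And>y. jet_bound (Suc m) f y (A / (1 + norm y) ^ Suc k)" "0 \<le> A"
    and T: "1 + norm x \<le> T" "1 + norm x' \<le> T" "1 + norm \<zeta> \<le> T" "1 + norm \<zeta>' \<le> T"
      "1 + norm (x - x') \<le> T" "1 + norm (\<zeta> - \<zeta>') \<le> T"
    and d: "norm (x - x') \<le> d" "norm (\<zeta> - \<zeta>') \<le> d"
  shows "jet_bound m (\<lambda>y. shift f x \<zeta> y - shift f x' \<zeta>' y) y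
    ((2 ^ m * DIM('a) + 4 ^ m) * A * d * T ^ (2 * m + 2 * k + 2) / (1 + norm y) ^ k)"
proof -
  define Y where "Y = 1 + norm y"
  have Y: "1 \<le> Y" by (simp add: Y_def)
  have T1: "1 \<le> T" using T(1) norm_ge_zero[of x] by linarith
  have d0: "0 \<le> d" using d norm_ge_zero order_trans by blast
  have Ak: "jet_bound (Suc m) f y (A / (1 + norm y) ^ k)" for y
  proof (rule jet_bound_mono[OF A(1) order_refl])
    show "A / (1 + norm y) ^ Suc k \<le> A / (1 + norm y) ^ k"
      using A(2) by (intro divide_left_mono power_increasing mult_pos_pos) (auto simp: add_pos_nonneg)
  qed
  have j1: "jet_bound m (\<lambda>y. (f (y - x) - f (y - x')) * wave \<zeta> y) y
     (2 ^ m * (DIM('a) * ((1 + norm x) ^ k * (1 + norm (x - x')) ^ k * A / Y ^ k) * norm (x - x')) * (1 + norm \<zeta>) ^ m)"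
    unfolding Y_def
    by (intro jet_bound_mult jet_bound_translate_diff jet_bound_wave smooth_diff smooth_translate f Ak A smooth_wave)
  have "2 ^ m * (DIM('a) * ((1 + norm x) ^ k * (1 + norm (x - x')) ^ k * A / Y ^ k) * norm (x - x')) * (1 + norm \<zeta>) ^ m
     \<le> 2 ^ m * (DIM('a) * (T ^ k * T ^ k * A / Y ^ k) * d) * T ^ m"
    using T T1 d d0 A(2) Y by (intro mult_mono divide_right_mono power_mono) auto
  also have "2 ^ m * (DIM('a) * (T ^ k * T ^ k * A / Y ^ k) * d) * T ^ m = (2 ^ m * DIM('a) * A * d / Y ^ k) * T ^ (k + k + m)"
    by (simp add: power_add)
  \<comment> \<open>The exponent \<open>2 * m + 2 * k + 2\<close> is chosen to dominate both
    \<open>2 * k + m\<close> here and \<open>2 * m + k + 1\<close> in the frequency term.\<close>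
  also have "\<dots> \<le> (2 ^ m * DIM('a) * A * d / Y ^ k) * T ^ (2 * m + 2 * k + 2)"
    using T1 A(2) d0 Y by (intro mult_left_mono power_increasing) auto
  finally have l1: "2 ^ m * (DIM('a) * ((1 + norm x) ^ k * (1 + norm (x - x')) ^ k * A / Y ^ k) * norm (x - x')) * (1 + norm \<zeta>) ^ m
     \<le> (2 ^ m * DIM('a) * A * d / Y ^ k) * T ^ (2 * m + 2 * k + 2)" .
  have 1: "jet_bound m (\<lambda>y. (f (y - x) - f (y - x')) * wave \<zeta> y) y
      ((2 ^ m * DIM('a) * A * d / Y ^ k) * T ^ (2 * m + 2 * k + 2))"
    by (rule jet_bound_mono[OF j1 order_refl l1])
  have j2: "jet_bound m (\<lambda>y. shift f x' \<zeta>' y * (wave (\<zeta> - \<zeta>') y - 1)) y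
     (2 ^ m * (2 ^ m * (1 + norm \<zeta>') ^ m * (1 + norm x') ^ Suc k * A / Y ^ Suc k) * (norm (\<zeta> - \<zeta>') * Y * (1 + norm (\<zeta> - \<zeta>')) ^ m))"
    unfolding Y_def
    by (intro jet_bound_mult jet_bound_shift jet_bound_wave_diff smooth_diff smooth_shift smooth_wave smooth_const f A
        jet_bound_mono[OF A(1), of m]) auto
  have "2 ^ m * (2 ^ m * (1 + norm \<zeta>') ^ m * (1 + norm x') ^ Suc k * A / Y ^ Suc k) * (norm (\<zeta> - \<zeta>') * Y * (1 + norm (\<zeta> - \<zeta>')) ^ m)
     \<le> 2 ^ m * (2 ^ m * T ^ m * T ^ Suc k * A / Y ^ Suc k) * (d * Y * T ^ m)"
    using T T1 d d0 A(2) Y by (intro mult_mono divide_right_mono power_mono) auto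
  also have "2 ^ m * (2 ^ m * T ^ m * T ^ Suc k * A / Y ^ Suc k) * (d * Y * T ^ m) = (2 ^ m * 2 ^ m * A * d / Y ^ k) * T ^ (m + Suc k + m)"
    using Y by (simp add: power_add field_simps)
  also have "\<dots> \<le> (2 ^ m * 2 ^ m * A * d / Y ^ k) * T ^ (2 * m + 2 * k + 2)"
    using T1 A(2) d0 Y by (intro mult_left_mono power_increasing) auto
  finally have l2: "2 ^ m * (2 ^ m * (1 + norm \<zeta>') ^ m * (1 + norm x') ^ Suc k * A / Y ^ Suc k) * (norm (\<zeta> - \<zeta>') * Y * (1 + norm (\<zeta> - \<zeta>')) ^ m)
     \<le> (2 ^ m * 2 ^ m * A * d / Y ^ k) * T ^ (2 * m + 2 * k + 2)" .
  have four: "(2::real) ^ m * 2 ^ m = 4 ^ m" by (simp add: power_mult_distrib[symmetric])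
  have 2: "jet_bound m (\<lambda>y. shift f x' \<zeta>' y * (wave (\<zeta> - \<zeta>') y - 1)) y
      ((4 ^ m * A * d / Y ^ k) * T ^ (2 * m + 2 * k + 2))"
    using jet_bound_mono[OF j2 order_refl l2] unfolding four .
  have w: "wave \<zeta> y = wave \<zeta>' y * wave (\<zeta> - \<zeta>') y" for y
    using wave_add[of \<zeta>' "\<zeta> - \<zeta>'" y] by simp
  have "(\<lambda>y. shift f x \<zeta> y - shift f x' \<zeta>' y) = (\<lambda>y. (f (y - x) - f (y - x')) * wave \<zeta> y + shift f x' \<zeta>' y * (wave (\<zeta> - \<zeta>') y - 1))"
    by (simp add: fun_eq_iff shift_def w algebra_simps)
  then show ?thesis
    using jet_bound_add[OF _ _ 1 2] f
    by (simp add: smooth_mult smooth_diff smooth_translate smooth_wave smooth_shift smooth_const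
       algebra_simps Y_def add_divide_distrib)
qed

lemma tame_shift:
  fixes X Z :: "'s::euclidean_space \<Rightarrow> 'a::euclidean_space"
  assumes f: "schwartz f" and X: "\<And>s s'. norm (X s - X s') \<le> L * norm (s - s')"
    and Z: "\<And>s s'. norm (Z s - Z s') \<le> L * norm (s - s')" and L: "0 \<le> L"
  shows "tame (\<lambda>s. shift f (X s) (Z s))"
  unfolding tame_def
proof (intro conjI allI)
  show "smooth (shift f (X s) (Z s))" for s by (intro smooth_shift schwartz_smooth f)
  \<comment> \<open>\<open>P * (1 + norm s)\<close> bounds \<open>1 + norm (X s)\<close> and
    \<open>1 + norm (Z s)\<close>, and the same \<open>P\<close> absorbs the Lipschitz constant in
    \<open>dd\<close>.\<close>
  define P where "P = 1 + L + norm (X 0) + norm (Z 0)"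
  have P1: "1 \<le> P" using L by (simp add: P_def)
  have bnd: "1 + norm (V s) \<le> P * (1 + norm s)"
    if "norm (V s - V 0) \<le> L * norm s" "norm (V 0) \<le> norm (X 0) + norm (Z 0)" for V :: "'s \<Rightarrow> 'a" and s
  proof -
    have "norm (V s) \<le> norm (V s - V 0) + norm (V 0)" using norm_triangle_sub[of "V s" "V 0"] by simp
    also have "\<dots> \<le> L * norm s + (norm (X 0) + norm (Z 0))" using that by (rule add_mono)
    moreover have "0 \<le> (1 + norm (X 0) + norm (Z 0)) * norm s + L" using L by simp
    ultimately show ?thesis by (simp add: P_def algebra_simps)
  qed
  have bX: "1 + norm (X s) \<le> P * (1 + norm s)" for s using X[of s 0] by (intro bnd) auto
  have bZ: "1 + norm (Z s) \<le> P * (1 + norm s)" for s using Z[of s 0] by (intro bnd) auto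
  fix k m
  obtain A where A: "0 \<le> A" "\<And>y. jet_bound m f y (A / (1 + norm y) ^ k)" using schwartz_jet[OF f] by metis
  show "\<exists>C\<ge>0. \<exists>q. \<forall>s y. jet_bound m (shift f (X s) (Z s)) y (C * (1 + norm s) ^ q / (1 + norm y) ^ k)"
  proof (intro exI[of _ "2 ^ m * P ^ (m + k) * A"] exI[of _ "m + k"] conjI allI)
    show "0 \<le> 2 ^ m * P ^ (m + k) * A" using A P1 by simp
    fix s :: 's and y :: 'a
    have "2 ^ m * (1 + norm (Z s)) ^ m * (1 + norm (X s)) ^ k * A / (1 + norm y) ^ k
      \<le> 2 ^ m * (P * (1 + norm s)) ^ m * (P * (1 + norm s)) ^ k * A / (1 + norm y) ^ k"
      using bX bZ A P1 by (intro divide_right_mono mult_mono power_mono) auto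
    also have "\<dots> = 2 ^ m * P ^ (m + k) * A * (1 + norm s) ^ (m + k) / (1 + norm y) ^ k"
      by (simp add: power_mult_distrib power_add)
    finally show "jet_bound m (shift f (X s) (Z s)) y (2 ^ m * P ^ (m + k) * A * (1 + norm s) ^ (m + k) / (1 + norm y) ^ k)"
      by (rule jet_bound_mono[OF jet_bound_shift[OF schwartz_smooth[OF f] A(2,1)] order_refl])
  qed
  obtain A where A: "0 \<le> A" "\<And>y. jet_bound (Suc m) f y (A / (1 + norm y) ^ Suc k)" using schwartz_jet[OF f] by metis
  let ?q = "2 * m + 2 * k + 2"
  show "\<exists>C\<ge>0. \<exists>q. \<forall>s s' y. jet_bound m (\<lambda>y. shift f (X s) (Z s) y - shift f (X s') (Z s') y) y
        (C * norm (s - s') * (1 + norm s + norm s') ^ q / (1 + norm y) ^ k)"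
  proof (intro exI[of _ "(2 ^ m * DIM('a) + 4 ^ m) * A * L * P ^ ?q"] exI[of _ "?q"] conjI allI)
    show "0 \<le> (2 ^ m * DIM('a) + 4 ^ m) * A * L * P ^ ?q" using A P1 L by simp
    fix s s' :: 's and y :: 'a
    let ?T = "P * (1 + norm s + norm s')"
    have up: "P * (1 + norm s) \<le> ?T" "P * (1 + norm s') \<le> ?T" using P1 by (auto intro!: mult_left_mono)
    have dd: "1 + L * norm (s - s') \<le> ?T"
    proof -
      have "L * norm (s - s') \<le> P * (norm s + norm s')"
        using P1 L by (intro mult_mono norm_triangle_ineq4) (auto simp: P_def)
      then show ?thesis using P1 by (simp add: algebra_simps)
    qed
    have "jet_bound m (\<lambda>y. shift f (X s) (Z s) y - shift f (X s') (Z s') y) y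
      ((2 ^ m * DIM('a) + 4 ^ m) * A * (L * norm (s - s')) * ?T ^ ?q / (1 + norm y) ^ k)"
      using bX[of s] bX[of s'] bZ[of s] bZ[of s'] up dd X[of s s'] Z[of s s']
      by (intro jet_bound_shift_diff schwartz_smooth f A) linarith+
    then show "jet_bound m (\<lambda>y. shift f (X s) (Z s) y - shift f (X s') (Z s') y) y
        ((2 ^ m * DIM('a) + 4 ^ m) * A * L * P ^ ?q * norm (s - s') * (1 + norm s + norm s') ^ ?q / (1 + norm y) ^ k)"
      by (simp only: power_mult_distrib mult_ac)
  qed
qed

section \<open>Integration of rapidly decreasing functions\<close>

lemma nn_integral_Cauchy_density_finite: "(\<integral>\<^sup>+x. ennreal (1 / (1 + x\<^sup>2)) \<partial>lborel) < \<infinity>"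
proof -
  let ?f = "\<lambda>x::real. 1 / (1 + x\<^sup>2)"
  have *: "(\<integral>\<^sup>+x. ennreal (?f x) * indicator {0..} x \<partial>lborel) = ennreal (pi / 2 - arctan 0)"
    by (rule nn_integral_FTC_atLeast)
      (auto intro!: DERIV_arctan[THEN DERIV_cong] tendsto_arctan_at_top simp: inverse_eq_divide)
  have "(\<integral>\<^sup>+x. ennreal (?f x) * indicator {..0} x \<partial>lborel) =
      (\<integral>\<^sup>+x. ennreal (?f x) * indicator {0..} x \<partial>lborel)"
    by (subst nn_integral_real_affine[where c="-1" and t=0])
      (auto intro!: nn_integral_cong simp: indicator_def)
  moreover have "(\<integral>\<^sup>+x. ennreal (?f x) \<partial>lborel) \<le>
      (\<integral>\<^sup>+x. ennreal (?f x) * indicator {0..} x + ennreal (?f x) * indicator {..0} x \<partial>lborel)"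
    by (intro nn_integral_mono) (auto simp: indicator_def)
  moreover have "(\<integral>\<^sup>+x. ennreal (?f x) * indicator {0..} x + ennreal (?f x) * indicator {..0} x \<partial>lborel) =
      (\<integral>\<^sup>+x. ennreal (?f x) * indicator {0..} x \<partial>lborel) + (\<integral>\<^sup>+x. ennreal (?f x) * indicator {..0} x \<partial>lborel)"
    by (rule nn_integral_add) auto
  ultimately show ?thesis using * by (simp add: order_le_less_trans)
qed

text \<open>Each factor \<open>1 + (x \<bullet> b)\<^sup>2\<close> is at most
  \<open>(1 + norm x)\<^sup>2\<close>, so the weight is dominated by a product of one-dimensional
  Cauchy densities; this comparison is the origin of the exponent
  \<open>2 * DIM('a)\<close>.\<close>

lemma integrable_weight:
  "integrable lborel (\<lambda>x::'a::euclidean_space. 1 / (1 + norm x) ^ (2 * DIM('a)))"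
proof (rule integrableI_nonneg)
  have le: "ennreal (1 / (1 + norm x) ^ (2 * DIM('a))) \<le> (\<Prod>b\<in>Basis. ennreal (1 / (1 + (x \<bullet> b)\<^sup>2)))" for x :: 'a
  proof -
    have "(\<Prod>b\<in>(Basis::'a set). 1 + (x \<bullet> b)\<^sup>2) \<le> (\<Prod>b\<in>(Basis::'a set). (1 + norm x)\<^sup>2)"
    proof (intro prod_mono conjI)
      fix b :: 'a assume "b \<in> Basis"
      then have "(x \<bullet> b)\<^sup>2 \<le> (norm x)\<^sup>2" using Basis_le_norm by (simp add: abs_le_square_iff[symmetric])
      then show "1 + (x \<bullet> b)\<^sup>2 \<le> (1 + norm x)\<^sup>2" using norm_ge_zero[of x] by (simp add: power2_sum add_increasing2)
    qed simp
    also have "\<dots> = (1 + norm x) ^ (2 * DIM('a))" by (simp add: power_mult)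
    finally have "1 / (1 + norm x) ^ (2 * DIM('a)) \<le> 1 / (\<Prod>b\<in>(Basis::'a set). 1 + (x \<bullet> b)\<^sup>2)"
      by (intro divide_left_mono mult_pos_pos prod_pos zero_less_power) (auto simp: add_pos_nonneg)
    also have "\<dots> = (\<Prod>b\<in>(Basis::'a set). 1 / (1 + (x \<bullet> b)\<^sup>2))" by (simp add: prod_dividef)
    finally show ?thesis by (simp add: prod_ennreal ennreal_leI)
  qed
  have "(\<integral>\<^sup>+x. ennreal (1 / (1 + norm x) ^ (2 * DIM('a))) \<partial>(lborel::'a measure)) \<le>
     (\<integral>\<^sup>+x. (\<Prod>b\<in>Basis. ennreal (1 / (1 + (x \<bullet> b)\<^sup>2))) \<partial>(lborel::'a measure))"
    by (intro nn_integral_mono le)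
  also have "\<dots> = (\<Prod>b\<in>(Basis::'a set). \<integral>\<^sup>+x. ennreal (1 / (1 + x\<^sup>2)) \<partial>lborel)"
    by (rule nn_integral_lborel_prod) auto
  also have "\<dots> < \<infinity>"
    using nn_integral_Cauchy_density_finite by (simp add: power_less_top_ennreal)
  finally show "(\<integral>\<^sup>+x. ennreal (1 / (1 + norm x) ^ (2 * DIM('a))) \<partial>(lborel::'a measure)) < \<infinity>" .
qed (auto simp: add_pos_nonneg)

text \<open>The weights of parameter integrals. Measurability in place of smoothness lets Schwartz
  functions, their Fourier transforms and the indicator of an interval be treated alike.\<close>

definition rapid :: "('s::euclidean_space \<Rightarrow> complex) \<Rightarrow> bool" where
  "rapid w \<longleftrightarrow> w \<in> borel_measurable borel \<and> (\<forall>k. \<exists>C. \<forall>s. norm (w s) \<le> C / (1 + norm s) ^ k)"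

lemma rapid_measurable [measurable_dest]: "rapid w \<Longrightarrow> w \<in> borel_measurable borel"
  by (simp add: rapid_def)

lemma integrable_rapid:
  fixes h :: "'s::euclidean_space \<Rightarrow> 'b::{banach, second_countable_topology}"
  assumes w: "rapid w" and h: "h \<in> borel_measurable borel"
    and le: "\<And>s. norm (h s) \<le> C * (norm (w s) * (1 + norm s) ^ q)"
  shows "integrable lborel h"
proof -
  \<comment> \<open>Of these powers, \<open>q\<close> cancel the growth and the other
    \<open>2 * DIM('s)\<close> leave an integrable weight.\<close>
  obtain A where A: "\<And>s. norm (w s) \<le> A / (1 + norm s) ^ (q + 2 * DIM('s))"
    using w by (auto simp: rapid_def)
  have "integrable lborel (\<lambda>s::'s. \<bar>C\<bar> * A * (1 / (1 + norm s) ^ (2 * DIM('s))))"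
    by (intro integrable_mult_right integrable_weight)
  then show ?thesis
  proof (rule Bochner_Integration.integrable_bound)
    show "AE s in lborel. norm (h s) \<le> norm (\<bar>C\<bar> * A * (1 / (1 + norm s) ^ (2 * DIM('s))))"
    proof (rule AE_I2)
      fix s :: 's
      have p: "0 < (1 + norm s) ^ j" for j by (simp add: add_pos_nonneg)
      have "norm (h s) \<le> \<bar>C\<bar> * (norm (w s) * (1 + norm s) ^ q)"
        by (rule order_trans[OF le mult_right_mono]) auto
      also have "\<dots> \<le> \<bar>C\<bar> * (A / (1 + norm s) ^ (q + 2 * DIM('s)) * (1 + norm s) ^ q)"
        using A by (intro mult_left_mono mult_right_mono) auto
      also have "\<dots> = \<bar>C\<bar> * A * (1 / (1 + norm s) ^ (2 * DIM('s)))"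
        using p[of q] by (simp add: power_add)
      finally show "norm (h s) \<le> norm (\<bar>C\<bar> * A * (1 / (1 + norm s) ^ (2 * DIM('s))))"
        unfolding real_norm_def by linarith
    qed
  qed (use h in simp)
qed

lemma integrable_rapid_weight:
  assumes "rapid w" shows "integrable lborel (\<lambda>s. norm (w s) * (1 + norm s) ^ q)"
proof (rule integrable_rapid[OF assms, of _ 1 q])
  show "(\<lambda>s. norm (w s) * (1 + norm s) ^ q) \<in> borel_measurable borel"
    using rapid_measurable[OF assms] by measurable
qed auto

section \<open>Differentiation under the integral sign\<close>

lemma has_vector_derivative_iff_quotient:
  fixes f :: "real \<Rightarrow> 'b::real_normed_vector"
  shows "(f has_vector_derivative v) (at 0) \<longleftrightarrow> ((\<lambda>h. (f h - f 0) /\<^sub>R h) \<longlongrightarrow> v) (at 0)"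
proof -
  have "(f has_vector_derivative v) (at 0) \<longleftrightarrow> ((\<lambda>h. norm (f (0 + h) - f 0 - h *\<^sub>R v) / norm h) \<longlongrightarrow> 0) (at 0)"
    by (simp add: has_vector_derivative_def has_derivative_at bounded_linear_scaleR_left)
  also have "\<dots> \<longleftrightarrow> ((\<lambda>h. norm ((f h - f 0) /\<^sub>R h - v)) \<longlongrightarrow> 0) (at 0)"
  proof (rule filterlim_cong[OF refl refl], rule eventually_at_topological[THEN iffD2], intro exI[of _ UNIV] conjI ballI impI)
    fix h :: real assume "h \<noteq> 0"
    then have "(f h - f 0) /\<^sub>R h - v = (f h - f 0 - h *\<^sub>R v) /\<^sub>R h" by (simp add: algebra_simps)
    then show "norm (f (0 + h) - f 0 - h *\<^sub>R v) / norm h = norm ((f h - f 0) /\<^sub>R h - v)"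
      by (simp add: divide_inverse mult.commute)
  qed auto
  also have "\<dots> \<longleftrightarrow> ((\<lambda>h. (f h - f 0) /\<^sub>R h) \<longlongrightarrow> v) (at 0)"
    by (simp add: tendsto_norm_zero_iff LIM_zero_iff)
  finally show ?thesis .
qed

text \<open>Difference quotients are dominated by \<open>g\<close> through the mean value
  inequality, so dominated convergence applies along every sequence tending to 0.\<close>

lemma has_vector_derivative_integral:
  fixes F :: "real \<Rightarrow> 's \<Rightarrow> complex"
  assumes F: "\<And>t s. \<bar>t\<bar> \<le> 1 \<Longrightarrow> ((\<lambda>t. F t s) has_vector_derivative F' t s) (at t)"
    and g: "\<And>t s. \<bar>t\<bar> \<le> 1 \<Longrightarrow> norm (F' t s) \<le> g s" "integrable M g"
    and int: "\<And>t. \<bar>t\<bar> \<le> 1 \<Longrightarrow> integrable M (F t)" and F'[measurable]: "F' 0 \<in> borel_measurable M"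
  shows "((\<lambda>t. \<integral>s. F t s \<partial>M) has_vector_derivative (\<integral>s. F' 0 s \<partial>M)) (at 0)"
  unfolding has_vector_derivative_iff_quotient tendsto_at_iff_sequentially comp_def
proof (intro allI impI)
  fix X :: "nat \<Rightarrow> real" assume X0: "\<forall>i. X i \<in> UNIV - {0}" and X: "X \<longlonglongrightarrow> 0"
  have "eventually (\<lambda>n. dist (X n) 0 < 1) sequentially" using X by (rule tendstoD) simp
  then obtain N where N: "\<And>n. N \<le> n \<Longrightarrow> \<bar>X n\<bar> \<le> 1" by (force simp: eventually_sequentially)
  show "(\<lambda>i. ((\<integral>s. F (X i) s \<partial>M) - (\<integral>s. F 0 s \<partial>M)) /\<^sub>R X i) \<longlonglongrightarrow> (\<integral>s. F' 0 s \<partial>M)"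
  \<comment> \<open>The hypotheses concern \<open>\<bar>t\<bar> \<le> 1\<close>, and the first
    \<open>N\<close> terms of the sequence may lie outside.\<close>
  proof (rule LIMSEQ_offset[where k=N])
    have le: "\<bar>X (i + N)\<bar> \<le> 1" for i by (rule N) simp
    have "(\<lambda>i. (\<integral>s. (F (X (i + N)) s - F 0 s) /\<^sub>R X (i + N) \<partial>M)) \<longlonglongrightarrow> (\<integral>s. F' 0 s \<partial>M)"
    proof (rule integral_dominated_convergence[where w=g])
      show "(\<lambda>s. (F (X (i + N)) s - F 0 s) /\<^sub>R X (i + N)) \<in> borel_measurable M" for i
        using int[OF le[of i]] int[of 0] by (auto intro!: borel_measurable_scaleR borel_measurable_diff)
      show "AE s in M. (\<lambda>i. (F (X (i + N)) s - F 0 s) /\<^sub>R X (i + N)) \<longlonglongrightarrow> F' 0 s"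
      proof (rule AE_I2)
        fix s
        have "((\<lambda>h. (F h s - F 0 s) /\<^sub>R h) \<longlongrightarrow> F' 0 s) (at 0)"
          using F[of 0 s] by (simp add: has_vector_derivative_iff_quotient)
        then have "(\<lambda>i. (F (X i) s - F 0 s) /\<^sub>R X i) \<longlonglongrightarrow> F' 0 s"
          unfolding tendsto_at_iff_sequentially comp_def using X X0 by blast
        then show "(\<lambda>i. (F (X (i + N)) s - F 0 s) /\<^sub>R X (i + N)) \<longlonglongrightarrow> F' 0 s"
          by (rule LIMSEQ_ignore_initial_segment)
      qed
      show "AE s in M. norm ((F (X (i + N)) s - F 0 s) /\<^sub>R X (i + N)) \<le> g s" for i
      proof (rule AE_I2)
        fix s
        have seg: "\<bar>\<tau>\<bar> \<le> 1" if "\<tau> \<in> closed_segment 0 (X (i + N))" for \<tau>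
          using that le[of i] by (auto simp: closed_segment_eq_real_ivl split: if_splits)
        have "norm (F (X (i + N)) s - F 0 s) \<le> g s * \<bar>X (i + N)\<bar>"
          by (rule has_vector_derivative_bound[where f'="\<lambda>t. F' t s"]) (use seg F g in auto)
        moreover have "0 < \<bar>X (i + N)\<bar>" using X0 by auto
        ultimately show "norm ((F (X (i + N)) s - F 0 s) /\<^sub>R X (i + N)) \<le> g s"
          by (simp add: divide_inverse[symmetric] mult.commute[of "inverse _"] divide_le_eq)
      qed
    qed (use g in auto)
    moreover have "(\<integral>s. (F (X (i + N)) s - F 0 s) /\<^sub>R X (i + N) \<partial>M) =
        ((\<integral>s. F (X (i + N)) s \<partial>M) - (\<integral>s. F 0 s \<partial>M)) /\<^sub>R X (i + N)" for i
      using int[OF le[of i]] int[of 0] by simp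
    ultimately show "(\<lambda>i. ((\<integral>s. F (X (i + N)) s \<partial>M) - (\<integral>s. F 0 s \<partial>M)) /\<^sub>R X (i + N)) \<longlonglongrightarrow> (\<integral>s. F' 0 s \<partial>M)"
      by (simp only:)
  qed
qed

text \<open>Existence of partial derivatives alone does not give continuity; their boundedness gives
  a Lipschitz bound along axis-parallel paths.\<close>

lemma schwartz_continuous:
  fixes f :: "'a::euclidean_space \<Rightarrow> complex"
  assumes "schwartz f" shows "continuous_on UNIV f"
proof -
  obtain A where A: "0 \<le> A" "\<And>y. jet_bound (Suc 0) f y (A / (1 + norm y) ^ 0)"
    using schwartz_jet[OF assms] by metis
  have le: "norm (f y - f x) \<le> DIM('a) * A * norm (y - x)" for x y
    using jet_bound_translate_diff[OF schwartz_smooth[OF assms] A(2,1), of 0 "y - x" y]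
    by (simp add: jet_bound_0 norm_minus_commute)
  show ?thesis unfolding continuous_on_def
  proof
    fix x :: 'a
    have "((\<lambda>y. f y - f x) \<longlongrightarrow> 0) (at x within UNIV)"
    proof (rule Lim_null_comparison)
      show "\<forall>\<^sub>F y in at x within UNIV. norm (f y - f x) \<le> DIM('a) * A * norm (y - x)" using le by simp
      have "((\<lambda>y. DIM('a) * A * norm (y - x)) \<longlongrightarrow> DIM('a) * A * norm (x - x)) (at x within UNIV)"
        by (intro tendsto_intros)
      then show "((\<lambda>y. DIM('a) * A * norm (y - x)) \<longlongrightarrow> 0) (at x within UNIV)" by simp
    qed
    then show "(f \<longlongrightarrow> f x) (at x within UNIV)" by (simp add: LIM_zero_iff)
  qed
qed

lemma schwartz_rapid:
  assumes "schwartz f" shows "rapid f"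
  unfolding rapid_def
proof (intro conjI allI)
  show "f \<in> borel_measurable borel"
    using schwartz_continuous[OF assms] by (rule borel_measurable_continuous_onI)
  show "\<exists>C. \<forall>s. norm (f s) \<le> C / (1 + norm s) ^ k" for k
    using schwartz_jet[OF assms, of 0 k] by (auto simp: jet_bound_0)
qed

lemma schwartz_integrable: "schwartz f \<Longrightarrow> integrable lborel f"
  by (rule integrable_rapid[OF schwartz_rapid, of f f 1 0]) (auto intro: rapid_measurable schwartz_rapid)

section \<open>Integrals of tame families\<close>

lemma tame_smooth: "tame F \<Longrightarrow> smooth (F s)"
  by (simp add: tame_def)

lemma tame_jet:
  assumes "tame F" obtains C q where "0 \<le> C"
    "\<And>s y. jet_bound m (F s) y (C * (1 + norm s) ^ q / (1 + norm y) ^ k)"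
  using assms unfolding tame_def by metis

lemma tame_lipschitz:
  assumes "tame F" obtains C q where "0 \<le> C"
    "\<And>s s' y. jet_bound m (\<lambda>y. F s y - F s' y) y
        (C * norm (s - s') * (1 + norm s + norm s') ^ q / (1 + norm y) ^ k)"
  using assms unfolding tame_def by metis

lemma tame_schwartz: "tame F \<Longrightarrow> schwartz (F s)"
  by (rule schwartzI) (auto intro: tame_smooth, metis tame_jet)

lemma continuous_if_lipschitz_poly:
  fixes H :: "'s::euclidean_space \<Rightarrow> complex"
  assumes le: "\<And>s s'. norm (H s - H s') \<le> C * norm (s - s') * (1 + norm s + norm s') ^ q"
  shows "continuous_on UNIV H"
  unfolding continuous_on_def
proof
  fix s :: 's
  have "((\<lambda>s'. H s' - H s) \<longlongrightarrow> 0) (at s within UNIV)"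
  proof (rule Lim_null_comparison)
    show "\<forall>\<^sub>F s' in at s within UNIV. norm (H s' - H s) \<le> C * norm (s' - s) * (1 + norm s' + norm s) ^ q" using le by simp
    have "((\<lambda>s'. C * norm (s' - s) * (1 + norm s' + norm s) ^ q) \<longlongrightarrow> C * norm (s - s) * (1 + norm s + norm s) ^ q) (at s within UNIV)"
      by (intro tendsto_intros)
    then show "((\<lambda>s'. C * norm (s' - s) * (1 + norm s' + norm s) ^ q) \<longlongrightarrow> 0) (at s within UNIV)" by simp
  qed
  then show "(H \<longlongrightarrow> H s) (at s within UNIV)" by (simp add: LIM_zero_iff)
qed

text \<open>The Lipschitz bound in the parameter passes to each derivative at a fixed
  \<open>y\<close>, which is therefore continuous in \<open>s\<close>.\<close>

lemma tame_measurable: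
  fixes F :: "'s::euclidean_space \<Rightarrow> 'a::euclidean_space \<Rightarrow> complex"
  assumes F: "tame F" and bs: "set bs \<subseteq> Basis"
  shows "(\<lambda>s. dirderivs bs (F s) y) \<in> borel_measurable borel"
proof -
  obtain C q where C: "\<And>s s' y. jet_bound (length bs) (\<lambda>y. F s y - F s' y) y
        (C * norm (s - s') * (1 + norm s + norm s') ^ q / (1 + norm y) ^ 0)"
    using tame_lipschitz[OF F] by metis
  have "norm (dirderivs bs (F s) y - dirderivs bs (F s') y) \<le> C * norm (s - s') * (1 + norm s + norm s') ^ q" for s s'
    using jet_boundD[OF C[of s s' y] bs] by (simp add: dirderivs_diff[OF tame_smooth[OF F] tame_smooth[OF F] bs])
  then show ?thesis by (intro borel_measurable_continuous_onI continuous_if_lipschitz_poly)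
qed

lemma tame_integrable:
  fixes F :: "'s::euclidean_space \<Rightarrow> 'a::euclidean_space \<Rightarrow> complex"
  assumes F: "tame F" and w: "rapid w" and bs: "set bs \<subseteq> Basis"
  shows "integrable lborel (\<lambda>s. w s * dirderivs bs (F s) y)"
proof -
  obtain C q where C: "0 \<le> C" "\<And>s y. jet_bound (length bs) (F s) y (C * (1 + norm s) ^ q / (1 + norm y) ^ 0)"
    using tame_jet[OF F] by metis
  show ?thesis
  proof (rule integrable_rapid[OF w, of _ C q])
    show "(\<lambda>s. w s * dirderivs bs (F s) y) \<in> borel_measurable borel"
      using tame_measurable[OF F bs] rapid_measurable[OF w] by measurable
    fix s
    have "norm (w s) * norm (dirderivs bs (F s) y) \<le> norm (w s) * (C * (1 + norm s) ^ q)"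
      using jet_boundD[OF C(2) bs] by (intro mult_left_mono) auto
    then show "norm (w s * dirderivs bs (F s) y) \<le> C * (norm (w s) * (1 + norm s) ^ q)"
      by (simp add: norm_mult mult_ac)
  qed
qed

lemma tame_integral_partial:
  fixes F :: "'s::euclidean_space \<Rightarrow> 'a::euclidean_space \<Rightarrow> complex"
  assumes F: "tame F" and w: "rapid w" and bs: "set bs \<subseteq> Basis" and b: "b \<in> Basis"
  shows "has_partial (\<lambda>y. \<integral>s. w s * dirderivs bs (F s) y \<partial>lborel) b
     (\<lambda>y. \<integral>s. w s * dirderivs (b # bs) (F s) y \<partial>lborel)"
  unfolding has_partial_def
proof
  fix y
  obtain C q where C: "0 \<le> C" "\<And>s y. jet_bound (length (b # bs)) (F s) y (C * (1 + norm s) ^ q / (1 + norm y) ^ 0)"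
    using tame_jet[OF F] by metis
  have bbs: "set (b # bs) \<subseteq> Basis" using bs b by simp
  have "((\<lambda>t. \<integral>s. w s * dirderivs bs (F s) (y + t *\<^sub>R b) \<partial>lborel) has_vector_derivative
     (\<integral>s. w s * dirderivs (b # bs) (F s) (y + 0 *\<^sub>R b) \<partial>lborel)) (at 0)"
  proof (rule has_vector_derivative_integral[where g="\<lambda>s. C * (norm (w s) * (1 + norm s) ^ q)"
        and F'="\<lambda>t s. w s * dirderivs (b # bs) (F s) (y + t *\<^sub>R b)"])
    fix t :: real and s
    have "has_partial (\<lambda>y. w s * dirderivs bs (F s) y) b (\<lambda>y. w s * dirderivs (b # bs) (F s) y)"
      using smooth_has_partial[OF smooth_dirderivs[OF tame_smooth[OF F] bs] b]
      by (intro has_partial_cmult) simp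
    from has_partial_line[OF this]
    show "((\<lambda>t. w s * dirderivs bs (F s) (y + t *\<^sub>R b)) has_vector_derivative
      w s * dirderivs (b # bs) (F s) (y + t *\<^sub>R b)) (at t)" .
    have "norm (w s) * norm (dirderivs (b # bs) (F s) (y + t *\<^sub>R b)) \<le> norm (w s) * (C * (1 + norm s) ^ q)"
      using jet_boundD[OF C(2) bbs] by (intro mult_left_mono) auto
    then show "norm (w s * dirderivs (b # bs) (F s) (y + t *\<^sub>R b)) \<le> C * (norm (w s) * (1 + norm s) ^ q)"
      by (simp add: norm_mult mult_ac del: dirderivs.simps)
  next
    show "integrable lborel (\<lambda>s. C * (norm (w s) * (1 + norm s) ^ q))"
      by (intro integrable_mult_right integrable_rapid_weight w)
    show "(\<lambda>s. w s * dirderivs (b # bs) (F s) (y + 0 *\<^sub>R b)) \<in> borel_measurable lborel"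
      using borel_measurable_integrable[OF tame_integrable[OF F w bbs]] .
    show "integrable lborel (\<lambda>s. w s * dirderivs bs (F s) (y + t *\<^sub>R b))" for t
      by (rule tame_integrable[OF F w bs])
  qed
  then show "((\<lambda>t. \<integral>s. w s * dirderivs bs (F s) (y + t *\<^sub>R b) \<partial>lborel) has_vector_derivative
     (\<integral>s. w s * dirderivs (b # bs) (F s) y \<partial>lborel)) (at 0)" by simp
qed

lemma dirderivs_tame_integral:
  fixes F :: "'s::euclidean_space \<Rightarrow> 'a::euclidean_space \<Rightarrow> complex"
  assumes "tame F" "rapid w" "set bs \<subseteq> Basis"
  shows "dirderivs bs (\<lambda>y. \<integral>s. w s * F s y \<partial>lborel) = (\<lambda>y. \<integral>s. w s * dirderivs bs (F s) y \<partial>lborel)"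
  using assms(3)
proof (induction bs)
  case (Cons b bs)
  then show ?case
    using has_partialD[OF tame_integral_partial[OF assms(1,2), of bs b]] by simp
qed simp

lemma smooth_tame_integral:
  fixes F :: "'s::euclidean_space \<Rightarrow> 'a::euclidean_space \<Rightarrow> complex"
  assumes "tame F" "rapid w"
  shows "smooth (\<lambda>y. \<integral>s. w s * F s y \<partial>lborel)"
  unfolding smooth_def
proof (intro allI impI)
  fix bs :: "'a list" and b x :: 'a assume bs: "set bs \<subseteq> Basis" "b \<in> Basis"
  then have "set (b # bs) \<subseteq> Basis" by simp
  with tame_integral_partial[OF assms bs]
  show "((\<lambda>t. dirderivs bs (\<lambda>y. \<integral>s. w s * F s y \<partial>lborel) (x + t *\<^sub>R b)) has_vector_derivative
     dirderivs (b # bs) (\<lambda>y. \<integral>s. w s * F s y \<partial>lborel) x) (at 0)"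
    using bs by (simp only: dirderivs_tame_integral[OF assms] has_partial_def)
qed

text \<open>If \<open>h\<close> is not integrable, its Bochner integral is 0 by convention while the
  majorant is nonnegative; so users only have to exhibit the majorant.\<close>

lemma norm_integral_le:
  fixes h :: "'s \<Rightarrow> complex"
  assumes "integrable M g" "\<And>s. norm (h s) \<le> g s"
  shows "norm (\<integral>s. h s \<partial>M) \<le> (\<integral>s. g s \<partial>M)"
proof (cases "integrable M h")
  case True
  have "norm (\<integral>s. h s \<partial>M) \<le> (\<integral>s. norm (h s) \<partial>M)" by (rule integral_norm_bound)
  also have "\<dots> \<le> (\<integral>s. g s \<partial>M)" using True assms by (intro integral_mono) auto
  finally show ?thesis .
next
  case False
  have "0 \<le> g s" for s using assms(2)[of s] norm_ge_zero[of "h s"] by linarith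
  then show ?thesis using False by (simp add: not_integrable_integral_eq integral_nonneg)
qed

lemma schwartz_tame_integral:
  fixes F :: "'s::euclidean_space \<Rightarrow> 'a::euclidean_space \<Rightarrow> complex"
  assumes F: "tame F" and w: "rapid w"
  shows "schwartz (\<lambda>y. \<integral>s. w s * F s y \<partial>lborel)"
proof (rule schwartzI[OF smooth_tame_integral[OF assms]])
  fix m k
  obtain C q where C: "0 \<le> C" "\<And>s y. jet_bound m (F s) y (C * (1 + norm s) ^ q / (1 + norm y) ^ k)"
    using tame_jet[OF F] by metis
  let ?I = "\<integral>s. norm (w s) * (1 + norm s) ^ q \<partial>lborel"
  have "jet_bound m (\<lambda>y. \<integral>s. w s * F s y \<partial>lborel) y (C * ?I / (1 + norm y) ^ k)" for y
    unfolding jet_bound_def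
  proof (intro allI impI)
    fix bs :: "'a list" assume bs: "set bs \<subseteq> Basis \<and> length bs \<le> m"
    have "norm (\<integral>s. w s * dirderivs bs (F s) y \<partial>lborel) \<le> (\<integral>s. C / (1 + norm y) ^ k * (norm (w s) * (1 + norm s) ^ q) \<partial>lborel)"
    proof (rule norm_integral_le)
      show "integrable lborel (\<lambda>s. C / (1 + norm y) ^ k * (norm (w s) * (1 + norm s) ^ q))"
        by (intro integrable_mult_right integrable_rapid_weight w)
      fix s
      have "norm (w s) * norm (dirderivs bs (F s) y) \<le> norm (w s) * (C * (1 + norm s) ^ q / (1 + norm y) ^ k)"
        using jet_boundD[OF C(2)] bs by (intro mult_left_mono) auto
      then show "norm (w s * dirderivs bs (F s) y) \<le> C / (1 + norm y) ^ k * (norm (w s) * (1 + norm s) ^ q)"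
        by (simp add: norm_mult mult_ac)
    qed
    then show "norm (dirderivs bs (\<lambda>y. \<integral>s. w s * F s y \<partial>lborel) y) \<le> C * ?I / (1 + norm y) ^ k"
      using bs by (simp add: dirderivs_tame_integral[OF assms])
  qed
  then show "\<exists>C. \<forall>y. jet_bound m (\<lambda>y. \<integral>s. w s * F s y \<partial>lborel) y (C / (1 + norm y) ^ k)" by blast
qed

section \<open>Tempered distributions commute with integrals of tame families\<close>

text \<open>Fixes once and for all one seminorm that bounds \<open>u\<close>: \<open>m0\<close> is
  the order and \<open>k0\<close> the polynomial weight. The crude estimates below are expressed
  through these two numbers.\<close>

locale tempered_distribution =
  fixes u :: "('a::euclidean_space \<Rightarrow> complex) \<Rightarrow> complex" and C0 :: real and k0 m0 :: nat
  assumes u_add: "\<And>f g. schwartz f \<Longrightarrow> schwartz g \<Longrightarrow> u (\<lambda>x. f x + g x) = u f + u g"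
    and u_cmult: "\<And>c f. schwartz f \<Longrightarrow> u (\<lambda>x. c * f x) = c * u f"
    and C0: "0 \<le> C0"
    and u_bound: "\<And>f M. schwartz f \<Longrightarrow> (\<And>y. jet_bound m0 f y (M / (1 + norm y) ^ k0)) \<Longrightarrow> norm (u f) \<le> C0 * M"

lemma tempered_imp_distribution:
  fixes u :: "('a::euclidean_space \<Rightarrow> complex) \<Rightarrow> complex"
  assumes "tempered u"
  obtains C0 k0 m0 where "tempered_distribution u C0 k0 m0"
proof -
  from assms obtain C k m where u: "\<And>f M. schwartz f \<Longrightarrow> (\<forall>x bs. set bs \<subseteq> Basis \<and> length bs \<le> m \<longrightarrow>
       (1 + norm x) ^ k * norm (dirderivs bs f x) \<le> M) \<Longrightarrow> norm (u f) \<le> C * M"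
    unfolding tempered_def by metis
  \<comment> \<open>\<open>tempered\<close> does not prescribe the sign of \<open>C\<close>;
    monotonicity arguments want it nonnegative.\<close>
  have "tempered_distribution u \<bar>C\<bar> k m"
  proof
    fix f :: "'a \<Rightarrow> complex" and M assume f: "schwartz f" and M: "\<And>y. jet_bound m f y (M / (1 + norm y) ^ k)"
    have "0 \<le> M" using jet_bound_nonneg[OF M[of 0]] by simp
    have "norm (u f) \<le> C * M"
    proof (rule u[OF f], intro allI impI)
      fix x and bs :: "'a list" assume "set bs \<subseteq> Basis \<and> length bs \<le> m"
      then have "norm (dirderivs bs f x) \<le> M / (1 + norm x) ^ k" using jet_boundD[OF M] by auto
      then show "(1 + norm x) ^ k * norm (dirderivs bs f x) \<le> M"
        by (simp add: pos_le_divide_eq add_pos_nonneg mult.commute)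
    qed
    also have "\<dots> \<le> \<bar>C\<bar> * M" using \<open>0 \<le> M\<close> by (intro mult_right_mono) auto
    finally show "norm (u f) \<le> \<bar>C\<bar> * M" .
  qed (use assms in \<open>auto simp: tempered_def\<close>)
  then show thesis by (rule that)
qed

lemma schwartz_zero: "schwartz (\<lambda>x. 0)"
  by (rule schwartzI[OF smooth_const], rule exI[of _ 0])
    (auto intro: jet_bound_vanishing[of UNIV])

lemma schwartz_sum:
  assumes "finite I" "\<And>i. i \<in> I \<Longrightarrow> schwartz (f i)"
  shows "schwartz (\<lambda>y. \<Sum>i\<in>I. f i y)"
  using assms by (induction I rule: finite_induct) (auto intro: schwartz_add schwartz_zero)

lemma dirderivs_sum:
  assumes "finite I" "\<And>i. i \<in> I \<Longrightarrow> schwartz (f i)" "set bs \<subseteq> Basis"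
  shows "dirderivs bs (\<lambda>y. \<Sum>i\<in>I. f i y) = (\<lambda>y. \<Sum>i\<in>I. dirderivs bs (f i) y)"
  using assms(1,2)
proof (induction I rule: finite_induct)
  case empty
  show ?case using assms(3) by (induction bs) auto
next
  case (insert i I)
  have "dirderivs bs (\<lambda>y. f i y + (\<Sum>i\<in>I. f i y)) = (\<lambda>y. dirderivs bs (f i) y + dirderivs bs (\<lambda>y. \<Sum>i\<in>I. f i y) y)"
    using insert by (intro dirderivs_add schwartz_smooth schwartz_sum assms(3)) auto
  then show ?case using insert by simp
qed

context tempered_distribution
begin

lemma u_diff: "schwartz f \<Longrightarrow> schwartz g \<Longrightarrow> u (\<lambda>x. f x - g x) = u f - u g"
  using u_add[of f "\<lambda>x. -1 * g x"] u_cmult[of g "-1"] schwartz_cmult[of g "-1"] by simp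

lemma u_zero: "u (\<lambda>x. 0) = 0"
  using u_cmult[OF schwartz_zero, of 0] by simp

lemma u_sum:
  assumes "finite I" "\<And>i. i \<in> I \<Longrightarrow> schwartz (f i)"
  shows "u (\<lambda>y. \<Sum>i\<in>I. f i y) = (\<Sum>i\<in>I. u (f i))"
  using assms by (induction I rule: finite_induct) (auto simp: u_zero u_add schwartz_sum)

lemma u_tame_lipschitz:
  assumes "tame F"
  obtains C q where "0 \<le> C" "\<And>s s'. norm (u (F s) - u (F s')) \<le> C * norm (s - s') * (1 + norm s + norm s') ^ q"
proof -
  obtain C q where C: "0 \<le> C" "\<And>s s' y. jet_bound m0 (\<lambda>y. F s y - F s' y) y
        (C * norm (s - s') * (1 + norm s + norm s') ^ q / (1 + norm y) ^ k0)"
    using tame_lipschitz[OF assms] by metis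
  have "norm (u (F s) - u (F s')) \<le> C0 * C * norm (s - s') * (1 + norm s + norm s') ^ q" for s s'
    using u_bound[OF schwartz_diff[OF tame_schwartz tame_schwartz, OF assms assms] C(2), of s s']
    by (simp add: u_diff tame_schwartz assms mult_ac)
  then show thesis using that C C0 by (metis mult_nonneg_nonneg)
qed

lemma u_tame_bound:
  assumes "tame F"
  obtains C q where "0 \<le> C" "\<And>s. norm (u (F s)) \<le> C * (1 + norm s) ^ q"
proof -
  obtain C q where C: "0 \<le> C" "\<And>s y. jet_bound m0 (F s) y (C * (1 + norm s) ^ q / (1 + norm y) ^ k0)"
    using tame_jet[OF assms] by metis
  have "norm (u (F s)) \<le> C0 * C * (1 + norm s) ^ q" for s
    using u_bound[OF tame_schwartz[OF assms] C(2)] by (simp add: mult_ac)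
  then show thesis using that C C0 by (metis mult_nonneg_nonneg)
qed

lemma u_tame_measurable: "tame F \<Longrightarrow> (\<lambda>s. u (F s)) \<in> borel_measurable borel"
  by (elim u_tame_lipschitz) (intro borel_measurable_continuous_onI continuous_if_lipschitz_poly)

lemma u_tame_integrable:
  assumes F: "tame F" and w: "rapid w"
  shows "integrable lborel (\<lambda>s. w s * u (F s))"
proof -
  obtain C q where C: "0 \<le> C" "\<And>s. norm (u (F s)) \<le> C * (1 + norm s) ^ q" using u_tame_bound[OF F] by metis
  show ?thesis
  proof (rule integrable_rapid[OF w, of _ C q])
    show "(\<lambda>s. w s * u (F s)) \<in> borel_measurable borel"
      using u_tame_measurable[OF F] rapid_measurable[OF w] by measurable
    show "norm (w s * u (F s)) \<le> C * (norm (w s) * (1 + norm s) ^ q)" for s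
      using mult_left_mono[OF C(2), of "norm (w s)" s] by (simp add: norm_mult mult_ac)
  qed
qed

end

text \<open>Composition with a simple function turns the integral into a finite sum weighted by the
  masses of \<open>w\<close> on the level sets, and a linear functional can pass through such a
  sum.\<close>

lemma integral_simple_compose:
  fixes w :: "'s::euclidean_space \<Rightarrow> complex" and H :: "'s \<Rightarrow> complex"
  assumes w: "integrable lborel w" and \<sigma>: "simple_function lborel \<sigma>"
  shows "(\<integral>s. w s * H (\<sigma> s) \<partial>lborel) = (\<Sum>v\<in>range \<sigma>. (\<integral>s. w s * indicator (\<sigma> -` {v}) s \<partial>lborel) * H v)"
proof -
  have fin: "finite (range \<sigma>)" using \<sigma> by (simp add: simple_function_def)
  have meas: "\<sigma> -` {v} \<in> sets lborel" for v using simple_functionD(2)[OF \<sigma>, of "{v}"] by simp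
  have int: "integrable lborel (\<lambda>s. w s * indicator (\<sigma> -` {v}) s)" for v
    using integrable_mult_indicator[OF meas w, of v]
    by (rule back_subst[where P="integrable lborel"]) (auto simp: indicator_def)
  have "w s * H (\<sigma> s) = (\<Sum>v\<in>range \<sigma>. (w s * indicator (\<sigma> -` {v}) s) * H v)" for s
  proof -
    have "(\<Sum>v\<in>range \<sigma>. (w s * indicator (\<sigma> -` {v}) s) * H v) = (\<Sum>v\<in>range \<sigma>. if v = \<sigma> s then w s * H v else 0)"
      by (intro sum.cong) (auto simp: indicator_def)
    then show ?thesis using fin by simp
  qed
  then have "(\<integral>s. w s * H (\<sigma> s) \<partial>lborel) = (\<integral>s. (\<Sum>v\<in>range \<sigma>. (w s * indicator (\<sigma> -` {v}) s) * H v) \<partial>lborel)"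
    by simp
  also have "\<dots> = (\<Sum>v\<in>range \<sigma>. (\<integral>s. w s * indicator (\<sigma> -` {v}) s * H v \<partial>lborel))"
    by (rule Bochner_Integration.integral_sum) (intro integrable_mult_left int)
  finally show ?thesis by simp
qed

lemma poly_weight_double:
  assumes "norm (x::'s::real_normed_vector) \<le> 2 * norm s"
  shows "(1 + norm s + norm x) ^ q \<le> 3 ^ q * (1 + norm s) ^ q"
proof -
  have "(1 + norm s + norm x) ^ q \<le> (3 * (1 + norm s)) ^ q" using assms by (intro power_mono) auto
  then show ?thesis unfolding power_mult_distrib .
qed

text \<open>The identity map of the parameter space is approximated by simple functions
  \<open>\<sigma> n\<close>. Replacing \<open>s\<close> by \<open>\<sigma> n s\<close> yields finite
  sums \<open>G n\<close>, for which linearity settles the claim; then both sides converge, the left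
  one in the seminorm of \<open>u\<close>, the right one by dominated convergence.\<close>

theorem (in tempered_distribution) u_tame_integral:
  fixes F :: "'s::euclidean_space \<Rightarrow> 'a \<Rightarrow> complex"
  assumes F: "tame F" and w: "rapid w"
  shows "u (\<lambda>y. \<integral>s. w s * F s y \<partial>lborel) = (\<integral>s. w s * u (F s) \<partial>lborel)"
proof -
  let ?g = "\<lambda>y. \<integral>s. w s * F s y \<partial>lborel"
  note [measurable] = rapid_measurable[OF w] u_tame_measurable[OF F]
  have "(\<lambda>s::'s. s) \<in> borel_measurable lborel" by simp
  from borel_measurable_implies_sequence_metric[OF this, of 0] obtain \<sigma> :: "nat \<Rightarrow> 's \<Rightarrow> 's" where
    simple: "\<And>n. simple_function lborel (\<sigma> n)" and lim: "\<And>s. (\<lambda>n. \<sigma> n s) \<longlonglongrightarrow> s" and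
    le: "\<And>n s. norm (\<sigma> n s) \<le> 2 * norm s"
    by (auto simp: dist_norm)
  have meas[measurable]: "\<sigma> n \<in> borel_measurable borel" for n
    using borel_measurable_simple_function[OF simple[of n]] by simp
  have fin: "finite (range (\<sigma> n))" for n using simple[of n] by (simp add: simple_function_def)
  have wint: "integrable lborel w"
    by (rule integrable_rapid[OF w, of w 1 0]) (auto intro: rapid_measurable[OF w])
  define c where "c n v = (\<integral>s. w s * indicator (\<sigma> n -` {v}) s \<partial>lborel)" for n v
  define G where "G n y = (\<Sum>v\<in>range (\<sigma> n). c n v * F v y)" for n y
  have comp: "(\<integral>s. w s * H (\<sigma> n s) \<partial>lborel) = (\<Sum>v\<in>range (\<sigma> n). c n v * H v)" for n and H :: "'s \<Rightarrow> complex"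
    unfolding c_def by (rule integral_simple_compose[OF wint simple])
  have SG: "schwartz (G n)" for n
    unfolding G_def[abs_def] by (intro schwartz_sum fin schwartz_cmult tame_schwartz F)
  have DG: "dirderivs bs (G n) y = (\<integral>s. w s * dirderivs bs (F (\<sigma> n s)) y \<partial>lborel)" if "set bs \<subseteq> Basis" for bs n y
    unfolding G_def[abs_def] comp[of "\<lambda>v. dirderivs bs (F v) y"]
    by (subst dirderivs_sum[OF fin schwartz_cmult[OF tame_schwartz[OF F]] that])
      (simp add: dirderivs_cmult[OF tame_smooth[OF F] that])
  have uG: "u (G n) = (\<integral>s. w s * u (F (\<sigma> n s)) \<partial>lborel)" for n
    unfolding G_def[abs_def] comp[of "\<lambda>v. u (F v)"]
    by (simp add: u_sum[OF fin] schwartz_cmult tame_schwartz[OF F] u_cmult)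
  obtain C q where C: "0 \<le> C" "\<And>s s' y. jet_bound m0 (\<lambda>y. F s y - F s' y) y
        (C * norm (s - s') * (1 + norm s + norm s') ^ q / (1 + norm y) ^ k0)"
    using tame_lipschitz[OF F] by metis
  \<comment> \<open>One scalar error controls all derivatives and all \<open>y\<close> at once,
    because the Lipschitz bound of a tame family is uniform in both.\<close>
  define e where "e n = (\<integral>s. norm (w s) * norm (s - \<sigma> n s) * (1 + norm s + norm (\<sigma> n s)) ^ q \<partial>lborel)" for n
  \<comment> \<open>From \<open>norm (\<sigma> n s) \<le> 2 * norm s\<close> the integrand of
    \<open>e n\<close> gets a majorant that does not depend on \<open>n\<close>.\<close>
  have dom: "norm (w s) * norm (s - \<sigma> n s) * (1 + norm s + norm (\<sigma> n s)) ^ q \<le> 3 ^ Suc q * (norm (w s) * (1 + norm s) ^ Suc q)" for n s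
  proof -
    have "norm (s - \<sigma> n s) \<le> 3 * (1 + norm s)" using norm_triangle_ineq4[of s "\<sigma> n s"] le[of n s] by simp
    then have "norm (w s) * norm (s - \<sigma> n s) * (1 + norm s + norm (\<sigma> n s)) ^ q \<le>
        norm (w s) * (3 * (1 + norm s)) * (3 ^ q * (1 + norm s) ^ q)"
      by (intro mult_mono poly_weight_double le) auto
    then show ?thesis unfolding power_Suc by (simp only: mult_ac)
  qed
  have int_dom: "integrable lborel (\<lambda>s. 3 ^ Suc q * (norm (w s) * (1 + norm s) ^ Suc q))" for q
    by (intro integrable_mult_right integrable_rapid_weight w)
  have int_e: "integrable lborel (\<lambda>s. norm (w s) * norm (s - \<sigma> n s) * (1 + norm s + norm (\<sigma> n s)) ^ q)" for n
    by (rule Bochner_Integration.integrable_bound[OF int_dom[of q]]) (use dom in auto)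
  \<comment> \<open>The limit integrand is left as the limit rules produce it, with the factor
    \<open>norm (s - s)\<close>; it is zero.\<close>
  have "e \<longlonglongrightarrow> (\<integral>s. norm (w s) * norm (s - s) * (1 + norm s + norm s) ^ q \<partial>(lborel::'s measure))"
    unfolding e_def[abs_def]
  proof (rule integral_dominated_convergence[OF _ _ int_dom[of q]])
    show "AE s in lborel. (\<lambda>n. norm (w s) * norm (s - \<sigma> n s) * (1 + norm s + norm (\<sigma> n s)) ^ q)
       \<longlonglongrightarrow> norm (w s) * norm (s - s) * (1 + norm s + norm s) ^ q"
      by (intro AE_I2 tendsto_intros lim)
  qed (use dom in auto)
  then have e0: "e \<longlonglongrightarrow> 0" by simp
  have bnd: "norm (u ?g - u (G n)) \<le> C0 * (C * e n)" for n
  proof -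
    have "norm (u (\<lambda>y. ?g y - G n y)) \<le> C0 * (C * e n)"
    proof (rule u_bound)
      show "schwartz (\<lambda>y. ?g y - G n y)" by (intro schwartz_diff schwartz_tame_integral F w SG)
      fix y
      show "jet_bound m0 (\<lambda>y. ?g y - G n y) y (C * e n / (1 + norm y) ^ k0)"
        unfolding jet_bound_def
      proof (intro allI impI)
        fix bs :: "'a list" assume bs: "set bs \<subseteq> Basis \<and> length bs \<le> m0"
        note [measurable] = tame_measurable[OF F, of bs y]
        obtain B p where B: "0 \<le> B" "\<And>s y. jet_bound m0 (F s) y (B * (1 + norm s) ^ p / (1 + norm y) ^ 0)"
          using tame_jet[OF F] by metis
        have i2: "integrable lborel (\<lambda>s. w s * dirderivs bs (F (\<sigma> n s)) y)"
        proof (rule integrable_rapid[OF w, of _ "3 ^ p * B" p])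
          show "(\<lambda>s. w s * dirderivs bs (F (\<sigma> n s)) y) \<in> borel_measurable borel"
            using bs by (intro borel_measurable_times rapid_measurable[OF w] measurable_compose[OF meas tame_measurable[OF F]]) auto
          fix s
          have "norm (dirderivs bs (F (\<sigma> n s)) y) \<le> B * (1 + norm (\<sigma> n s)) ^ p"
            using jet_boundD[OF B(2)[of "\<sigma> n s" y]] bs by auto
          also have "\<dots> \<le> B * (1 + norm s + norm (\<sigma> n s)) ^ p"
            using B(1) by (intro mult_left_mono power_mono) auto
          also have "\<dots> \<le> B * (3 ^ p * (1 + norm s) ^ p)"
            using B(1) by (intro mult_left_mono poly_weight_double le) auto
          finally have "norm (w s) * norm (dirderivs bs (F (\<sigma> n s)) y) \<le> norm (w s) * (B * (3 ^ p * (1 + norm s) ^ p))"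
            by (intro mult_left_mono) auto
          then show "norm (w s * dirderivs bs (F (\<sigma> n s)) y) \<le> 3 ^ p * B * (norm (w s) * (1 + norm s) ^ p)"
            by (simp add: norm_mult mult_ac)
        qed
        have "dirderivs bs (\<lambda>y. ?g y - G n y) y = dirderivs bs ?g y - dirderivs bs (G n) y"
          using bs by (simp add: dirderivs_diff smooth_tame_integral[OF F w] schwartz_smooth[OF SG])
        also have "\<dots> = (\<integral>s. w s * dirderivs bs (F s) y - w s * dirderivs bs (F (\<sigma> n s)) y \<partial>lborel)"
          using bs i2 tame_integrable[OF F w, of bs y] by (simp add: dirderivs_tame_integral[OF F w] DG)
        also have "norm \<dots> \<le> (\<integral>s. C / (1 + norm y) ^ k0 * (norm (w s) * norm (s - \<sigma> n s) * (1 + norm s + norm (\<sigma> n s)) ^ q) \<partial>lborel)"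
        proof (rule norm_integral_le)
          show "integrable lborel (\<lambda>s. C / (1 + norm y) ^ k0 * (norm (w s) * norm (s - \<sigma> n s) * (1 + norm s + norm (\<sigma> n s)) ^ q))"
            by (intro integrable_mult_right int_e)
          fix s
          have "norm (dirderivs bs (F s) y - dirderivs bs (F (\<sigma> n s)) y) \<le>
             C * norm (s - \<sigma> n s) * (1 + norm s + norm (\<sigma> n s)) ^ q / (1 + norm y) ^ k0"
            using jet_boundD[OF C(2)[of s "\<sigma> n s" y]] bs by (simp add: dirderivs_diff tame_smooth[OF F])
          then have "norm (w s) * norm (dirderivs bs (F s) y - dirderivs bs (F (\<sigma> n s)) y) \<le>
             norm (w s) * (C * norm (s - \<sigma> n s) * (1 + norm s + norm (\<sigma> n s)) ^ q / (1 + norm y) ^ k0)"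
            by (intro mult_left_mono) auto
          then show "norm (w s * dirderivs bs (F s) y - w s * dirderivs bs (F (\<sigma> n s)) y) \<le>
            C / (1 + norm y) ^ k0 * (norm (w s) * norm (s - \<sigma> n s) * (1 + norm s + norm (\<sigma> n s)) ^ q)"
            by (simp add: right_diff_distrib[symmetric] norm_mult mult_ac)
        qed
        also have "\<dots> = C * e n / (1 + norm y) ^ k0" by (simp add: e_def)
        finally show "norm (dirderivs bs (\<lambda>y. ?g y - G n y) y) \<le> C * e n / (1 + norm y) ^ k0" .
      qed
    qed
    then show ?thesis by (simp add: u_diff schwartz_tame_integral[OF F w] SG)
  qed
  have "(\<lambda>n. u ?g - u (G n)) \<longlonglongrightarrow> 0"
  proof (rule Lim_null_comparison)
    show "\<forall>\<^sub>F n in sequentially. norm (u ?g - u (G n)) \<le> C0 * (C * e n)" using bnd by simp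
    show "(\<lambda>n. C0 * (C * e n)) \<longlonglongrightarrow> 0" using tendsto_mult[OF tendsto_const tendsto_mult[OF tendsto_const e0]] by fastforce
  qed
  then have "(\<lambda>n. u ?g - (u ?g - u (G n))) \<longlonglongrightarrow> u ?g - 0" by (intro tendsto_diff tendsto_const)
  then have lim1: "(\<lambda>n. u (G n)) \<longlonglongrightarrow> u ?g" by simp
  obtain B p where B: "0 \<le> B" "\<And>s. norm (u (F s)) \<le> B * (1 + norm s) ^ p" using u_tame_bound[OF F] by metis
  obtain L r where L: "\<And>s s'. norm (u (F s) - u (F s')) \<le> L * norm (s - s') * (1 + norm s + norm s') ^ r"
    using u_tame_lipschitz[OF F] by metis
  have cont: "continuous_on UNIV (\<lambda>s. u (F s))" using L by (rule continuous_if_lipschitz_poly)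
  have "(\<lambda>n. \<integral>s. w s * u (F (\<sigma> n s)) \<partial>lborel) \<longlonglongrightarrow> (\<integral>s. w s * u (F s) \<partial>lborel)"
  proof (rule integral_dominated_convergence[where w="\<lambda>s. (B * 3 ^ p) * (norm (w s) * (1 + norm s) ^ p)"])
    show "integrable lborel (\<lambda>s. (B * 3 ^ p) * (norm (w s) * (1 + norm s) ^ p))"
      by (intro integrable_mult_right integrable_rapid_weight w)
    show "(\<lambda>s. w s * u (F (\<sigma> n s))) \<in> borel_measurable lborel" for n by measurable
    show "AE s in lborel. (\<lambda>n. w s * u (F (\<sigma> n s))) \<longlonglongrightarrow> w s * u (F s)"
      using continuous_on_tendsto_compose[OF cont lim] by (intro AE_I2 tendsto_mult tendsto_const) auto
    show "AE s in lborel. norm (w s * u (F (\<sigma> n s))) \<le> (B * 3 ^ p) * (norm (w s) * (1 + norm s) ^ p)" for n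
    proof (rule AE_I2)
      fix s
      have "norm (u (F (\<sigma> n s))) \<le> B * (1 + norm (\<sigma> n s)) ^ p" by (rule B)
      also have "\<dots> \<le> B * (1 + norm s + norm (\<sigma> n s)) ^ p"
        using B(1) by (intro mult_left_mono power_mono) auto
      also have "\<dots> \<le> B * (3 ^ p * (1 + norm s) ^ p)"
        using B(1) by (intro mult_left_mono poly_weight_double le) auto
      finally have "norm (w s) * norm (u (F (\<sigma> n s))) \<le> norm (w s) * (B * (3 ^ p * (1 + norm s) ^ p))"
        by (intro mult_left_mono) auto
      then show "norm (w s * u (F (\<sigma> n s))) \<le> (B * 3 ^ p) * (norm (w s) * (1 + norm s) ^ p)"
        by (simp add: norm_mult mult_ac)
    qed
  qed auto
  then have "(\<lambda>n. u (G n)) \<longlonglongrightarrow> (\<integral>s. w s * u (F s) \<partial>lborel)" by (simp add: uG)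
  with lim1 show ?thesis by (rule LIMSEQ_unique)
qed

section \<open>Bump functions and the Gaussian\<close>

text \<open>The polynomial parameter makes this family of flat functions closed under
  differentiation: with \<open>s = 1 / t\<close>, the derivative in \<open>t\<close> of
  \<open>p s * exp (- s)\<close> is
  \<open>s\<^sup>2 * (p s - pderiv p s) * exp (- s)\<close>.\<close>

definition flat_exp :: "real poly \<Rightarrow> real \<Rightarrow> complex" where
  "flat_exp p t = of_real (if t > 0 then poly p (1 / t) * exp (- (1 / t)) else 0)"

lemma poly_exp_tendsto_0: "((\<lambda>s. poly p s * exp (- s)) \<longlongrightarrow> (0::real)) at_top"
proof -
  have "((\<lambda>s. \<Sum>i\<le>degree p. coeff p i * (s ^ i / exp s)) \<longlongrightarrow> (\<Sum>i\<le>degree p. coeff p i * 0)) at_top"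
    by (intro tendsto_sum tendsto_mult tendsto_const tendsto_power_div_exp_0)
  then show ?thesis
    by (simp add: poly_altdef sum_distrib_right exp_minus divide_inverse mult.assoc)
qed

lemma flat_exp_tendsto_0: "(flat_exp p \<longlongrightarrow> 0) (at 0)"
proof -
  have "((\<lambda>h. poly p (inverse h) * exp (- inverse h)) \<longlongrightarrow> (0::real)) (at_right 0)"
    by (rule filterlim_compose[OF poly_exp_tendsto_0 filterlim_inverse_at_top_right])
  then have "((\<lambda>h. complex_of_real (poly p (inverse h) * exp (- inverse h))) \<longlongrightarrow> 0) (at_right 0)"
    using tendsto_of_real[of _ "0::real"] by fastforce
  then have r: "(flat_exp p \<longlongrightarrow> 0) (at_right 0)"
    by (rule Lim_transform_eventually)
      (auto simp: flat_exp_def eventually_at_filter inverse_eq_divide)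
  have l: "(flat_exp p \<longlongrightarrow> 0) (at_left 0)"
    by (rule Lim_transform_eventually[OF tendsto_const]) (auto simp: flat_exp_def eventually_at_filter)
  show ?thesis using r l by (simp add: filterlim_split_at)
qed

lemma flat_exp_derivative:
  "(flat_exp p has_vector_derivative flat_exp ([:0, 0, 1:] * (p - pderiv p)) t) (at t)"
proof -
  consider "t > 0" | "t < 0" | "t = 0" by linarith
  then show ?thesis
  proof cases
    case 1
    have "((\<lambda>t. poly p (1 / t) * exp (- (1 / t))) has_real_derivative
        poly (pderiv p) (1 / t) * (- 1 / t\<^sup>2) * exp (- (1 / t)) + poly p (1 / t) * (exp (- (1 / t)) * (1 / t\<^sup>2))) (at t)"
      using 1 by (auto intro!: derivative_eq_intros DERIV_chain'[OF _ poly_DERIV] simp: power2_eq_square)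
    moreover have "poly (pderiv p) (1 / t) * (- 1 / t\<^sup>2) * exp (- (1 / t)) + poly p (1 / t) * (exp (- (1 / t)) * (1 / t\<^sup>2))
       = poly ([:0, 0, 1:] * (p - pderiv p)) (1 / t) * exp (- (1 / t))"
      by (simp add: algebra_simps power2_eq_square)
    ultimately have "((\<lambda>t. poly p (1 / t) * exp (- (1 / t))) has_real_derivative
       poly ([:0, 0, 1:] * (p - pderiv p)) (1 / t) * exp (- (1 / t))) (at t)" by (simp only:)
    then have "((\<lambda>t. complex_of_real (poly p (1 / t) * exp (- (1 / t)))) has_vector_derivative
       of_real (poly ([:0, 0, 1:] * (p - pderiv p)) (1 / t) * exp (- (1 / t)))) (at t)"
      by (rule has_vector_derivative_of_real)
    then have "(flat_exp p has_vector_derivative of_real (poly ([:0, 0, 1:] * (p - pderiv p)) (1 / t) * exp (- (1 / t)))) (at t)"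
      by (rule has_vector_derivative_transform_within_open[of _ _ _ "{0<..}"]) (use 1 in \<open>auto simp: flat_exp_def\<close>)
    then show ?thesis using 1 by (simp add: flat_exp_def)
  next
    case 2
    have "((\<lambda>t::real. 0::complex) has_vector_derivative 0) (at t)" by simp
    then have "(flat_exp p has_vector_derivative 0) (at t)"
      by (rule has_vector_derivative_transform_within_open[of _ _ _ "{..<0}"]) (use 2 in \<open>auto simp: flat_exp_def\<close>)
    then show ?thesis using 2 by (simp add: flat_exp_def)
  next
    case 3
    have "((\<lambda>h. (flat_exp p h - flat_exp p 0) /\<^sub>R h) \<longlongrightarrow> 0) (at 0)"
    \<comment> \<open>At 0 the difference quotient is again a flat function: dividing by
      \<open>h\<close> multiplies the polynomial by its variable.\<close>
    proof (rule Lim_transform_eventually[OF flat_exp_tendsto_0[of "pCons 0 p"]])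
      show "\<forall>\<^sub>F h in at 0. flat_exp (pCons 0 p) h = (flat_exp p h - flat_exp p 0) /\<^sub>R h"
        by (auto simp: flat_exp_def eventually_at_filter scaleR_conv_of_real divide_inverse)
    qed
    then show ?thesis using 3 by (simp add: has_vector_derivative_iff_quotient flat_exp_def)
  qed
qed

lemma has_partial_real:
  assumes "\<And>t. (f has_vector_derivative f' t) (at t)"
  shows "has_partial f (1::real) f'"
  unfolding has_partial_def
proof
  fix x :: real
  have "((\<lambda>t. x + t) has_vector_derivative 1) (at 0)" by (auto intro!: derivative_eq_intros)
  from vector_diff_chain_at[OF this, of f "f' x"] assms[of x]
  show "((\<lambda>t. f (x + t *\<^sub>R 1)) has_vector_derivative f' x) (at 0)" by (simp add: o_def)
qed

lemma has_partial_realD: "has_partial f (1::real) f' \<Longrightarrow> (f has_vector_derivative f' t) (at t)"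
  using has_partial_line[of f 1 f' 0 t UNIV] by simp

lemma smooth_flat_exp: "smooth (flat_exp p)"
proof (rule smooth_coinduct[where X="\<lambda>h. h \<in> range flat_exp"])
  show "\<exists>g. g \<in> range flat_exp \<and> has_partial h b g" if "h \<in> range flat_exp" "b \<in> Basis" for h b
    using that has_partial_real[OF flat_exp_derivative] by auto
qed simp

lemma has_partial_inverse_power:
  assumes f: "has_partial f b f'" and nz: "\<And>x. f x \<noteq> 0"
  shows "has_partial (\<lambda>x. inverse (f x) ^ n) b (\<lambda>x. - of_nat n * f' x * inverse (f x) ^ Suc n)"
  unfolding has_partial_def
proof
  fix x
  have nz': "f (x + 0 *\<^sub>R b) \<noteq> 0" using nz by blast
  have "((\<lambda>z. inverse z ^ n) has_field_derivative - of_nat n * inverse (f (x + 0 *\<^sub>R b)) ^ Suc n) (at (f (x + 0 *\<^sub>R b)))"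
    using DERIV_power[OF DERIV_inverse[OF nz'], of n] by (cases n) (simp_all add: algebra_simps)
  from field_vector_diff_chain_at[OF has_partial_line[OF f, of x 0 UNIV] this]
  show "((\<lambda>t. inverse (f (x + t *\<^sub>R b)) ^ n) has_vector_derivative - of_nat n * f' x * inverse (f x) ^ Suc n) (at 0)"
    by (simp add: o_def mult_ac)
qed

text \<open>The quotients of smooth functions by powers of \<open>f\<close> form a class closed
  under partial derivatives, by the quotient rule.\<close>

lemma smooth_divide:
  fixes f g :: "'a::euclidean_space \<Rightarrow> complex"
  assumes "smooth g" "smooth f" and nz: "\<And>x. f x \<noteq> 0"
  shows "smooth (\<lambda>x. g x / f x)"
proof (rule smooth_coinduct[where X="\<lambda>h. \<exists>g n. smooth g \<and> h = (\<lambda>x. g x * inverse (f x) ^ n)"])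
  show "\<exists>g' n. smooth g' \<and> (\<lambda>x. g x / f x) = (\<lambda>x. g' x * inverse (f x) ^ n)"
    by (intro exI[of _ g] exI[of _ 1]) (simp add: assms divide_inverse)
  fix h :: "'a \<Rightarrow> complex" and b :: 'a
  assume "\<exists>g n. smooth g \<and> h = (\<lambda>x. g x * inverse (f x) ^ n)" and b: "b \<in> Basis"
  then obtain g n where g: "smooth g" and h: "h = (\<lambda>x. g x * inverse (f x) ^ n)" by blast
  let ?g = "\<lambda>x. dirderivs [b] g x * f x + (- of_nat n) * (g x * dirderivs [b] f x)"
  have "has_partial h b (\<lambda>x. dirderivs [b] g x * inverse (f x) ^ n + g x * (- of_nat n * dirderivs [b] f x * inverse (f x) ^ Suc n))"
    unfolding h by (intro has_partial_mult has_partial_inverse_power smooth_has_partial g assms b)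
  moreover have "dirderivs [b] g x * inverse (f x) ^ n + g x * (- of_nat n * dirderivs [b] f x * inverse (f x) ^ Suc n)
     = ?g x * inverse (f x) ^ Suc n" for x
    using nz[of x] by (simp add: field_simps)
  ultimately have "has_partial h b (\<lambda>x. ?g x * inverse (f x) ^ Suc n)" by (simp only:)
  moreover have "smooth ?g" by (intro smooth_add smooth_mult smooth_const smooth_partial assms g b)
  ultimately show "\<exists>k. (\<exists>g n. smooth g \<and> k = (\<lambda>x. g x * inverse (f x) ^ n)) \<and> has_partial h b k" by blast
qed

lemma schwartz_coinduct:
  assumes "X f" and step: "\<And>f b. X f \<Longrightarrow> b \<in> Basis \<Longrightarrow> \<exists>g. X g \<and> has_partial f b g"
    and decay: "\<And>f k. X f \<Longrightarrow> \<exists>C. \<forall>y. (1 + norm y) ^ k * norm (f y) \<le> C"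
  shows "schwartz f"
proof -
  have sm: "smooth f" by (rule smooth_coinduct[of X]) fact+
  have X: "X (dirderivs bs f)" if "set bs \<subseteq> Basis" for bs
    using that
  proof (induction bs)
    case (Cons b bs)
    then obtain g where "X g" "has_partial (dirderivs bs f) b g" using step by force
    then show ?case using has_partialD[of "dirderivs bs f" b g] by simp
  qed (use assms(1) in simp)
  then show ?thesis using sm decay unfolding schwartz_def smooth_def by blast
qed

text \<open>The coefficients that the chain rule produces when a function of
  \<open>y \<bullet> y\<close> is differentiated; of these only closure under partials and
  polynomial growth are wanted.\<close>

inductive polyfun :: "('a::euclidean_space \<Rightarrow> complex) \<Rightarrow> bool" where
  const: "polyfun (\<lambda>y. c)"
| coord: "polyfun (\<lambda>y. of_real (y \<bullet> b))"
| mult: "polyfun p \<Longrightarrow> polyfun q \<Longrightarrow> polyfun (\<lambda>y. p y * q y)"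
| add: "polyfun p \<Longrightarrow> polyfun q \<Longrightarrow> polyfun (\<lambda>y. p y + q y)"

lemma has_partial_coord: "has_partial (\<lambda>y. of_real (y \<bullet> c)) b (\<lambda>y. of_real (b \<bullet> c))"
  unfolding has_partial_def
proof
  fix x
  have "((\<lambda>t. x \<bullet> c + t * (b \<bullet> c)) has_real_derivative b \<bullet> c) (at 0)" by (auto intro!: derivative_eq_intros)
  then show "((\<lambda>t. complex_of_real ((x + t *\<^sub>R b) \<bullet> c)) has_vector_derivative of_real (b \<bullet> c)) (at 0)"
    by (simp add: inner_add_left has_real_derivative_iff_has_vector_derivative has_vector_derivative_of_real del: of_real_add)
qed

lemma polyfun_partial: "polyfun p \<Longrightarrow> \<exists>q. polyfun q \<and> has_partial p b q"
proof (induction rule: polyfun.induct)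
  case (const c) then show ?case using has_partial_const polyfun.const by blast
next
  case (coord c) then show ?case using has_partial_coord polyfun.const by blast
next
  case (mult p q)
  then obtain p' q' where "polyfun p'" "has_partial p b p'" "polyfun q'" "has_partial q b q'" by blast
  then show ?case using mult.hyps
    by (intro exI[of _ "\<lambda>x. p' x * q x + p x * q' x"] conjI has_partial_mult polyfun.add polyfun.mult)
next
  case (add p q)
  then obtain p' q' where "polyfun p'" "has_partial p b p'" "polyfun q'" "has_partial q b q'" by blast
  then show ?case
    by (intro exI[of _ "\<lambda>x. p' x + q' x"] conjI has_partial_add polyfun.add)
qed

lemma polyfun_growth: "polyfun p \<Longrightarrow> \<exists>C k. 0 \<le> C \<and> (\<forall>y. norm (p y) \<le> C * (1 + norm y) ^ k)"
proof (induction rule: polyfun.induct)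
  case (const c) then show ?case by (intro exI[of _ "norm c"] exI[of _ 0]) auto
next
  case (coord b)
  have "norm (complex_of_real (y \<bullet> b)) \<le> norm b * (1 + norm y) ^ 1" for y
    using Cauchy_Schwarz_ineq2[of y b] norm_ge_zero[of b] by (simp add: algebra_simps add_increasing)
  then show ?case using norm_ge_zero by blast
next
  case (mult p q)
  then obtain C k D l where *: "0 \<le> C" "\<And>y. norm (p y) \<le> C * (1 + norm y) ^ k" "0 \<le> D" "\<And>y. norm (q y) \<le> D * (1 + norm y) ^ l"
    by blast
  have "norm (p y * q y) \<le> (C * D) * (1 + norm y) ^ (k + l)" for y
    using mult_mono[OF *(2)[of y] *(4)[of y]] * by (simp add: norm_mult power_add mult_ac)
  then show ?case using * by (meson mult_nonneg_nonneg)
next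
  case (add p q)
  then obtain C k D l where *: "0 \<le> C" "\<And>y. norm (p y) \<le> C * (1 + norm y) ^ k" "0 \<le> D" "\<And>y. norm (q y) \<le> D * (1 + norm y) ^ l"
    by blast
  have "norm (p y + q y) \<le> (C + D) * (1 + norm y) ^ (k + l)" for y
  proof -
    have "norm (p y + q y) \<le> C * (1 + norm y) ^ k + D * (1 + norm y) ^ l"
      using * by (intro norm_triangle_mono) auto
    also have "\<dots> \<le> C * (1 + norm y) ^ (k + l) + D * (1 + norm y) ^ (k + l)"
      using * by (intro add_mono mult_left_mono power_increasing) auto
    finally show ?thesis by (simp add: distrib_right)
  qed
  then show ?case using * by (meson add_nonneg_nonneg)
qed

text \<open>Decay is required for \<open>t \<ge> 0\<close>, since \<open>t\<close> stands for
  \<open>y \<bullet> y\<close>; the profile \<open>exp (- t / 2)\<close> of the Gaussian grows for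
  negative \<open>t\<close>.\<close>

definition radial_profile :: "(real \<Rightarrow> complex) \<Rightarrow> bool" where
  "radial_profile a \<longleftrightarrow> smooth a \<and>
     (\<forall>bs k. set bs \<subseteq> Basis \<longrightarrow> (\<exists>C. \<forall>t\<ge>0. norm (dirderivs bs a t) \<le> C / (1 + t) ^ k))"

lemma radial_profile_derivative:
  assumes "radial_profile a" shows "radial_profile (dirderivs [1] a)"
  unfolding radial_profile_def
proof (intro conjI allI impI)
  show "smooth (dirderivs [1] a)" using assms by (intro smooth_dirderivs) (auto simp: radial_profile_def)
  fix bs :: "real list" and k assume "set bs \<subseteq> Basis"
  then have "set (bs @ [1]) \<subseteq> Basis" by simp
  then show "\<exists>C. \<forall>t\<ge>0. norm (dirderivs bs (dirderivs [1] a) t) \<le> C / (1 + t) ^ k"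
    using assms unfolding radial_profile_def dirderivs_append[symmetric] by blast
qed

text \<open>A class containing \<open>y \<mapsto> a (y \<bullet> y)\<close> and closed under partial derivatives.\<close>

inductive radial_sum :: "('a::euclidean_space \<Rightarrow> complex) \<Rightarrow> bool" where
  gen: "polyfun p \<Longrightarrow> radial_profile a \<Longrightarrow> radial_sum (\<lambda>y. p y * a (y \<bullet> y))"
| add: "radial_sum f \<Longrightarrow> radial_sum g \<Longrightarrow> radial_sum (\<lambda>y. f y + g y)"

lemma has_partial_radial:
  assumes "smooth a"
  shows "has_partial (\<lambda>y::'a::euclidean_space. a (y \<bullet> y)) b (\<lambda>y. 2 * of_real (y \<bullet> b) * dirderivs [1] a (y \<bullet> y))"
  unfolding has_partial_def
proof
  fix x :: 'a
  have "((\<lambda>t. x \<bullet> x + 2 * t * (x \<bullet> b) + t\<^sup>2 * (b \<bullet> b)) has_real_derivative 2 * (x \<bullet> b)) (at 0)"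
    by (auto intro!: derivative_eq_intros)
  then have 1: "((\<lambda>t. (x + t *\<^sub>R b) \<bullet> (x + t *\<^sub>R b)) has_vector_derivative 2 * (x \<bullet> b)) (at 0)"
    by (simp add: has_real_derivative_iff_has_vector_derivative inner_add inner_commute algebra_simps power2_eq_square)
  have 2: "(a has_vector_derivative dirderivs [1] a (x \<bullet> x)) (at ((x + 0 *\<^sub>R b) \<bullet> (x + 0 *\<^sub>R b)))"
    using has_partial_realD[OF smooth_has_partial[OF assms], of "x \<bullet> x"] by simp
  from vector_diff_chain_at[OF 1 2]
  show "((\<lambda>t. a ((x + t *\<^sub>R b) \<bullet> (x + t *\<^sub>R b))) has_vector_derivative 2 * of_real (x \<bullet> b) * dirderivs [1] a (x \<bullet> x)) (at 0)"
    by (simp add: o_def scaleR_conv_of_real del: dirderivs.simps)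
qed

lemma schwartz_radial:
  assumes "radial_profile a"
  shows "schwartz (\<lambda>y::'a::euclidean_space. a (y \<bullet> y))"
proof (rule schwartz_coinduct[where X="radial_sum :: ('a \<Rightarrow> complex) \<Rightarrow> bool"])
  show "radial_sum (\<lambda>y::'a. a (y \<bullet> y))" using radial_sum.gen[OF polyfun.const[of 1] assms] by simp
next
  fix f :: "'a \<Rightarrow> complex" and b :: 'a assume "radial_sum f" and b: "b \<in> Basis"
  then show "\<exists>g. radial_sum g \<and> has_partial f b g"
  proof induction
    case (gen p a)
    then obtain p' where p': "polyfun p'" "has_partial p b p'" using polyfun_partial by blast
    have "smooth a" using gen by (simp add: radial_profile_def)
    have "has_partial (\<lambda>y. p y * a (y \<bullet> y)) b (\<lambda>y. p' y * a (y \<bullet> y) + p y * (2 * of_real (y \<bullet> b) * dirderivs [1] a (y \<bullet> y)))"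
      by (intro has_partial_mult has_partial_radial p' \<open>smooth a\<close>)
    moreover have "radial_sum (\<lambda>y. p' y * a (y \<bullet> y) + (p y * (2 * of_real (y \<bullet> b))) * dirderivs [1] a (y \<bullet> y))"
      by (intro radial_sum.intros polyfun.intros p' gen radial_profile_derivative)
    ultimately show ?case by (intro exI[of _ "\<lambda>y. p' y * a (y \<bullet> y) + (p y * (2 * of_real (y \<bullet> b))) * dirderivs [1] a (y \<bullet> y)"])
        (simp add: mult.assoc del: dirderivs.simps)
  next
    case (add f g)
    then obtain f' g' where "radial_sum f'" "has_partial f b f'" "radial_sum g'" "has_partial g b g'"
      using b by auto
    then show ?case by (intro exI[of _ "\<lambda>x. f' x + g' x"] conjI radial_sum.add has_partial_add)
  qed
next
  fix f :: "'a \<Rightarrow> complex" and k assume "radial_sum f"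
  then show "\<exists>C. \<forall>y. (1 + norm y) ^ k * norm (f y) \<le> C"
  proof induction
    case (gen p a)
    obtain C l where C: "0 \<le> C" "\<And>y. norm (p y) \<le> C * (1 + norm y) ^ l" using polyfun_growth[OF gen(1)] by blast
    obtain D where D: "\<And>t. t \<ge> 0 \<Longrightarrow> norm (a t) \<le> D / (1 + t) ^ (k + l)"
      using gen(2) unfolding radial_profile_def by (metis dirderivs.simps(1) empty_set empty_subsetI)
    have "(1 + norm y) ^ k * norm (p y * a (y \<bullet> y)) \<le> 2 ^ (k + l) * C * D" for y
    proof -
      let ?r = "norm y"
      have D0: "0 \<le> D" using order_trans[OF norm_ge_zero D[of 0]] by simp
      have 1: "(1 + ?r) ^ (k + l) \<le> 2 ^ (k + l) * (1 + y \<bullet> y) ^ (k + l)"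
      proof -
        \<comment> \<open>Completing the square gives \<open>1 + ?r \<le> 2 * (1 + ?r * ?r)\<close>,
          which converts decay in \<open>y \<bullet> y\<close> into decay in
          \<open>norm y\<close>.\<close>
        have "0 \<le> (?r - 1 / 4)\<^sup>2" by simp
        also have "\<dots> = ?r * ?r - ?r / 2 + 1 / 16" by (simp add: power2_eq_square algebra_simps)
        finally have "1 + ?r \<le> 2 * (1 + ?r * ?r)" by argo
        then have "1 + ?r \<le> 2 * (1 + y \<bullet> y)" by (simp add: dot_square_norm power2_eq_square)
        then have "(1 + ?r) ^ (k + l) \<le> (2 * (1 + y \<bullet> y)) ^ (k + l)" by (intro power_mono) auto
        then show ?thesis by (simp only: power_mult_distrib)
      qed
      have "(1 + ?r) ^ k * norm (p y * a (y \<bullet> y)) \<le> (1 + ?r) ^ k * ((C * (1 + ?r) ^ l) * (D / (1 + y \<bullet> y) ^ (k + l)))"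
        unfolding norm_mult using C D[of "y \<bullet> y"] by (intro mult_left_mono mult_mono) auto
      also have "\<dots> = C * D * ((1 + ?r) ^ (k + l) / (1 + y \<bullet> y) ^ (k + l))" by (simp add: power_add)
      also have "\<dots> \<le> C * D * 2 ^ (k + l)"
        using 1 C D0 by (intro mult_left_mono) (auto simp: divide_le_eq add_pos_nonneg)
      finally show ?thesis by (simp add: mult_ac)
    qed
    then show ?case by blast
  next
    case (add f g)
    then obtain C D where *: "\<And>y. (1 + norm y) ^ k * norm (f y) \<le> C" "\<And>y. (1 + norm y) ^ k * norm (g y) \<le> D" by blast
    have "(1 + norm y) ^ k * norm (f y + g y) \<le> C + D" for y
    proof -
      have "(1 + norm y) ^ k * norm (f y + g y) \<le> (1 + norm y) ^ k * (norm (f y) + norm (g y))"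
        by (intro mult_left_mono norm_triangle_ineq) auto
      then show ?thesis using *[of y] by (simp add: distrib_left)
    qed
    then show ?case by blast
  qed
qed

section \<open>The Gaussian and the cutoff functions\<close>

definition gaussian :: "'a::euclidean_space \<Rightarrow> complex" where
  "gaussian y = of_real (exp (- (y \<bullet> y) / 2))"

lemma schwartz_gaussian: "schwartz (gaussian :: 'a::euclidean_space \<Rightarrow> complex)"
proof -
  define e where "e t = complex_of_real (exp (- t / 2))" for t :: real
  have de: "has_partial (\<lambda>t. c * e t) 1 (\<lambda>t. (- c / 2) * e t)" for c
  proof (rule has_partial_real)
    fix t :: real
    have "((\<lambda>t. exp (- t / 2)) has_real_derivative (- 1 / 2) * exp (- t / 2)) (at t)"
      by (auto intro!: derivative_eq_intros)
    then have "((\<lambda>t. e t) has_vector_derivative of_real ((- 1 / 2) * exp (- t / 2))) (at t)"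
      unfolding e_def by (metis has_real_derivative_iff_has_vector_derivative has_vector_derivative_of_real)
    then have "((\<lambda>t. c * e t) has_vector_derivative c * of_real ((- 1 / 2) * exp (- t / 2))) (at t)"
      by (rule has_vector_derivative_mult_right)
    then show "((\<lambda>t. c * e t) has_vector_derivative (- c / 2) * e t) (at t)" by (simp add: e_def)
  qed
  have De: "\<exists>c. dirderivs bs e = (\<lambda>t. c * e t)" if "set bs \<subseteq> Basis" for bs
    using that
  proof (induction bs)
    case Nil show ?case by (intro exI[of _ 1]) simp
  next
    case (Cons b bs)
    then obtain c where "dirderivs bs e = (\<lambda>t. c * e t)" by auto
    then show ?case using has_partialD[OF de[of c]] Cons.prems by (intro exI[of _ "- c / 2"]) simp
  qed
  have "radial_profile e"
    unfolding radial_profile_def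
  proof (intro conjI allI impI)
    show "smooth e"
    proof (rule smooth_coinduct[where X="\<lambda>h. h \<in> range (\<lambda>c t. c * e t)"])
      show "e \<in> range (\<lambda>c t. c * e t)" by (rule image_eqI[of _ _ 1]) auto
      show "\<exists>g. g \<in> range (\<lambda>c t. c * e t) \<and> has_partial h b g" if h: "h \<in> range (\<lambda>c t. c * e t)" "b \<in> Basis" for h b
      proof -
        obtain c where "h = (\<lambda>t. c * e t)" using h(1) by auto
        then have "has_partial h b (\<lambda>t. (- c / 2) * e t)" using h(2) de[of c] by simp
        then show ?thesis by blast
      qed
    qed
    fix bs :: "real list" and k :: nat assume "set bs \<subseteq> Basis"
    then obtain c where c: "dirderivs bs e = (\<lambda>t. c * e t)" using De by blast
    have "norm (e t) \<le> (2 * real (Suc k)) ^ Suc k / (1 + t) ^ k" if "t \<ge> 0" for t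
    proof -
      let ?n = "Suc k"
      \<comment> \<open>The exponential dominates its compound-interest approximation.
        \<open>Suc k\<close> in place of \<open>k\<close> avoids a division by 0.\<close>
      have "(1 + (t / 2) / real ?n) ^ ?n \<le> exp (t / 2)"
        using that by (intro exp_ge_one_plus_x_over_n_power_n) auto
      then have "(2 * real ?n) ^ ?n * (1 + (t / 2) / real ?n) ^ ?n \<le> (2 * real ?n) ^ ?n * exp (t / 2)"
        by (intro mult_left_mono) auto
      moreover have "(1 + t) ^ k \<le> (1 + t) ^ ?n" using that by (intro power_increasing) auto
      moreover have "(1 + t) ^ ?n \<le> (2 * real ?n * (1 + (t / 2) / real ?n)) ^ ?n"
        using that by (intro power_mono) (auto simp: field_simps)
      ultimately have "(1 + t) ^ k \<le> (2 * real ?n) ^ ?n * exp (t / 2)" unfolding power_mult_distrib by linarith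
      then have "(1 + t) ^ k * exp (- (t / 2)) \<le> (2 * real ?n) ^ ?n * exp (t / 2) * exp (- (t / 2))"
        by (intro mult_right_mono) auto
      also have "\<dots> = (2 * real ?n) ^ ?n" by (simp add: exp_minus)
      finally show ?thesis using that by (simp add: e_def le_divide_eq mult.commute)
    qed
    then have "norm (dirderivs bs e t) \<le> (norm c * (2 * real (Suc k)) ^ Suc k) / (1 + t) ^ k" if "t \<ge> 0" for t
      using mult_left_mono[of "norm (e t)" _ "norm c"] that by (fastforce simp: c norm_mult)
    then show "\<exists>C. \<forall>t\<ge>0. norm (dirderivs bs e t) \<le> C / (1 + t) ^ k" by blast
  qed
  from schwartz_radial[OF this] show ?thesis unfolding gaussian_def e_def by simp
qed

text \<open>The usual quotient of two flat functions without common zero. The profile is a function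
  of the squared radius, so 1 and 4 correspond to radii 1 and 2.\<close>

lemma ex_plateau_profile:
  obtains a where "radial_profile a" "\<And>t. t \<le> 1 \<Longrightarrow> a t = 1" "\<And>t. 4 \<le> t \<Longrightarrow> a t = 0"
proof -
  define E where "E = flat_exp 1"
  define A where "A t = E ((-1) *\<^sub>R (t - 4))" for t :: real
  define B where "B t = E (t - 1)" for t :: real
  have E0: "E t = 0" if "t \<le> 0" for t using that by (simp add: E_def flat_exp_def)
  have E: "E t = of_real (exp (- (1 / t)))" if "t > 0" for t using that by (simp add: E_def flat_exp_def)
  have Er: "\<exists>r\<ge>0. E t = of_real r" for t by (cases "t > 0") (auto simp: E E0 intro: exI[of _ 0])
  have sE: "smooth E" by (simp add: E_def smooth_flat_exp)
  have sA: "smooth A" unfolding A_def[abs_def] by (rule smooth_translate[OF smooth_dilate[OF sE]])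
  have sB: "smooth B" unfolding B_def[abs_def] by (rule smooth_translate[OF sE])
  have nz: "A t + B t \<noteq> 0" for t
  proof -
    have "A t \<noteq> 0 \<or> B t \<noteq> 0" unfolding A_def B_def by (cases "t < 4") (auto simp: E)
    moreover obtain r s where "r \<ge> 0" "A t = of_real r" "s \<ge> 0" "B t = of_real s" unfolding A_def B_def using Er by meson
    ultimately show ?thesis by (auto simp: of_real_add[symmetric] simp del: of_real_add)
  qed
  define a where "a t = A t / (A t + B t)" for t
  have sa: "smooth a" unfolding a_def[abs_def] by (intro smooth_divide smooth_add sA sB nz)
  have a1: "a t = 1" if "t \<le> 1" for t using that nz[of t] by (simp add: a_def B_def E0)
  have a0: "a t = 0" if "4 \<le> t" for t using that by (simp add: a_def A_def E0)
  have "radial_profile a"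
    unfolding radial_profile_def
  proof (intro conjI allI impI sa)
    fix bs :: "real list" and k :: nat assume bs: "set bs \<subseteq> Basis"
    \<comment> \<open>On \<open>{0..4}\<close> the derivatives are bounded by compactness, and
      beyond 4 they vanish; \<open>5 ^ k\<close> bounds the weight on that interval.\<close>
    have "has_partial (dirderivs bs a) 1 (dirderivs [1] (dirderivs bs a))"
      by (rule smooth_has_partial[OF smooth_dirderivs[OF sa bs]]) simp
    then have "continuous_on {0..4} (dirderivs bs a)"
      by (intro continuous_at_imp_continuous_on ballI has_vector_derivative_continuous[OF has_partial_realD])
    then have "bounded (dirderivs bs a ` {0..4})" by (intro compact_imp_bounded compact_continuous_image) auto
    then obtain M where "\<forall>x \<in> dirderivs bs a ` {0..4}. norm x \<le> M" unfolding bounded_iff by blast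
    then have M: "\<And>t. t \<in> {0..4} \<Longrightarrow> norm (dirderivs bs a t) \<le> M" by blast
    have M0: "0 \<le> M" using order_trans[OF norm_ge_zero M[of 0]] by simp
    have "norm (dirderivs bs a t) \<le> (M * 5 ^ k) / (1 + t) ^ k" if "0 \<le> t" for t
    proof (cases "t \<le> 4")
      case True
      have "(1 + t) ^ k \<le> 5 ^ k" using that True by (intro power_mono) auto
      then have "norm (dirderivs bs a t) * (1 + t) ^ k \<le> M * 5 ^ k"
        using M[of t] that True M0 by (intro mult_mono) auto
      then show ?thesis using that by (simp add: le_divide_eq)
    next
      case False
      have "jet_bound (length bs) a t 0"
        by (rule jet_bound_vanishing[of "{4<..}"]) (use False a0 in auto)
      then have "dirderivs bs a t = 0" using jet_boundD[of "length bs" a t 0 bs] bs by simp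
      then show ?thesis using M0 that by simp
    qed
    then show "\<exists>C. \<forall>t\<ge>0. norm (dirderivs bs a t) \<le> C / (1 + t) ^ k" by blast
  qed
  then show thesis using that a0 a1 by blast
qed

text \<open>The bound \<open>r \<le> 1\<close> turns the rescaling by \<open>1 / r\<close> into a
  dilation by a factor at least 1, as in \<open>schwartz_dilate\<close>.\<close>

lemma ex_cutoff:
  fixes x0 :: "'a::euclidean_space"
  assumes r: "0 < r" "r \<le> 1"
  obtains chi :: "'a \<Rightarrow> complex" where "schwartz chi" "\<And>y. y \<in> ball x0 r \<Longrightarrow> chi y = 1"
    "\<And>y. chi y \<noteq> 0 \<Longrightarrow> y \<in> cball x0 (2 * r)"
proof -
  obtain a where a: "radial_profile a" "\<And>t. t \<le> 1 \<Longrightarrow> a t = 1" "\<And>t. 4 \<le> t \<Longrightarrow> a t = 0"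
    using ex_plateau_profile by blast
  define chi0 where "chi0 y = a (y \<bullet> y)" for y :: 'a
  define chi where "chi = shift (\<lambda>y. chi0 ((1 / r) *\<^sub>R y)) x0 0"
  have "schwartz chi0" unfolding chi0_def[abs_def] by (rule schwartz_radial[OF a(1)])
  then have s: "schwartz chi" unfolding chi_def using r by (intro schwartz_shift schwartz_dilate) auto
  have chi: "chi y = a ((norm (y - x0) / r)\<^sup>2)" for y
    by (simp add: chi_def chi0_def shift_def power2_norm_eq_inner[symmetric] power_divide power2_eq_square)
  show thesis
  proof (rule that[OF s])
    show "chi y = 1" if "y \<in> ball x0 r" for y
    proof -
      have "norm (y - x0) / r \<le> 1" using that r by (simp add: dist_norm norm_minus_commute)
      then show ?thesis unfolding chi using r by (intro a(2)) (simp add: power_le_one)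
    qed
    show "y \<in> cball x0 (2 * r)" if "chi y \<noteq> 0" for y
    proof (rule ccontr)
      assume "y \<notin> cball x0 (2 * r)"
      then have "2 \<le> norm (y - x0) / r" using r by (simp add: dist_norm norm_minus_commute le_divide_eq)
      then have "2\<^sup>2 \<le> (norm (y - x0) / r)\<^sup>2" by (intro power_mono) auto
      then show False using that a(3) unfolding chi by simp
    qed
  qed
qed

section \<open>The Fourier transform on Schwartz functions\<close>

lemma
  fixes h :: "'a::euclidean_space \<Rightarrow> complex"
  assumes h: "h \<in> borel_measurable borel" and c: "c \<noteq> 0"
  shows integral_affine: "(\<integral>x. h x \<partial>lborel) = of_real (\<bar>c\<bar> ^ DIM('a)) * (\<integral>x. h (t + c *\<^sub>R x) \<partial>lborel)"
    and integrable_affine: "integrable lborel h \<longleftrightarrow> integrable lborel (\<lambda>x. h (t + c *\<^sub>R x))"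
proof -
  have m: "(\<lambda>x. t + c *\<^sub>R x) \<in> measurable lborel borel" by simp
  have hd: "h \<in> borel_measurable (distr lborel borel (\<lambda>x. t + c *\<^sub>R x))" using h by simp
  have "(\<integral>x. h x \<partial>lborel) = (\<integral>x. h x \<partial>(density (distr lborel borel (\<lambda>x. t + c *\<^sub>R x)) (\<lambda>_. \<bar>c\<bar> ^ DIM('a))))"
    by (subst lborel_affine[OF c, of t]) (simp add: ennreal_power)
  also have "\<dots> = (\<integral>x. \<bar>c\<bar> ^ DIM('a) *\<^sub>R h x \<partial>(distr lborel borel (\<lambda>x. t + c *\<^sub>R x)))"
    by (rule integral_density[OF hd]) auto
  also have "\<dots> = (\<integral>x. \<bar>c\<bar> ^ DIM('a) *\<^sub>R h (t + c *\<^sub>R x) \<partial>lborel)"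
    by (rule integral_distr[OF m]) (use h in measurable)
  finally show "(\<integral>x. h x \<partial>lborel) = of_real (\<bar>c\<bar> ^ DIM('a)) * (\<integral>x. h (t + c *\<^sub>R x) \<partial>lborel)"
    by (simp add: scaleR_conv_of_real)
  have "integrable lborel h \<longleftrightarrow> integrable (density (distr lborel borel (\<lambda>x. t + c *\<^sub>R x)) (\<lambda>_. \<bar>c\<bar> ^ DIM('a))) h"
    by (subst lborel_affine[OF c, of t]) (simp add: ennreal_power)
  also have "\<dots> \<longleftrightarrow> integrable (distr lborel borel (\<lambda>x. t + c *\<^sub>R x)) (\<lambda>x. \<bar>c\<bar> ^ DIM('a) *\<^sub>R h x)"
    by (rule integrable_density[OF hd]) auto
  also have "\<dots> \<longleftrightarrow> integrable lborel (\<lambda>x. \<bar>c\<bar> ^ DIM('a) *\<^sub>R h (t + c *\<^sub>R x))"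
    by (rule integrable_distr_eq[OF m]) (use h in measurable)
  finally show "integrable lborel h \<longleftrightarrow> integrable lborel (\<lambda>x. h (t + c *\<^sub>R x))"
    using c integrable_scaleR_right[of "inverse (\<bar>c\<bar> ^ DIM('a))" lborel "\<lambda>x. \<bar>c\<bar> ^ DIM('a) *\<^sub>R h (t + c *\<^sub>R x)"]
      integrable_scaleR_right[of "\<bar>c\<bar> ^ DIM('a)" lborel "\<lambda>x. h (t + c *\<^sub>R x)"]
    by auto
qed

text \<open>The integral of a translate does not depend on the translation, and differentiating it
  under the integral sign yields the integral of the partial derivative. This takes the place of
  integration by parts.\<close>

lemma integral_partial_eq_0:
  fixes f :: "'a::euclidean_space \<Rightarrow> complex"
  assumes f: "schwartz f" and b: "b \<in> Basis"
  shows "(\<integral>x. dirderivs [b] f x \<partial>lborel) = 0"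
proof -
  let ?K = "2 * DIM('a)" and ?g = "dirderivs [b] f"
  have g: "schwartz ?g" by (rule schwartz_partial[OF f b])
  obtain A where A: "0 \<le> A" "\<And>y. jet_bound 0 ?g y (A / (1 + norm y) ^ ?K)"
    using schwartz_jet[OF g] by metis
  have fm: "f \<in> borel_measurable borel" using schwartz_rapid[OF f] by (rule rapid_measurable)
  have 1: "((\<lambda>t. \<integral>x. f (x + t *\<^sub>R b) \<partial>lborel) has_vector_derivative (\<integral>x. ?g (x + 0 *\<^sub>R b) \<partial>lborel)) (at 0)"
  proof (rule has_vector_derivative_integral[where F'="\<lambda>t x. ?g (x + t *\<^sub>R b)" and g="\<lambda>x. 2 ^ ?K * A * (1 / (1 + norm x) ^ ?K)"])
    show "integrable lborel (\<lambda>x::'a. 2 ^ ?K * A * (1 / (1 + norm x) ^ ?K))"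
      by (intro integrable_mult_right integrable_weight)
    show "(\<lambda>x. ?g (x + 0 *\<^sub>R b)) \<in> borel_measurable lborel"
      using rapid_measurable[OF schwartz_rapid[OF g]] by simp
    fix t :: real assume t: "\<bar>t\<bar> \<le> 1"
    show "integrable lborel (\<lambda>x. f (x + t *\<^sub>R b))"
      using integrable_affine[OF fm, of 1 "t *\<^sub>R b"] schwartz_integrable[OF f] by (simp add: add.commute)
    fix x
    show "((\<lambda>t. f (x + t *\<^sub>R b)) has_vector_derivative ?g (x + t *\<^sub>R b)) (at t)"
      by (rule has_partial_line[OF smooth_has_partial[OF schwartz_smooth[OF f] b]])
    have "norm (?g (x + t *\<^sub>R b)) \<le> A / (1 + norm (x - (- t *\<^sub>R b))) ^ ?K"
      using A(2)[of "x + t *\<^sub>R b"] by (simp add: jet_bound_0 del: dirderivs.simps)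
    also have "\<dots> \<le> (1 + norm (- t *\<^sub>R b)) ^ ?K * A / (1 + norm x) ^ ?K" by (rule weight_shift[OF A(1)])
    also have "\<dots> \<le> 2 ^ ?K * A / (1 + norm x) ^ ?K"
      using t b A(1) by (intro divide_right_mono mult_right_mono power_mono) auto
    finally show "norm (?g (x + t *\<^sub>R b)) \<le> 2 ^ ?K * A * (1 / (1 + norm x) ^ ?K)" by simp
  qed
  have 2: "(\<integral>x. f (x + t *\<^sub>R b) \<partial>lborel) = (\<integral>x. f x \<partial>lborel)" for t
    using integral_affine[OF fm, of 1 "t *\<^sub>R b"] by (simp add: add.commute)
  have "((\<lambda>t::real. (\<integral>x. f x \<partial>lborel)) has_vector_derivative 0) (at 0)" by simp
  from vector_derivative_unique_at[OF 1[unfolded 2] this] show ?thesis by simp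
qed

text \<open>The constant of the inversion formula is kept as \<open>(ft gaussian 0)\<^sup>2\<close>;
  it equals \<open>(2 * pi) ^ n\<close> in dimension \<open>n\<close>, but what enters the argument
  is that it is nonzero.\<close>

definition ft :: "('a::euclidean_space \<Rightarrow> complex) \<Rightarrow> 'a \<Rightarrow> complex" where
  "ft f \<zeta> = (\<integral>y. f y * wave \<zeta> y \<partial>lborel)"

lemma wave_commute: "wave \<zeta> y = wave y \<zeta>"
  by (simp add: wave_def inner_commute)

lemma wave_measurable [measurable]: "wave \<zeta> \<in> borel_measurable borel"
  unfolding wave_def[abs_def] by measurable

lemma norm_ft_le: "integrable lborel f \<Longrightarrow> norm (ft f \<zeta>) \<le> (\<integral>y. norm (f y) \<partial>lborel)"
  unfolding ft_def by (rule norm_integral_le) (auto simp: norm_mult)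

lemma integrable_times_wave: "integrable lborel f \<Longrightarrow> integrable lborel (\<lambda>y. f y * wave \<zeta> y)"
  by (rule Bochner_Integration.integrable_bound[of _ f]) (auto simp: norm_mult)

lemma ft_partial:
  fixes f :: "'a::euclidean_space \<Rightarrow> complex"
  assumes f: "schwartz f" and b: "b \<in> Basis"
  shows "ft (dirderivs [b] f) \<zeta> = \<i> * of_real (b \<bullet> \<zeta>) * ft f \<zeta>"
proof -
  have p: "has_partial (\<lambda>y. f y * wave \<zeta> y) b (\<lambda>y. dirderivs [b] f y * wave \<zeta> y + f y * ((- \<i> * of_real (b \<bullet> \<zeta>)) * wave \<zeta> y))"
    by (intro has_partial_mult has_partial_wave smooth_has_partial schwartz_smooth f b)
  have "schwartz (shift f 0 \<zeta>)" by (rule schwartz_shift[OF f])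
  then have "schwartz (\<lambda>y. f y * wave \<zeta> y)" by (simp add: shift_def[abs_def])
  from integral_partial_eq_0[OF this b]
  have "(\<integral>y. dirderivs [b] f y * wave \<zeta> y + (- \<i> * of_real (b \<bullet> \<zeta>)) * (f y * wave \<zeta> y) \<partial>lborel) = 0"
    unfolding has_partialD[OF p] by (simp add: mult_ac)
  moreover have "integrable lborel (\<lambda>y. dirderivs [b] f y * wave \<zeta> y)"
    by (intro integrable_times_wave schwartz_integrable schwartz_partial f b)
  moreover have "integrable lborel (\<lambda>y. (- \<i> * of_real (b \<bullet> \<zeta>)) * (f y * wave \<zeta> y))"
    by (intro integrable_mult_right integrable_times_wave schwartz_integrable f)
  ultimately have "(\<integral>y. dirderivs [b] f y * wave \<zeta> y \<partial>lborel) + (- \<i> * of_real (b \<bullet> \<zeta>)) * (\<integral>y. f y * wave \<zeta> y \<partial>lborel) = 0"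
    by (simp only: Bochner_Integration.integral_add integral_mult_right_zero)
  then show ?thesis by (simp add: ft_def del: dirderivs.simps)
qed

text \<open>Each power of the weight is bought with one derivative: \<open>ft_partial\<close> turns
  multiplication by a coordinate into a derivative of \<open>f\<close>, and
  \<open>norm \<zeta>\<close> is at most the sum of the absolute coordinates.\<close>

lemma ft_decay:
  fixes f :: "'a::euclidean_space \<Rightarrow> complex"
  assumes "schwartz f" shows "\<exists>C. \<forall>\<zeta>. norm (ft f \<zeta>) \<le> C / (1 + norm \<zeta>) ^ k"
  using assms
proof (induction k arbitrary: f)
  case 0
  then show ?case using norm_ft_le[OF schwartz_integrable] by auto
next
  case (Suc k)
  obtain C where C: "\<And>\<zeta>. norm (ft f \<zeta>) \<le> C / (1 + norm \<zeta>) ^ k" using Suc by blast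
  have "\<forall>b\<in>Basis. \<exists>D. \<forall>\<zeta>. norm (ft (dirderivs [b] f) \<zeta>) \<le> D / (1 + norm \<zeta>) ^ k"
    using Suc.IH[OF schwartz_partial[OF Suc.prems]] by blast
  then obtain D where D: "\<And>b \<zeta>. b \<in> Basis \<Longrightarrow> norm (ft (dirderivs [b] f) \<zeta>) \<le> D b / (1 + norm \<zeta>) ^ k" by metis
  have "norm (ft f \<zeta>) \<le> (C + sum D Basis) / (1 + norm \<zeta>) ^ Suc k" for \<zeta>
  proof -
    have "norm \<zeta> * norm (ft f \<zeta>) \<le> (\<Sum>b\<in>Basis. \<bar>\<zeta> \<bullet> b\<bar>) * norm (ft f \<zeta>)"
      by (intro mult_right_mono norm_le_l1) auto
    also have "\<dots> = (\<Sum>b\<in>Basis. norm (ft (dirderivs [b] f) \<zeta>))"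
      unfolding sum_distrib_right
      by (intro sum.cong refl) (simp add: ft_partial[OF Suc.prems] norm_mult inner_commute del: dirderivs.simps)
    also have "\<dots> \<le> (\<Sum>b\<in>Basis. D b / (1 + norm \<zeta>) ^ k)" by (intro sum_mono D)
    finally have "(1 + norm \<zeta>) * norm (ft f \<zeta>) \<le> (C + sum D Basis) / (1 + norm \<zeta>) ^ k"
      using C[of \<zeta>] by (simp add: distrib_right sum_divide_distrib[symmetric] add_divide_distrib)
    then have "norm (ft f \<zeta>) \<le> (C + sum D Basis) / (1 + norm \<zeta>) ^ k / (1 + norm \<zeta>)"
      using pos_le_divide_eq[of "1 + norm \<zeta>" "norm (ft f \<zeta>)"] norm_ge_zero[of \<zeta>]
      by (metis add_pos_nonneg mult.commute zero_less_one)
    then show ?thesis by (simp only: divide_divide_eq_left power_Suc2)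
  qed
  then show ?case by blast
qed

lemma ft_continuous:
  fixes f :: "'a::euclidean_space \<Rightarrow> complex"
  assumes f: "schwartz f" shows "continuous_on UNIV (ft f)"
proof (rule continuous_if_lipschitz_poly[where q=0])
  have int: "integrable lborel (\<lambda>y. norm (f y) * (1 + norm y) ^ 1)"
    by (rule integrable_rapid_weight[OF schwartz_rapid[OF f]])
  fix \<zeta> \<zeta>' :: 'a
  have "ft f \<zeta> - ft f \<zeta>' = (\<integral>y. f y * wave \<zeta> y - f y * wave \<zeta>' y \<partial>lborel)"
    unfolding ft_def by (intro Bochner_Integration.integral_diff[symmetric] integrable_times_wave schwartz_integrable f)
  also have "norm \<dots> \<le> (\<integral>y. norm (\<zeta> - \<zeta>') * (norm (f y) * (1 + norm y) ^ 1) \<partial>lborel)"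
  proof (rule norm_integral_le)
    fix y
    have "wave \<zeta> y = wave \<zeta>' y * wave (\<zeta> - \<zeta>') y" using wave_add[of \<zeta>' "\<zeta> - \<zeta>'" y] by simp
    then have "f y * wave \<zeta> y - f y * wave \<zeta>' y = f y * wave \<zeta>' y * (wave (\<zeta> - \<zeta>') y - 1)" by (simp add: algebra_simps)
    then have "norm (f y * wave \<zeta> y - f y * wave \<zeta>' y) = norm (f y) * norm (wave (\<zeta> - \<zeta>') y - 1)" by (simp add: norm_mult)
    also have "\<dots> \<le> norm (f y) * (norm (\<zeta> - \<zeta>') * (1 + norm y))"
      by (intro mult_left_mono order_trans[OF norm_wave_diff]) auto
    finally show "norm (f y * wave \<zeta> y - f y * wave \<zeta>' y) \<le> norm (\<zeta> - \<zeta>') * (norm (f y) * (1 + norm y) ^ 1)" by (simp add: mult_ac)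
  qed (intro integrable_mult_right int)
  finally show "norm (ft f \<zeta> - ft f \<zeta>') \<le> (\<integral>y. norm (f y) * (1 + norm y) ^ 1 \<partial>lborel) * norm (\<zeta> - \<zeta>') * (1 + norm \<zeta> + norm \<zeta>') ^ 0"
    by (simp add: mult.commute)
qed

lemma rapid_ft: "schwartz f \<Longrightarrow> rapid (ft f)"
  unfolding rapid_def using ft_decay by (auto intro!: borel_measurable_continuous_onI ft_continuous)

lemma has_partial_ft:
  fixes f :: "'a::euclidean_space \<Rightarrow> complex"
  assumes f: "schwartz f" and b: "b \<in> Basis"
  shows "has_partial (ft f) b (ft (\<lambda>y. - \<i> * of_real (y \<bullet> b) * f y))"
  unfolding has_partial_def
proof
  fix \<zeta>
  have [measurable]: "f \<in> borel_measurable borel" using schwartz_rapid[OF f] by (rule rapid_measurable)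
  have "((\<lambda>t. \<integral>y. f y * wave (\<zeta> + t *\<^sub>R b) y \<partial>lborel) has_vector_derivative
    (\<integral>y. f y * ((- \<i> * of_real (b \<bullet> y)) * wave y (\<zeta> + 0 *\<^sub>R b)) \<partial>lborel)) (at 0)"
  proof (rule has_vector_derivative_integral[where F'="\<lambda>t y. f y * ((- \<i> * of_real (b \<bullet> y)) * wave y (\<zeta> + t *\<^sub>R b))"
        and g="\<lambda>y. norm (f y) * (1 + norm y) ^ 1"])
    show "integrable lborel (\<lambda>y. norm (f y) * (1 + norm y) ^ 1)"
      by (rule integrable_rapid_weight[OF schwartz_rapid[OF f]])
    show "(\<lambda>y. f y * ((- \<i> * of_real (b \<bullet> y)) * wave y (\<zeta> + 0 *\<^sub>R b))) \<in> borel_measurable lborel"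
      unfolding wave_commute[of _ "\<zeta> + 0 *\<^sub>R b"] by measurable
    fix t :: real
    show "integrable lborel (\<lambda>y. f y * wave (\<zeta> + t *\<^sub>R b) y)"
      by (intro integrable_times_wave schwartz_integrable f)
    fix y
    show "((\<lambda>t. f y * wave (\<zeta> + t *\<^sub>R b) y) has_vector_derivative f y * ((- \<i> * of_real (b \<bullet> y)) * wave y (\<zeta> + t *\<^sub>R b))) (at t)"
      unfolding wave_commute[of _ y]
      by (rule has_partial_line[OF has_partial_cmult[OF has_partial_wave]])
    have "norm (f y) * \<bar>b \<bullet> y\<bar> \<le> norm (f y) * (1 + norm y)"
      using Basis_le_norm[OF b, of y] by (intro mult_left_mono) (auto simp: inner_commute)
    then show "norm (f y * ((- \<i> * of_real (b \<bullet> y)) * wave y (\<zeta> + t *\<^sub>R b))) \<le> norm (f y) * (1 + norm y) ^ 1"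
      by (simp add: norm_mult)
  qed
  then show "((\<lambda>t. ft f (\<zeta> + t *\<^sub>R b)) has_vector_derivative ft (\<lambda>y. - \<i> * of_real (y \<bullet> b) * f y) \<zeta>) (at 0)"
    unfolding ft_def by (simp add: wave_commute[of _ \<zeta>] inner_commute mult_ac)
qed

lemma has_partial_exp_square:
  "has_partial (\<lambda>y. complex_of_real (exp (c * (y \<bullet> y) / 2))) b (\<lambda>y. of_real (c * (y \<bullet> b)) * of_real (exp (c * (y \<bullet> y) / 2)))"
  unfolding has_partial_def
proof
  fix y
  have "((\<lambda>t. exp (c * (y \<bullet> y + 2 * t * (y \<bullet> b) + t\<^sup>2 * (b \<bullet> b)) / 2)) has_real_derivative
      c * (y \<bullet> b) * exp (c * (y \<bullet> y) / 2)) (at 0)"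
    by (auto intro!: derivative_eq_intros)
  from has_vector_derivative_of_real[OF this]
  show "((\<lambda>t. complex_of_real (exp (c * ((y + t *\<^sub>R b) \<bullet> (y + t *\<^sub>R b)) / 2))) has_vector_derivative
     of_real (c * (y \<bullet> b)) * of_real (exp (c * (y \<bullet> y) / 2))) (at 0)"
    by (simp add: inner_add inner_commute algebra_simps power2_eq_square)
qed

text \<open>The Gaussian and its transform satisfy the same first-order equations. Multiplying the
  transform by the reciprocal Gaussian \<open>e\<close> therefore gives a function with vanishing
  partials, which is constant along axis-parallel paths.\<close>

lemma ft_gaussian: "ft gaussian \<zeta> = ft gaussian (0::'a) * gaussian (\<zeta>::'a::euclidean_space)"
proof -
  let ?g = "gaussian :: 'a \<Rightarrow> complex"
  define e where "e y = complex_of_real (exp (1 * (y \<bullet> y) / 2))" for y :: 'a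
  have dg: "dirderivs [b] ?g = (\<lambda>y. - of_real (y \<bullet> b) * ?g y)" for b
    using has_partialD[OF has_partial_exp_square[of "-1" b]] by (simp add: gaussian_def[abs_def])
  have pft: "has_partial (ft ?g) b (\<lambda>\<zeta>. - of_real (\<zeta> \<bullet> b) * ft ?g \<zeta>)" if b: "b \<in> Basis" for b
  proof -
    have "ft (\<lambda>y. - \<i> * of_real (y \<bullet> b) * ?g y) \<zeta> = - of_real (\<zeta> \<bullet> b) * ft ?g \<zeta>" for \<zeta>
    proof -
      have "ft (\<lambda>y. - \<i> * of_real (y \<bullet> b) * ?g y) \<zeta> = \<i> * ft (dirderivs [b] ?g) \<zeta>"
        unfolding dg by (simp add: ft_def mult.assoc integral_mult_right_zero[symmetric] del: integral_mult_right_zero)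
      also have "\<dots> = - of_real (\<zeta> \<bullet> b) * ft ?g \<zeta>"
        unfolding ft_partial[OF schwartz_gaussian b] by (simp add: inner_commute mult.assoc[symmetric])
      finally show ?thesis .
    qed
    then have "ft (\<lambda>y. - \<i> * of_real (y \<bullet> b) * ?g y) = (\<lambda>\<zeta>. - of_real (\<zeta> \<bullet> b) * ft ?g \<zeta>)" by (rule ext)
    with has_partial_ft[OF schwartz_gaussian b] show ?thesis by (simp only:)
  qed
  have ph: "has_partial (\<lambda>\<zeta>. ft ?g \<zeta> * e \<zeta>) b (\<lambda>\<zeta>. 0)" if b: "b \<in> Basis" for b
    using has_partial_mult[OF pft[OF b] has_partial_exp_square[of 1 b]]
    by (simp add: e_def[abs_def])
  have "norm (ft ?g (0 + \<zeta>) * e (0 + \<zeta>) - ft ?g 0 * e 0) \<le> real DIM('a) * 0 * norm \<zeta>"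
    by (rule coordinatewise_bound[where r="norm \<zeta>" and G="\<lambda>\<zeta>. ft ?g \<zeta> * e \<zeta>"])
      (auto intro!: has_partial_bound[OF ph, of _ _ 0, simplified])
  then have 1: "ft ?g \<zeta> * e \<zeta> = ft ?g 0" by (simp add: e_def)
  have 2: "e \<zeta> * gaussian \<zeta> = 1"
    unfolding e_def gaussian_def by (subst of_real_mult[symmetric], subst exp_add[symmetric]) simp
  have "ft ?g 0 * gaussian \<zeta> = ft ?g \<zeta> * (e \<zeta> * gaussian \<zeta>)" by (simp only: 1[symmetric] mult.assoc)
  then show ?thesis unfolding 2 mult_1_right by (rule sym)
qed

lemma ft_gaussian_0_nonzero: "ft gaussian (0::'a::euclidean_space) \<noteq> 0"
proof
  let ?e = "\<lambda>y::'a. exp (- (y \<bullet> y) / 2)"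
  assume "ft gaussian (0::'a) = 0"
  then have "complex_of_real (\<integral>y. ?e y \<partial>lborel) = 0"
    by (simp add: ft_def gaussian_def[abs_def])
  moreover have "integrable lborel ?e"
    using schwartz_integrable[OF schwartz_gaussian, where 'a='a]
    unfolding gaussian_def[abs_def] complex_of_real_integrable_eq .
  ultimately have "AE y in lborel. ?e y = 0"
    by (subst integral_nonneg_eq_0_iff_AE[symmetric]) auto
  then have "AE y in (lborel :: 'a measure). False" by simp
  then show False by (simp add: AE_iff_null emeasure_lborel_UNIV null_sets_def)
qed

text \<open>Fubini for \<open>f y * wave \<eta> y * g \<eta>\<close>, whose kernel is symmetric in
  \<open>y\<close> and \<open>\<eta>\<close>.\<close>

lemma ft_multiplication:
  fixes f g :: "'a::euclidean_space \<Rightarrow> complex"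
  assumes f: "integrable lborel f" and g: "integrable lborel g"
  shows "(\<integral>\<eta>. ft f \<eta> * g \<eta> \<partial>lborel) = (\<integral>y. f y * ft g y \<partial>lborel)"
proof -
  note [measurable] = borel_measurable_integrable[OF f] borel_measurable_integrable[OF g]
  have int: "integrable (lborel \<Otimes>\<^sub>M lborel) (\<lambda>(y, \<eta>). f y * wave \<eta> y * g \<eta>)"
  proof (rule lborel_pair.Fubini_integrable)
    show "(\<lambda>(y, \<eta>). f y * wave \<eta> y * g \<eta>) \<in> borel_measurable (lborel \<Otimes>\<^sub>M lborel)"
      unfolding wave_def by measurable
    show "integrable lborel (\<lambda>y. \<integral>\<eta>. norm (case (y, \<eta>) of (y, \<eta>) \<Rightarrow> f y * wave \<eta> y * g \<eta>) \<partial>lborel)"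
      using f by (simp add: norm_mult)
    have "integrable lborel (\<lambda>\<eta>. f y * (g \<eta> * wave y \<eta>))" for y
      by (intro integrable_mult_right integrable_times_wave g)
    then show "AE y in lborel. integrable lborel (\<lambda>\<eta>. case (y, \<eta>) of (y, \<eta>) \<Rightarrow> f y * wave \<eta> y * g \<eta>)"
      by (simp add: wave_commute[of _ "_"] mult_ac)
  qed
  have "(\<integral>\<eta>. ft f \<eta> * g \<eta> \<partial>lborel) = (\<integral>\<eta>. (\<integral>y. f y * wave \<eta> y * g \<eta> \<partial>lborel) \<partial>lborel)"
    by (simp add: ft_def)
  also have "\<dots> = (\<integral>y. (\<integral>\<eta>. f y * wave \<eta> y * g \<eta> \<partial>lborel) \<partial>lborel)"
    by (rule lborel_pair.Fubini_integral[OF int])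
  also have "\<dots> = (\<integral>y. f y * ft g y \<partial>lborel)"
    by (intro Bochner_Integration.integral_cong refl)
      (simp add: ft_def wave_commute mult_ac integral_mult_right_zero[symmetric] del: integral_mult_right_zero)
  finally show ?thesis .
qed

text \<open>Inserting the definition of \<open>ft f\<close> gives no absolutely convergent double
  integral, so a Gaussian factor of width \<open>1 / \<epsilon> n\<close> is put in first. The
  multiplication formula moves the transform onto the Gaussian, which is its own transform up to a
  constant, and then \<open>n\<close> tends to infinity on both sides.\<close>

theorem ft_inversion:
  fixes f :: "'a::euclidean_space \<Rightarrow> complex"
  assumes f: "schwartz f"
  shows "(\<integral>\<eta>. ft f \<eta> * wave (- x) \<eta> \<partial>lborel) = (ft gaussian (0::'a))\<^sup>2 * f x"
proof -
  let ?\<gamma> = "ft gaussian (0::'a)"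
  let ?g = "gaussian :: 'a \<Rightarrow> complex"
  define \<epsilon> where "\<epsilon> n = 1 / real (Suc n)" for n
  have \<epsilon>: "0 < \<epsilon> n" for n by (simp add: \<epsilon>_def)
  have \<epsilon>0: "\<epsilon> \<longlonglongrightarrow> 0" using LIMSEQ_inverse_real_of_nat by (simp add: \<epsilon>_def[abs_def] inverse_eq_divide)
  have fm[measurable]: "f \<in> borel_measurable borel" using schwartz_rapid[OF f] by (rule rapid_measurable)
  have gm[measurable]: "?g \<in> borel_measurable borel" using schwartz_rapid[OF schwartz_gaussian] by (rule rapid_measurable)
  have ftm[measurable]: "ft f \<in> borel_measurable borel" using rapid_ft[OF f] by (rule rapid_measurable)
  have ftint: "integrable lborel (ft f)"
    by (rule integrable_rapid[OF rapid_ft[OF f], of _ 1 0]) auto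
  have gint: "integrable lborel ?g" by (rule schwartz_integrable[OF schwartz_gaussian])
  have gc: "continuous_on UNIV ?g" by (rule schwartz_continuous[OF schwartz_gaussian])
  have fc: "continuous_on UNIV f" by (rule schwartz_continuous[OF f])
  have n1: "norm (?g y) \<le> 1" for y by (simp add: gaussian_def)
  \<comment> \<open>The substitution \<open>y = x + \<epsilon> n *\<^sub>R z\<close> rescales the
    narrow Gaussian to the standard one; its Jacobian cancels the scaling factor of the transform,
    which is \<open>sc\<close>.\<close>
  have key: "(\<integral>\<eta>. ft f \<eta> * (?g (\<epsilon> n *\<^sub>R \<eta>) * wave (- x) \<eta>) \<partial>lborel) = ?\<gamma> * (\<integral>z. f (x + \<epsilon> n *\<^sub>R z) * ?g z \<partial>lborel)" for n
  proof -
    have gi: "integrable lborel (\<lambda>\<eta>. ?g (\<epsilon> n *\<^sub>R \<eta>))"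
      using integrable_affine[OF gm, of "\<epsilon> n" 0] gint \<epsilon>[of n] by simp
    have "(\<integral>\<eta>. ft f \<eta> * (?g (\<epsilon> n *\<^sub>R \<eta>) * wave (- x) \<eta>) \<partial>lborel) = (\<integral>y. f y * ft (\<lambda>\<eta>. ?g (\<epsilon> n *\<^sub>R \<eta>) * wave (- x) \<eta>) y \<partial>lborel)"
      by (intro ft_multiplication schwartz_integrable f integrable_times_wave gi)
    also have "\<dots> = of_real (\<bar>\<epsilon> n\<bar> ^ DIM('a)) * (\<integral>z. f (x + \<epsilon> n *\<^sub>R z) * ft (\<lambda>\<eta>. ?g (\<epsilon> n *\<^sub>R \<eta>) * wave (- x) \<eta>) (x + \<epsilon> n *\<^sub>R z) \<partial>lborel)"
    proof (rule integral_affine)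
      have "ft (\<lambda>\<eta>. ?g (\<epsilon> n *\<^sub>R \<eta>) * wave (- x) \<eta>) y = ft (\<lambda>\<eta>. ?g (\<epsilon> n *\<^sub>R \<eta>)) (y - x)" for y
        using wave_add[of "- x" y] by (simp add: ft_def mult.assoc)
      moreover have "ft (\<lambda>\<eta>. ?g (\<epsilon> n *\<^sub>R \<eta>)) \<in> borel_measurable borel"
        unfolding ft_def[abs_def] wave_def by measurable
      ultimately show "(\<lambda>y. f y * ft (\<lambda>\<eta>. ?g (\<epsilon> n *\<^sub>R \<eta>) * wave (- x) \<eta>) y) \<in> borel_measurable borel"
        by simp
    qed (use \<epsilon>[of n] in simp)
    finally have 1: "(\<integral>\<eta>. ft f \<eta> * (?g (\<epsilon> n *\<^sub>R \<eta>) * wave (- x) \<eta>) \<partial>lborel) =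
       of_real (\<bar>\<epsilon> n\<bar> ^ DIM('a)) * (\<integral>z. f (x + \<epsilon> n *\<^sub>R z) * ft (\<lambda>\<eta>. ?g (\<epsilon> n *\<^sub>R \<eta>) * wave (- x) \<eta>) (x + \<epsilon> n *\<^sub>R z) \<partial>lborel)" .
    have sc: "of_real (\<bar>\<epsilon> n\<bar> ^ DIM('a)) * ft (\<lambda>\<eta>. ?g (\<epsilon> n *\<^sub>R \<eta>) * wave (- x) \<eta>) (x + \<epsilon> n *\<^sub>R z) = ?\<gamma> * ?g z" for z
    proof -
      have w: "wave (- x) \<eta> * wave (x + \<epsilon> n *\<^sub>R z) \<eta> = wave z (0 + \<epsilon> n *\<^sub>R \<eta>)" for \<eta>
        using wave_add[of "- x" "x + \<epsilon> n *\<^sub>R z" \<eta>] by (simp add: wave_def)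
      have "?\<gamma> * ?g z = (\<integral>\<eta>. ?g \<eta> * wave z \<eta> \<partial>lborel)" unfolding ft_gaussian[of z, symmetric] by (simp add: ft_def)
      also have "\<dots> = of_real (\<bar>\<epsilon> n\<bar> ^ DIM('a)) * (\<integral>\<eta>. ?g (0 + \<epsilon> n *\<^sub>R \<eta>) * wave z (0 + \<epsilon> n *\<^sub>R \<eta>) \<partial>lborel)"
        by (rule integral_affine) (use \<epsilon>[of n] in auto)
      also have "(\<integral>\<eta>. ?g (0 + \<epsilon> n *\<^sub>R \<eta>) * wave z (0 + \<epsilon> n *\<^sub>R \<eta>) \<partial>lborel) = ft (\<lambda>\<eta>. ?g (\<epsilon> n *\<^sub>R \<eta>) * wave (- x) \<eta>) (x + \<epsilon> n *\<^sub>R z)"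
        unfolding ft_def w[symmetric] by (simp add: mult.assoc)
      finally show ?thesis ..
    qed
    have "of_real (\<bar>\<epsilon> n\<bar> ^ DIM('a)) * (f (x + \<epsilon> n *\<^sub>R z) * ft (\<lambda>\<eta>. ?g (\<epsilon> n *\<^sub>R \<eta>) * wave (- x) \<eta>) (x + \<epsilon> n *\<^sub>R z))
       = f (x + \<epsilon> n *\<^sub>R z) * (?\<gamma> * ?g z)" for z
      by (subst mult.left_commute) (simp only: sc)
    then have "of_real (\<bar>\<epsilon> n\<bar> ^ DIM('a)) * (\<integral>z. f (x + \<epsilon> n *\<^sub>R z) * ft (\<lambda>\<eta>. ?g (\<epsilon> n *\<^sub>R \<eta>) * wave (- x) \<eta>) (x + \<epsilon> n *\<^sub>R z) \<partial>lborel)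
       = (\<integral>z. f (x + \<epsilon> n *\<^sub>R z) * (?\<gamma> * ?g z) \<partial>lborel)"
      by (simp only: integral_mult_right_zero[symmetric])
    also have "\<dots> = ?\<gamma> * (\<integral>z. f (x + \<epsilon> n *\<^sub>R z) * ?g z \<partial>lborel)"
      by (simp only: integral_mult_right_zero[symmetric] mult.left_commute)
    finally show ?thesis using 1 by simp
  qed
  have "(\<lambda>n. \<integral>\<eta>. ft f \<eta> * (?g (\<epsilon> n *\<^sub>R \<eta>) * wave (- x) \<eta>) \<partial>lborel) \<longlonglongrightarrow> (\<integral>\<eta>. ft f \<eta> * (?g (0 *\<^sub>R \<eta>) * wave (- x) \<eta>) \<partial>lborel)"
  proof (rule integral_dominated_convergence[where w="\<lambda>\<eta>. norm (ft f \<eta>)"])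
    show "AE \<eta> in lborel. (\<lambda>n. ft f \<eta> * (?g (\<epsilon> n *\<^sub>R \<eta>) * wave (- x) \<eta>)) \<longlonglongrightarrow> ft f \<eta> * (?g (0 *\<^sub>R \<eta>) * wave (- x) \<eta>)"
      by (intro AE_I2 tendsto_intros continuous_on_tendsto_compose[OF gc] \<epsilon>0) auto
    show "AE \<eta> in lborel. norm (ft f \<eta> * (?g (\<epsilon> n *\<^sub>R \<eta>) * wave (- x) \<eta>)) \<le> norm (ft f \<eta>)" for n
      using n1 by (auto simp: norm_mult intro!: mult_left_le)
  qed (use ftint in auto)
  moreover have "?g (0 *\<^sub>R \<eta>) = 1" for \<eta> by (simp add: gaussian_def)
  ultimately have lim1: "(\<lambda>n. ?\<gamma> * (\<integral>z. f (x + \<epsilon> n *\<^sub>R z) * ?g z \<partial>lborel)) \<longlonglongrightarrow> (\<integral>\<eta>. ft f \<eta> * wave (- x) \<eta> \<partial>lborel)"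
    unfolding key by simp
  obtain B where B: "\<And>y. norm (f y) \<le> B" using schwartz_bounded_jets[OF f, of 0] by (auto simp: jet_bound_0)
  have "(\<lambda>n. \<integral>z. f (x + \<epsilon> n *\<^sub>R z) * ?g z \<partial>lborel) \<longlonglongrightarrow> (\<integral>z. f (x + 0 *\<^sub>R z) * ?g z \<partial>lborel)"
  proof (rule integral_dominated_convergence[where w="\<lambda>z. B * norm (?g z)"])
    show "AE z in lborel. (\<lambda>n. f (x + \<epsilon> n *\<^sub>R z) * ?g z) \<longlonglongrightarrow> f (x + 0 *\<^sub>R z) * ?g z"
      by (intro AE_I2 tendsto_intros continuous_on_tendsto_compose[OF fc] \<epsilon>0) auto
    show "AE z in lborel. norm (f (x + \<epsilon> n *\<^sub>R z) * ?g z) \<le> B * norm (?g z)" for n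
      using B by (auto simp: norm_mult intro!: mult_right_mono)
  qed (use gint in auto)
  moreover have "(\<integral>z. f (x + 0 *\<^sub>R z) * ?g z \<partial>lborel) = f x * ?\<gamma>" by (simp add: ft_def)
  ultimately have "(\<lambda>n. ?\<gamma> * (\<integral>z. f (x + \<epsilon> n *\<^sub>R z) * ?g z \<partial>lborel)) \<longlonglongrightarrow> ?\<gamma> * (f x * ?\<gamma>)"
    by (intro tendsto_mult tendsto_const) (simp only:)
  from LIMSEQ_unique[OF lim1 this] show ?thesis by (simp add: power2_eq_square mult_ac)
qed

corollary ex_ft_nonzero:
  fixes f :: "'a::euclidean_space \<Rightarrow> complex"
  assumes "schwartz f" "f \<noteq> (\<lambda>_. 0)" obtains \<eta> where "ft f \<eta> \<noteq> 0"
proof (rule ccontr)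
  assume "\<not> thesis"
  then have "ft f \<eta> = 0" for \<eta> using that by blast
  then have "f x = 0" for x
    using ft_inversion[OF assms(1), of x] ft_gaussian_0_nonzero[where 'a='a] by simp
  then show False using assms(2) by auto
qed

section \<open>Wave packets and cutoffs as values of the distribution on shifts\<close>

lemma fourier_cutoff_shift: "fourier_cutoff u chi \<xi> = u (shift chi 0 \<xi>)"
  by (simp add: fourier_cutoff_def shift_def[abs_def] wave_def)

lemma wave_packet_shift: "wave_packet \<phi> u x \<xi> = u (shift (\<lambda>y. cnj (\<phi> y)) x \<xi>)"
  by (simp add: wave_packet_def shift_def[abs_def] wave_def)

lemma shift_diff: "shift f (x + h) \<zeta> y - shift f x \<zeta> y = (f (y - x - h) - f (y - x)) * wave \<zeta> y"
  by (simp add: shift_def algebra_simps)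

text \<open>Lets an integral over \<open>{0..1}\<close> count as a weighted integral over the line,
  so that \<open>u_tame_integral\<close> applies to it.\<close>

lemma rapid_indicator: "rapid (\<lambda>t::real. indicator {0..1} t :: complex)"
  unfolding rapid_def
proof (intro conjI allI)
  fix k :: nat
  have "norm (indicator {0..1} t :: complex) \<le> 2 ^ k / (1 + norm t) ^ k" for t :: real
    by (auto simp: indicator_def intro!: power_mono)
  then show "\<exists>C. \<forall>t::real. norm (indicator {0..1} t :: complex) \<le> C / (1 + norm t) ^ k" by blast
qed measurable

lemma rapid_mult_bounded:
  assumes w: "rapid w" and g: "g \<in> borel_measurable borel" "\<And>s. norm (g s) \<le> B"
  shows "rapid (\<lambda>s. w s * g s)"
  unfolding rapid_def
proof (intro conjI allI)
  show "(\<lambda>s. w s * g s) \<in> borel_measurable borel"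
    using rapid_measurable[OF w] g(1) by measurable
  fix k
  obtain C where C: "\<And>s. norm (w s) \<le> C / (1 + norm s) ^ k" using w by (auto simp: rapid_def)
  have "norm (w s * g s) \<le> (C * B) / (1 + norm s) ^ k" for s
  proof -
    have "norm (w s) * norm (g s) \<le> C / (1 + norm s) ^ k * B"
      using g(2)[of s] C[of s] by (intro mult_mono) (auto intro: order_trans[OF norm_ge_zero])
    then show ?thesis by (simp add: norm_mult)
  qed
  then show "\<exists>C. \<forall>s. norm (w s * g s) \<le> C / (1 + norm s) ^ k" by blast
qed

context tempered_distribution
begin

text \<open>Temperedness alone: growth is polynomial in dilation, position and frequency, with
  exponents fixed by the seminorm of \<open>u\<close>. This crude bound covers the ranges of
  parameters where no decay is available.\<close>

lemma u_shift_dilate_bound: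
  fixes f :: "'a \<Rightarrow> complex"
  assumes f: "schwartz f"
  obtains C where "0 \<le> C" "\<And>R x \<zeta>. 1 \<le> R \<Longrightarrow>
    norm (u (shift (\<lambda>y. f (R *\<^sub>R y)) x \<zeta>)) \<le> C * R ^ m0 * (1 + norm x) ^ k0 * (1 + norm \<zeta>) ^ m0"
proof -
  obtain A where A: "0 \<le> A" "\<And>y. jet_bound m0 f y (A / (1 + norm y) ^ k0)" using schwartz_jet[OF f] by metis
  have "norm (u (shift (\<lambda>y. f (R *\<^sub>R y)) x \<zeta>)) \<le> (C0 * 2 ^ m0 * A) * R ^ m0 * (1 + norm x) ^ k0 * (1 + norm \<zeta>) ^ m0"
    if R: "1 \<le> R" for R x \<zeta>
  proof -
    note j = jet_bound_dilate_weight[OF schwartz_smooth[OF f] A(2) R]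
    have sd: "schwartz (\<lambda>y. f (R *\<^sub>R y))" by (rule schwartz_dilate[OF f R])
    have "norm (u (shift (\<lambda>y. f (R *\<^sub>R y)) x \<zeta>)) \<le> C0 * (2 ^ m0 * (1 + norm \<zeta>) ^ m0 * (1 + norm x) ^ k0 * (R ^ m0 * A))"
      by (rule u_bound[OF schwartz_shift[OF sd] jet_bound_shift[OF schwartz_smooth[OF sd] j]]) (use A R in auto)
    then show ?thesis by (simp add: mult_ac)
  qed
  then show thesis using that[of "C0 * 2 ^ m0 * A"] C0 A by simp
qed

lemma u_shift_bound:
  fixes f :: "'a \<Rightarrow> complex"
  assumes f: "schwartz f"
  obtains C where "0 \<le> C" "\<And>x \<zeta>. norm (u (shift f x \<zeta>)) \<le> C * (1 + norm x) ^ k0 * (1 + norm \<zeta>) ^ m0"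
proof -
  obtain C where "0 \<le> C" and C: "\<And>R x \<zeta>. 1 \<le> R \<Longrightarrow>
    norm (u (shift (\<lambda>y. f (R *\<^sub>R y)) x \<zeta>)) \<le> C * R ^ m0 * (1 + norm x) ^ k0 * (1 + norm \<zeta>) ^ m0"
    using u_shift_dilate_bound[OF f] by metis
  with C[of 1] show thesis by (intro that[of C]) auto
qed

text \<open>The wave factor does not move with \<open>x\<close>, so the derivative of a shift in its
  position is minus the shift of \<open>dirderivs [b] f\<close>. The fundamental theorem of
  calculus, with \<open>u\<close> taken under the integral, bounds differences of values of
  \<open>u\<close> on shifts of \<open>f\<close> by values on shifts of its derivative.\<close>

lemma u_shift_mean_value:
  fixes f :: "'a \<Rightarrow> complex"
  assumes f: "schwartz f" and b: "b \<in> Basis"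
    and B: "\<And>\<tau>. \<tau> \<in> closed_segment 0 h \<Longrightarrow> norm (u (shift (dirderivs [b] f) (x + \<tau> *\<^sub>R b) \<zeta>)) \<le> B"
  shows "norm (u (shift f (x + h *\<^sub>R b) \<zeta>) - u (shift f x \<zeta>)) \<le> B * \<bar>h\<bar>"
proof -
  let ?g = "dirderivs [b] f"
  let ?F = "\<lambda>t::real. shift ?g (x + (t * h) *\<^sub>R b) \<zeta>"
  let ?w = "\<lambda>t::real. indicator {0..1} t :: complex"
  have g: "schwartz ?g" by (rule schwartz_partial[OF f b])
  have tame: "tame ?F"
  proof (rule tame_shift[OF g, of _ "\<bar>h\<bar>" "\<lambda>_. \<zeta>"])
    fix s s' :: real
    have "(x + (s * h) *\<^sub>R b) - (x + (s' * h) *\<^sub>R b) = ((s - s') * h) *\<^sub>R b" by (simp add: algebra_simps)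
    then show "norm ((x + (s * h) *\<^sub>R b) - (x + (s' * h) *\<^sub>R b)) \<le> \<bar>h\<bar> * norm (s - s')"
      using b by (simp add: abs_mult mult.commute)
  qed auto
  have FTC: "shift f (x + h *\<^sub>R b) \<zeta> y - shift f x \<zeta> y = (- of_real h) * (\<integral>t. ?w t * ?F t y \<partial>lborel)" for y
  proof -
    \<comment> \<open>As the position moves by \<open>t * h\<close>, the argument
      \<open>y - x\<close> moves by \<open>- t * h\<close>; hence the minus signs.\<close>
    let ?p = "\<lambda>t. f (y - x + (t * - h) *\<^sub>R b) * wave \<zeta> y"
    have "(\<integral>t. indicator {0..1} t *\<^sub>R ((- of_real h) * ?F t y) \<partial>lborel) = ?p 1 - ?p 0"
    proof (rule integral_FTC_atLeastAtMost)
      fix t :: real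
      have 1: "((\<lambda>t. t * - h) has_vector_derivative - h) (at t)"
        by (auto intro!: derivative_eq_intros simp: has_real_derivative_iff_has_vector_derivative[symmetric])
      have 2: "((\<lambda>t. f (y - x + t *\<^sub>R b)) has_vector_derivative ?g (y - x + (t * - h) *\<^sub>R b)) (at (t * - h))"
        by (rule has_partial_line[OF smooth_has_partial[OF schwartz_smooth[OF f] b]])
      have "(?p has_vector_derivative (- h *\<^sub>R ?g (y - x + (t * - h) *\<^sub>R b)) * wave \<zeta> y) (at t)"
        using has_vector_derivative_mult_left[OF vector_diff_chain_at[OF 1 2]] by (simp add: o_def)
      moreover have "(- h *\<^sub>R ?g (y - x + (t * - h) *\<^sub>R b)) * wave \<zeta> y = (- of_real h) * ?F t y"
        by (simp add: shift_def scaleR_conv_of_real algebra_simps del: dirderivs.simps)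
      ultimately show "(?p has_vector_derivative (- of_real h) * ?F t y) (at t within {0..1})"
        by (simp add: has_vector_derivative_at_within del: dirderivs.simps)
    next
      have "continuous_on {0..1} (\<lambda>t. ?g (y - (x + (t * h) *\<^sub>R b)))"
        by (intro continuous_on_compose2[OF schwartz_continuous[OF g]] continuous_intros) auto
      then show "continuous_on {0..1} (\<lambda>t. (- of_real h) * ?F t y)"
        unfolding shift_def by (intro continuous_intros)
    qed simp
    moreover have "(\<integral>t. indicator {0..1} t *\<^sub>R ((- of_real h) * ?F t y) \<partial>lborel) = (\<integral>t. (- of_real h) * (?w t * ?F t y) \<partial>lborel)"
      by (intro Bochner_Integration.integral_cong refl) (auto simp: indicator_def)
    ultimately have "(- of_real h) * (\<integral>t. ?w t * ?F t y \<partial>lborel) = ?p 1 - ?p 0"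
      by (simp only: integral_mult_right_zero)
    then show ?thesis unfolding shift_diff by (simp add: algebra_simps del: dirderivs.simps)
  qed
  have "u (shift f (x + h *\<^sub>R b) \<zeta>) - u (shift f x \<zeta>) = u (\<lambda>y. shift f (x + h *\<^sub>R b) \<zeta> y - shift f x \<zeta> y)"
    by (intro u_diff[symmetric] schwartz_shift f)
  also have "\<dots> = (- of_real h) * u (\<lambda>y. \<integral>t. ?w t * ?F t y \<partial>lborel)"
    unfolding FTC by (intro u_cmult schwartz_tame_integral tame rapid_indicator)
  also have "u (\<lambda>y. \<integral>t. ?w t * ?F t y \<partial>lborel) = (\<integral>t. ?w t * u (?F t) \<partial>lborel)"
    by (rule u_tame_integral[OF tame rapid_indicator])
  finally have eq: "u (shift f (x + h *\<^sub>R b) \<zeta>) - u (shift f x \<zeta>) = (- of_real h) * (\<integral>t. ?w t * u (?F t) \<partial>lborel)" .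
  have "norm (\<integral>t. ?w t * u (?F t) \<partial>lborel) \<le> (\<integral>t. indicator {0..1::real} t *\<^sub>R B \<partial>lborel)"
  proof (rule norm_integral_le)
    show "integrable lborel (\<lambda>t::real. indicator {0..1} t *\<^sub>R B)" by simp
    fix t :: real
    show "norm (?w t * u (?F t)) \<le> indicator {0..1} t *\<^sub>R B"
    proof (cases "t \<in> {0..1}")
      case True
      then have "t * h \<in> closed_segment 0 h" by (auto simp: closed_segment_def)
      from B[OF this] show ?thesis using True by (simp del: dirderivs.simps)
    qed simp
  qed
  also have "\<dots> = B" by simp
  finally show ?thesis unfolding eq by (simp add: norm_mult mult.commute[of B] mult_left_mono del: dirderivs.simps)
qed

section \<open>From one decaying window to decay of a localised Fourier transform\<close>

text \<open>Here \<open>R\<close> plays the role of \<open>\<surd>\<lambda>\<close>.  The factor \<open>R ^ (2 * m0)\<close> comes from the order of \<open>u\<close>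
  and is the same at every stage, whereas each induction step gains a factor \<open>1 / R\<close>.  The room
  \<open>\<rho> + \<rho>' < r0\<close> is used up by the translations by \<open>z / R\<close> of the averaging.\<close>

lemma decay_by_induction:
  fixes k :: "'a \<Rightarrow> complex" and x0 :: 'a
  assumes k: "schwartz k" and c: "(\<integral>y. k y \<partial>lborel) \<noteq> 0"
    and W: "\<And>N::nat. \<exists>C\<ge>0. \<forall>R x \<xi>. 1 \<le> R \<longrightarrow> x \<in> ball x0 r0 \<longrightarrow> norm \<xi> = 1 \<longrightarrow> \<xi> \<in> S \<longrightarrow>
       norm (u (shift (\<lambda>y. k (R *\<^sub>R y)) x (R\<^sup>2 *\<^sub>R \<xi>))) \<le> C / R ^ N"
    and m: "schwartz m" "\<And>y. m y \<noteq> 0 \<Longrightarrow> y \<in> cball x0 \<rho>" and \<rho>: "0 \<le> \<rho>'" "\<rho> + \<rho>' < r0"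
  shows "\<exists>C\<ge>0. \<forall>R s \<xi>. 1 \<le> R \<longrightarrow> norm s \<le> \<rho>' \<longrightarrow> norm \<xi> = 1 \<longrightarrow> \<xi> \<in> S \<longrightarrow>
     norm (u (shift m s (R\<^sup>2 *\<^sub>R \<xi>))) \<le> C * R ^ (2 * m0) / R ^ N"
  using m \<rho>
proof (induction N arbitrary: m \<rho>')
  \<comment> \<open>Plain temperedness; the frequency has norm \<open>R\<^sup>2\<close>, which is
    the origin of \<open>R ^ (2 * m0)\<close>.\<close>
  case 0
  obtain C where C: "0 \<le> C" "\<And>x \<zeta>. norm (u (shift m x \<zeta>)) \<le> C * (1 + norm x) ^ k0 * (1 + norm \<zeta>) ^ m0"
    using u_shift_bound[OF 0(1)] by metis
  have "norm (u (shift m s (R\<^sup>2 *\<^sub>R \<xi>))) \<le> (C * (1 + \<rho>') ^ k0 * 2 ^ m0) * R ^ (2 * m0)"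
    if "1 \<le> R" "norm s \<le> \<rho>'" "norm \<xi> = 1" for R s \<xi>
  proof -
    have "1 + norm (R\<^sup>2 *\<^sub>R \<xi>) \<le> 2 * R\<^sup>2" using that by (simp add: one_le_power)
    then have "C * (1 + norm s) ^ k0 * (1 + norm (R\<^sup>2 *\<^sub>R \<xi>)) ^ m0 \<le> C * (1 + \<rho>') ^ k0 * (2 * R\<^sup>2) ^ m0"
      using that C(1) 0(3) by (intro mult_mono power_mono) auto
    then show ?thesis using C(2)[of s "R\<^sup>2 *\<^sub>R \<xi>"] by (simp add: power_mult_distrib power_mult mult.assoc)
  qed
  moreover have "0 \<le> C * (1 + \<rho>') ^ k0 * 2 ^ m0" using C(1) 0 by simp
  ultimately show ?case by (simp only: power_0 div_by_1) blast
next
  case (Suc N)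
  define \<delta> where "\<delta> = (r0 - \<rho> - \<rho>') / 2"
  have \<delta>: "0 < \<delta>" "\<rho> + (\<rho>' + \<delta>) < r0" using Suc.prems by (auto simp: \<delta>_def field_simps)
  let ?c = "\<integral>y. k y \<partial>lborel"
  have "\<forall>b\<in>Basis. \<exists>C\<ge>0. \<forall>R s \<xi>. 1 \<le> R \<longrightarrow> norm s \<le> \<rho>' + \<delta> \<longrightarrow> norm \<xi> = 1 \<longrightarrow> \<xi> \<in> S \<longrightarrow>
     norm (u (shift (dirderivs [b] m) s (R\<^sup>2 *\<^sub>R \<xi>))) \<le> C * R ^ (2 * m0) / R ^ N"
  proof
    fix b :: 'a assume b: "b \<in> Basis"
    show "\<exists>C\<ge>0. \<forall>R s \<xi>. 1 \<le> R \<longrightarrow> norm s \<le> \<rho>' + \<delta> \<longrightarrow> norm \<xi> = 1 \<longrightarrow> \<xi> \<in> S \<longrightarrow>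
       norm (u (shift (dirderivs [b] m) s (R\<^sup>2 *\<^sub>R \<xi>))) \<le> C * R ^ (2 * m0) / R ^ N"
    proof (rule Suc.IH)
      show "schwartz (dirderivs [b] m)" by (rule schwartz_partial[OF Suc.prems(1) b])
      show "y \<in> cball x0 \<rho>" if nz: "dirderivs [b] m y \<noteq> 0" for y
      proof (rule ccontr)
        assume y: "y \<notin> cball x0 \<rho>"
        have "jet_bound 1 m y 0"
          by (rule jet_bound_vanishing[of "- cball x0 \<rho>"]) (use y Suc.prems(2) in auto)
        then show False using jet_boundD[of 1 m y 0 "[b]"] b nz by (simp del: dirderivs.simps)
      qed
    qed (use Suc.prems \<delta> in auto)
  qed
  then obtain Cb where Cb: "\<And>b. b \<in> Basis \<Longrightarrow> 0 \<le> Cb b" "\<And>b R s \<xi>. b \<in> Basis \<Longrightarrow> 1 \<le> R \<Longrightarrow> norm s \<le> \<rho>' + \<delta> \<Longrightarrow> norm \<xi> = 1 \<Longrightarrow> \<xi> \<in> S \<Longrightarrow>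
     norm (u (shift (dirderivs [b] m) s (R\<^sup>2 *\<^sub>R \<xi>))) \<le> Cb b * R ^ (2 * m0) / R ^ N" by metis
  define C1 where "C1 = sum Cb Basis"
  have C1: "0 \<le> C1" "\<And>b. b \<in> Basis \<Longrightarrow> Cb b \<le> C1"
    unfolding C1_def using Cb(1) by (auto intro: sum_nonneg member_le_sum)
  obtain C2 where C2: "0 \<le> C2" "\<And>x \<zeta>. norm (u (shift m x \<zeta>)) \<le> C2 * (1 + norm x) ^ k0 * (1 + norm \<zeta>) ^ m0"
    using u_shift_bound[OF Suc.prems(1)] by metis
  \<comment> \<open>The additional \<open>DIM('a)\<close> powers pay for the Jacobian
    \<open>R ^ DIM('a)\<close> of the change of variables in \<open>subst\<close>.\<close>
  obtain CW where CW: "0 \<le> CW" "\<And>R x \<xi>. 1 \<le> R \<Longrightarrow> x \<in> ball x0 r0 \<Longrightarrow> norm \<xi> = 1 \<Longrightarrow> \<xi> \<in> S \<Longrightarrow>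
       norm (u (shift (\<lambda>y. k (R *\<^sub>R y)) x (R\<^sup>2 *\<^sub>R \<xi>))) \<le> CW / R ^ (Suc N + DIM('a))"
    using W[of "Suc N + DIM('a)"] by metis
  obtain A where A: "0 \<le> A" "\<And>y. jet_bound 0 m y (A / (1 + norm y) ^ (2 * DIM('a)))"
    using schwartz_jet[OF Suc.prems(1)] by metis
  \<comment> \<open>\<open>C3\<close> belongs to the crude bound \<open>far\<close>. In
    \<open>C4\<close> it is divided by \<open>\<delta> ^ Suc N\<close> because
    \<open>norm z > \<delta> * R\<close> is traded for powers of \<open>R\<close>; the term
    \<open>DIM('a) * C1\<close> comes from the mean value estimate \<open>near\<close>.\<close>
  define C3 where "C3 = 2 * C2 * (1 + \<rho>') ^ k0 * 2 ^ m0"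
  define C4 where "C4 = DIM('a) * C1 + C3 / \<delta> ^ Suc N"
  define I where "I = (\<integral>z. norm (k z) * (1 + norm z) ^ (k0 + Suc N) \<partial>lborel)"
  define J where "J = (\<integral>x. 1 / (1 + norm (x::'a)) ^ (2 * DIM('a)) \<partial>lborel)"
  define C5 where "C5 = (C4 * I + CW * (1 + \<rho>') ^ (2 * DIM('a)) * A * J) / norm ?c"
  have I0: "0 \<le> I" unfolding I_def by (rule Bochner_Integration.integral_nonneg) auto
  have J0: "0 \<le> J" unfolding J_def by (rule Bochner_Integration.integral_nonneg) (auto simp: add_pos_nonneg)
  have C3: "0 \<le> C3" using C2(1) Suc.prems by (simp add: C3_def)
  have C4: "0 \<le> C4" using C1(1) C3 \<delta> by (simp add: C4_def)
  have C5: "0 \<le> C5" using C4 I0 J0 CW A Suc.prems by (simp add: C5_def)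
  show ?case
  proof (intro exI[of _ C5] conjI C5 allI impI)
    fix R :: real and s \<xi> :: 'a assume R: "1 \<le> R" and s: "norm s \<le> \<rho>'" and \<xi>: "norm \<xi> = 1" "\<xi> \<in> S"
    let ?\<zeta> = "R\<^sup>2 *\<^sub>R \<xi>"
    let ?V = "\<lambda>x. u (shift m x ?\<zeta>)"
    let ?E = "R ^ (2 * m0) / R ^ Suc N"
    have R0: "0 < R" using R by simp
    \<comment> \<open>Here the induction hypothesis enters: moving the shift costs derivatives of
      \<open>m\<close>, already known to decay like \<open>R ^ (2 * m0) / R ^ N\<close>.\<close>
    have near: "norm (?V (s + h) - ?V s) \<le> DIM('a) * (C1 * R ^ (2 * m0) / R ^ N) * norm h" if h: "norm h \<le> \<delta>" for h
    proof (rule coordinatewise_bound[where G="?V" and r=\<delta>])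
      show "0 \<le> C1 * R ^ (2 * m0) / R ^ N" using C1 R by simp
      fix x b :: 'a and t :: real
      assume b: "b \<in> Basis" and x: "norm (x - s) \<le> \<delta>" "norm (x + t *\<^sub>R b - s) \<le> \<delta>"
      show "norm (?V (x + t *\<^sub>R b) - ?V x) \<le> C1 * R ^ (2 * m0) / R ^ N * \<bar>t\<bar>"
      proof (rule u_shift_mean_value[OF Suc.prems(1) b])
        fix \<tau> assume "\<tau> \<in> closed_segment 0 t"
        from segment_in_cball[OF x this] have "norm (x + \<tau> *\<^sub>R b) \<le> \<rho>' + \<delta>"
          using s norm_triangle_sub[of "x + \<tau> *\<^sub>R b" s] by linarith
        then have "norm (u (shift (dirderivs [b] m) (x + \<tau> *\<^sub>R b) ?\<zeta>)) \<le> Cb b * R ^ (2 * m0) / R ^ N"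
          by (intro Cb(2) b R \<xi>)
        also have "\<dots> \<le> C1 * R ^ (2 * m0) / R ^ N"
          using C1(2)[OF b] R by (intro divide_right_mono mult_right_mono) auto
        finally show "norm (u (shift (dirderivs [b] m) (x + \<tau> *\<^sub>R b) ?\<zeta>)) \<le> C1 * R ^ (2 * m0) / R ^ N" .
      qed
    qed fact
    \<comment> \<open>No decay is claimed for large shifts; the polynomial growth in
      \<open>h\<close> is absorbed by the rapid decay of \<open>k\<close>.\<close>
    have far: "norm (?V (s + h) - ?V s) \<le> C3 * (1 + norm h) ^ k0 * R ^ (2 * m0)" for h
    proof -
      have \<zeta>2: "(1 + norm ?\<zeta>) ^ m0 \<le> 2 ^ m0 * R ^ (2 * m0)"
      proof -
        have "1 + norm ?\<zeta> \<le> 2 * R\<^sup>2" using R \<xi> by (simp add: one_le_power)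
        then have "(1 + norm ?\<zeta>) ^ m0 \<le> (2 * R\<^sup>2) ^ m0" by (intro power_mono) auto
        then show ?thesis by (simp add: power_mult_distrib power_mult)
      qed
      have *: "norm (?V x) \<le> C2 * ((1 + \<rho>') * (1 + norm h)) ^ k0 * (2 ^ m0 * R ^ (2 * m0))" if "1 + norm x \<le> (1 + \<rho>') * (1 + norm h)" for x
        using that C2(1) \<zeta>2 Suc.prems(3) by (intro order_trans[OF C2(2)] mult_mono power_mono) auto
      have "0 \<le> \<rho>' * norm h" using Suc.prems by simp
      then have "1 + norm (s + h) \<le> (1 + \<rho>') * (1 + norm h)" "1 + norm s \<le> (1 + \<rho>') * (1 + norm h)"
        using s norm_triangle_ineq[of s h] norm_ge_zero[of h] unfolding distrib_left distrib_right by linarith+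
      then have "norm (?V (s + h) - ?V s) \<le> 2 * (C2 * ((1 + \<rho>') * (1 + norm h)) ^ k0 * (2 ^ m0 * R ^ (2 * m0)))"
        using *[of "s + h"] *[of s] norm_triangle_ineq4[of "?V (s + h)" "?V s"] by linarith
      then show ?thesis by (simp add: C3_def power_mult_distrib mult_ac)
    qed
    \<comment> \<open>Short shifts gain \<open>1 / R\<close> from the scaling of \<open>z\<close>.
      Long ones, with \<open>norm z > \<delta> * R\<close>, gain \<open>1 / R ^ Suc N\<close> by
      multiplying with a power of \<open>norm z / (\<delta> * R)\<close>, which is at least
      1.\<close>
    have diff: "norm (?V s - ?V (s + (1 / R) *\<^sub>R z)) \<le> C4 * (1 + norm z) ^ (k0 + Suc N) * ?E" for z
    proof (cases "norm z \<le> \<delta> * R")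
      case True
      have nh: "norm ((1 / R) *\<^sub>R z) = norm z / R" using R0 by simp
      have z1: "norm z \<le> (1 + norm z) ^ (k0 + Suc N)"
        using self_le_power[of "1 + norm z" "k0 + Suc N"] by simp
      have "norm (?V (s + (1 / R) *\<^sub>R z) - ?V s) \<le> DIM('a) * (C1 * R ^ (2 * m0) / R ^ N) * norm ((1 / R) *\<^sub>R z)"
        by (rule near) (use True R0 in \<open>simp add: nh divide_le_eq\<close>)
      also have "\<dots> = DIM('a) * C1 * norm z * ?E" unfolding nh using R0 by (simp add: field_simps)
      also have "\<dots> \<le> C4 * (1 + norm z) ^ (k0 + Suc N) * ?E"
        using C1 C3 \<delta> R0 z1 C4 unfolding C4_def by (intro mult_right_mono mult_mono) auto
      finally show ?thesis by (simp add: norm_minus_commute)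
    next
      case False
      have nh: "norm ((1 / R) *\<^sub>R z) \<le> norm z" using R by (simp add: divide_le_eq mult_le_cancel_left1)
      have big: "1 \<le> (norm z / (\<delta> * R)) ^ Suc N"
        using False \<delta> R0 by (intro one_le_power) (simp add: le_divide_eq)
      have "norm (?V (s + (1 / R) *\<^sub>R z) - ?V s) \<le> C3 * (1 + norm ((1 / R) *\<^sub>R z)) ^ k0 * R ^ (2 * m0)" by (rule far)
      also have "\<dots> \<le> C3 * (1 + norm z) ^ k0 * R ^ (2 * m0) * 1"
        using C3 nh R0 by (simp add: mult_right_mono mult_left_mono power_mono)
      also have "\<dots> \<le> C3 * (1 + norm z) ^ k0 * R ^ (2 * m0) * (norm z / (\<delta> * R)) ^ Suc N"
        using C3 R0 big by (intro mult_left_mono) auto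
      also have "\<dots> = (C3 / \<delta> ^ Suc N) * ((1 + norm z) ^ k0 * norm z ^ Suc N) * ?E"
        by (simp only: power_divide power_mult_distrib times_divide_eq_left times_divide_eq_right divide_divide_eq_left mult_ac)
      also have "\<dots> \<le> C4 * ((1 + norm z) ^ k0 * (1 + norm z) ^ Suc N) * ?E"
        using C1 C3 \<delta> R0 unfolding C4_def by (intro mult_right_mono mult_mono power_mono) auto
      finally show ?thesis by (simp only: norm_minus_commute[of "?V s"] power_add)
    qed
    have tameX: "tame (\<lambda>z. shift m (s + (1 / R) *\<^sub>R z) ?\<zeta>)"
    proof (rule tame_shift[OF Suc.prems(1), of _ 1 "\<lambda>_. ?\<zeta>"])
      fix z z' :: 'a
      have "(s + (1 / R) *\<^sub>R z) - (s + (1 / R) *\<^sub>R z') = (1 / R) *\<^sub>R (z - z')" by (simp add: algebra_simps)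
      then show "norm ((s + (1 / R) *\<^sub>R z) - (s + (1 / R) *\<^sub>R z')) \<le> 1 * norm (z - z')"
        using R by (simp add: divide_le_eq mult_le_cancel_left1)
    qed auto
    have kR: "schwartz (\<lambda>y. k (R *\<^sub>R y))" by (rule schwartz_dilate[OF k R])
    have tameY: "tame (\<lambda>x. shift (\<lambda>y. k (R *\<^sub>R y)) x ?\<zeta>)"
      by (rule tame_shift[OF kR, of _ 1 "\<lambda>_. ?\<zeta>"]) auto
    have ms: "schwartz (\<lambda>x. m (x - s))"
      using schwartz_shift[OF Suc.prems(1), of s 0] by (simp add: shift_def[abs_def])
    let ?w = "\<lambda>x. of_real (R ^ DIM('a)) * m (x - s)"
    have rw: "rapid ?w" by (intro schwartz_rapid schwartz_cmult ms)
    have rk: "rapid k" by (rule schwartz_rapid[OF k])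
    have [measurable]: "k \<in> borel_measurable borel" "m \<in> borel_measurable borel"
      using rk schwartz_rapid[OF Suc.prems(1)] by (auto intro: rapid_measurable)
    \<comment> \<open>One integral in two readings under \<open>z = R *\<^sub>R (y - x)\<close>: an
      average of shifted copies of \<open>m\<close> with weight \<open>k\<close>, or an average of
      windows at positions \<open>x\<close> with weight \<open>m (x - s)\<close>. The frequency is
      the same in both.\<close>
    have subst: "(\<integral>z. k z * shift m (s + (1 / R) *\<^sub>R z) ?\<zeta> y \<partial>lborel) = (\<integral>x. ?w x * shift (\<lambda>y. k (R *\<^sub>R y)) x ?\<zeta> y \<partial>lborel)" for y
    proof -
      have "(\<integral>z. k z * shift m (s + (1 / R) *\<^sub>R z) ?\<zeta> y \<partial>lborel) =
         of_real (\<bar>- R\<bar> ^ DIM('a)) * (\<integral>x. k (R *\<^sub>R y + (- R) *\<^sub>R x) * shift m (s + (1 / R) *\<^sub>R (R *\<^sub>R y + (- R) *\<^sub>R x)) ?\<zeta> y \<partial>lborel)"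
        unfolding shift_def by (rule integral_affine) (use R0 in auto)
      also have "\<dots> = (\<integral>x. of_real (\<bar>- R\<bar> ^ DIM('a)) * (k (R *\<^sub>R y + (- R) *\<^sub>R x) * shift m (s + (1 / R) *\<^sub>R (R *\<^sub>R y + (- R) *\<^sub>R x)) ?\<zeta> y) \<partial>lborel)"
        by (rule integral_mult_right_zero[symmetric])
      also have "\<dots> = (\<integral>x. ?w x * shift (\<lambda>y. k (R *\<^sub>R y)) x ?\<zeta> y \<partial>lborel)"
      proof (rule Bochner_Integration.integral_cong[OF refl])
        fix x
        have "y - (s + (1 / R) *\<^sub>R (R *\<^sub>R y + (- R) *\<^sub>R x)) = x - s" using R0 by (simp add: algebra_simps)
        then show "of_real (\<bar>- R\<bar> ^ DIM('a)) * (k (R *\<^sub>R y + (- R) *\<^sub>R x) * shift m (s + (1 / R) *\<^sub>R (R *\<^sub>R y + (- R) *\<^sub>R x)) ?\<zeta> y)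
          = ?w x * shift (\<lambda>y. k (R *\<^sub>R y)) x ?\<zeta> y"
          using R0 unfolding shift_def by (simp only: abs_minus_cancel abs_of_pos) (simp add: algebra_simps)
      qed
      finally show ?thesis .
    qed
    have uT: "(\<integral>z. k z * ?V (s + (1 / R) *\<^sub>R z) \<partial>lborel) = (\<integral>x. ?w x * u (shift (\<lambda>y. k (R *\<^sub>R y)) x ?\<zeta>) \<partial>lborel)"
      using u_tame_integral[OF tameX rk] u_tame_integral[OF tameY rw] unfolding subst by simp
    have n1: "norm (\<integral>x. ?w x * u (shift (\<lambda>y. k (R *\<^sub>R y)) x ?\<zeta>) \<partial>lborel) \<le>
       (\<integral>x. (CW * (1 + \<rho>') ^ (2 * DIM('a)) * A / R ^ Suc N) * (1 / (1 + norm (x::'a)) ^ (2 * DIM('a))) \<partial>lborel)"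
    proof (rule norm_integral_le)
      show "integrable lborel (\<lambda>x::'a. (CW * (1 + \<rho>') ^ (2 * DIM('a)) * A / R ^ Suc N) * (1 / (1 + norm x) ^ (2 * DIM('a))))"
        by (intro integrable_mult_right integrable_weight)
      fix x :: 'a
      show "norm (?w x * u (shift (\<lambda>y. k (R *\<^sub>R y)) x ?\<zeta>)) \<le> (CW * (1 + \<rho>') ^ (2 * DIM('a)) * A / R ^ Suc N) * (1 / (1 + norm x) ^ (2 * DIM('a)))"
      \<comment> \<open>Where the weight is nonzero, \<open>x\<close> lies within
        \<open>\<rho> + \<rho>'\<close> of \<open>x0\<close>, hence in the region covered by
        \<open>W\<close>.\<close>
      proof (cases "m (x - s) = 0")
        case True
        then show ?thesis using CW A R0 Suc.prems by simp
      next
        case False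
        then have "dist x0 (x - s) \<le> \<rho>" using Suc.prems(2) by auto
        then have "x \<in> ball x0 r0" using s Suc.prems(4) norm_triangle_ineq[of "x0 - (x - s)" "- s"] by (simp add: dist_norm)
        then have 1: "norm (u (shift (\<lambda>y. k (R *\<^sub>R y)) x ?\<zeta>)) \<le> CW / R ^ (Suc N + DIM('a))"
          by (intro CW(2) R \<xi>)
        have "norm (m (x - s)) \<le> A / (1 + norm (x - s)) ^ (2 * DIM('a))" using A(2) by (simp add: jet_bound_0)
        also have "\<dots> \<le> (1 + norm s) ^ (2 * DIM('a)) * A / (1 + norm x) ^ (2 * DIM('a))" by (rule weight_shift[OF A(1)])
        also have "\<dots> \<le> (1 + \<rho>') ^ (2 * DIM('a)) * A / (1 + norm x) ^ (2 * DIM('a))"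
          using s A(1) by (intro divide_right_mono mult_right_mono power_mono) auto
        finally have "R ^ DIM('a) * norm (m (x - s)) \<le> R ^ DIM('a) * ((1 + \<rho>') ^ (2 * DIM('a)) * A / (1 + norm x) ^ (2 * DIM('a)))"
          using R0 by (intro mult_left_mono) auto
        then have 2: "norm (?w x) \<le> R ^ DIM('a) * ((1 + \<rho>') ^ (2 * DIM('a)) * A / (1 + norm x) ^ (2 * DIM('a)))"
          using R0 by (simp add: norm_mult norm_power)
        have "norm (?w x * u (shift (\<lambda>y. k (R *\<^sub>R y)) x ?\<zeta>)) \<le>
          R ^ DIM('a) * ((1 + \<rho>') ^ (2 * DIM('a)) * A / (1 + norm x) ^ (2 * DIM('a))) * (CW / R ^ (Suc N + DIM('a)))"
          unfolding norm_mult[of "?w x"] using 1 2 R0 A(1) Suc.prems by (intro mult_mono) auto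
        also have "\<dots> = (CW * (1 + \<rho>') ^ (2 * DIM('a)) * A / R ^ Suc N) * (1 / (1 + norm x) ^ (2 * DIM('a)))"
          using R0 by (simp add: power_add mult_ac)
        finally show ?thesis .
      qed
    qed
    have n2: "norm (\<integral>z. k z * (?V s - ?V (s + (1 / R) *\<^sub>R z)) \<partial>lborel) \<le>
       (\<integral>z. (C4 * ?E) * (norm (k z) * (1 + norm z) ^ (k0 + Suc N)) \<partial>lborel)"
    proof (rule norm_integral_le)
      show "integrable lborel (\<lambda>z. (C4 * ?E) * (norm (k z) * (1 + norm z) ^ (k0 + Suc N)))"
        by (intro integrable_mult_right integrable_rapid_weight rk)
      fix z
      show "norm (k z * (?V s - ?V (s + (1 / R) *\<^sub>R z))) \<le> (C4 * ?E) * (norm (k z) * (1 + norm z) ^ (k0 + Suc N))"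
        using mult_left_mono[OF diff[of z], of "norm (k z)"] by (simp only: norm_mult norm_ge_zero mult_ac)
    qed
    have ik: "integrable lborel k" by (rule schwartz_integrable[OF k])
    \<comment> \<open>Reading \<open>?c * ?V s\<close> as the \<open>k\<close>-average of a constant
      splits it into the average of differences, bounded by \<open>n2\<close>, and the average of
      the shifted values, which is small by \<open>uT\<close> and \<open>n1\<close>.\<close>
    have "?c * ?V s = (\<integral>z. k z * ?V s \<partial>lborel)" by simp
    also have "\<dots> = (\<integral>z. k z * (?V s - ?V (s + (1 / R) *\<^sub>R z)) + k z * ?V (s + (1 / R) *\<^sub>R z) \<partial>lborel)"
      by (simp add: algebra_simps)
    also have "\<dots> = (\<integral>z. k z * (?V s - ?V (s + (1 / R) *\<^sub>R z)) \<partial>lborel) + (\<integral>z. k z * ?V (s + (1 / R) *\<^sub>R z) \<partial>lborel)"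
    proof (rule Bochner_Integration.integral_add)
      show i: "integrable lborel (\<lambda>z. k z * ?V (s + (1 / R) *\<^sub>R z))" by (rule u_tame_integrable[OF tameX rk])
      show "integrable lborel (\<lambda>z. k z * (?V s - ?V (s + (1 / R) *\<^sub>R z)))"
        unfolding right_diff_distrib by (intro Bochner_Integration.integrable_diff integrable_mult_left ik i)
    qed
    finally have "norm (?c * ?V s) \<le> norm (\<integral>z. k z * (?V s - ?V (s + (1 / R) *\<^sub>R z)) \<partial>lborel) +
        norm (\<integral>x. ?w x * u (shift (\<lambda>y. k (R *\<^sub>R y)) x ?\<zeta>) \<partial>lborel)"
      unfolding uT by (simp add: norm_triangle_ineq)
    also have "\<dots> \<le> (C4 * ?E) * I + (CW * (1 + \<rho>') ^ (2 * DIM('a)) * A / R ^ Suc N) * J"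
      using n1 n2 by (simp only: I_def J_def integral_mult_right_zero)
    also have "\<dots> \<le> (C4 * ?E) * I + (CW * (1 + \<rho>') ^ (2 * DIM('a)) * A * ?E) * J"
    proof -
      have "1 / R ^ Suc N \<le> ?E" using R by (intro divide_right_mono) (auto simp: one_le_power)
      then have "CW * (1 + \<rho>') ^ (2 * DIM('a)) * A * (1 / R ^ Suc N) * J \<le> CW * (1 + \<rho>') ^ (2 * DIM('a)) * A * ?E * J"
        using CW A J0 Suc.prems by (intro mult_right_mono mult_left_mono) auto
      then show ?thesis by simp
    qed
    also have "\<dots> = (C4 * I + CW * (1 + \<rho>') ^ (2 * DIM('a)) * A * J) * ?E" by (simp only: distrib_right distrib_left mult_ac)
    also have "C4 * I + CW * (1 + \<rho>') ^ (2 * DIM('a)) * A * J = norm ?c * C5" using c by (simp add: C5_def)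
    also have "norm ?c * C5 * ?E = norm ?c * (C5 * ?E)" by (rule mult.assoc)
    finally have "norm ?c * norm (?V s) \<le> norm ?c * (C5 * ?E)" by (simp add: norm_mult)
    moreover have "0 < norm ?c" using c by simp
    ultimately have "norm (?V s) \<le> C5 * ?E" by (rule mult_left_le_imp_le)
    then show "norm (?V s) \<le> C5 * R ^ (2 * m0) / R ^ Suc N" by (simp only: times_divide_eq_right)
  qed
qed

end

section \<open>Conic neighbourhoods\<close>

text \<open>A cone prescribed by its trace on the unit sphere, so that estimates for unit vectors in
  a ball transfer to it by scaling.\<close>

definition sector :: "'a::euclidean_space \<Rightarrow> real \<Rightarrow> 'a set" where
  "sector \<omega> r = {\<zeta>. \<zeta> \<noteq> 0 \<and> (1 / norm \<zeta>) *\<^sub>R \<zeta> \<in> ball \<omega> r}"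

lemma conic_nbhd_sector:
  assumes "\<xi>0 \<noteq> 0" "0 < r" shows "conic_nbhd (sector ((1 / norm \<xi>0) *\<^sub>R \<xi>0) r) \<xi>0"
  unfolding conic_nbhd_def
proof (intro conjI ballI allI impI)
  let ?\<omega> = "(1 / norm \<xi>0) *\<^sub>R \<xi>0"
  have "open (- {0} \<inter> (\<lambda>\<zeta>. (1 / norm \<zeta>) *\<^sub>R \<zeta>) -` ball ?\<omega> r)"
    by (rule continuous_open_preimage) (auto intro!: continuous_intros)
  moreover have "sector ?\<omega> r = - {0} \<inter> (\<lambda>\<zeta>. (1 / norm \<zeta>) *\<^sub>R \<zeta>) -` ball ?\<omega> r"
    by (auto simp: sector_def)
  ultimately show "open (sector ?\<omega> r)" by simp
  show "\<xi>0 \<in> sector ?\<omega> r" using assms by (simp add: sector_def)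
  show "t *\<^sub>R \<xi> \<in> sector ?\<omega> r" if "\<xi> \<in> sector ?\<omega> r" "0 < t" for \<xi> t
    using that by (simp add: sector_def)
qed

text \<open>The ball in \<open>\<Gamma>\<close> has twice the radius \<open>r\<close>, so that
  directions within \<open>r\<close> of the axis may still be perturbed by \<open>r\<close>. The
  bound \<open>1 / 4\<close> keeps perturbed unit vectors away from 0.\<close>

lemma conic_nbhd_ball:
  assumes \<Gamma>: "conic_nbhd \<Gamma> \<xi>0" and "\<xi>0 \<noteq> 0"
  obtains r where "0 < r" "r \<le> 1 / 4" "ball ((1 / norm \<xi>0) *\<^sub>R \<xi>0) (2 * r) \<subseteq> \<Gamma>"
proof -
  have "(1 / norm \<xi>0) *\<^sub>R \<xi>0 \<in> \<Gamma>" using assms by (auto simp: conic_nbhd_def)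
  then obtain e where e: "0 < e" "ball ((1 / norm \<xi>0) *\<^sub>R \<xi>0) e \<subseteq> \<Gamma>"
    using \<Gamma> unfolding conic_nbhd_def by (meson openE)
  show thesis
  proof (rule that[of "min (1 / 4) (e / 2)"])
    have "ball ((1 / norm \<xi>0) *\<^sub>R \<xi>0) (2 * min (1 / 4) (e / 2)) \<subseteq> ball ((1 / norm \<xi>0) *\<^sub>R \<xi>0) e"
      by (rule subset_ball) simp
    then show "ball ((1 / norm \<xi>0) *\<^sub>R \<xi>0) (2 * min (1 / 4) (e / 2)) \<subseteq> \<Gamma>" using e by blast
  qed (use e in auto)
qed

lemma powr_minus_nat: "0 < x \<Longrightarrow> x powr (- real N) = 1 / x ^ N"
  by (simp add: powr_minus powr_realpow inverse_eq_divide)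

section \<open>One decaying window excludes the point from the wave front set\<close>

context tempered_distribution
begin

lemma wave_packet_scaled:
  assumes \<phi>: "schwartz \<phi>" and lam: "1 \<le> lam"
  shows "wave_packet (scaled lam \<phi>) u x \<zeta> =
    of_real (lam powr (real DIM('a) / 4)) * u (shift (\<lambda>y. cnj (\<phi> (sqrt lam *\<^sub>R y))) x \<zeta>)"
proof -
  have "schwartz (\<lambda>y. cnj (\<phi> (sqrt lam *\<^sub>R y)))"
    using lam by (intro schwartz_dilate[OF schwartz_cnj[OF \<phi>]]) simp
  moreover have "shift (\<lambda>y. cnj (scaled lam \<phi> y)) x \<zeta> =
      (\<lambda>y. of_real (lam powr (real DIM('a) / 4)) * shift (\<lambda>y. cnj (\<phi> (sqrt lam *\<^sub>R y))) x \<zeta> y)"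
    by (simp add: shift_def[abs_def] scaled_def mult.assoc)
  ultimately show ?thesis by (simp add: wave_packet_shift u_cmult schwartz_shift)
qed

text \<open>Modulating the dilated window by \<open>\<eta>\<close> shifts the frequency
  \<open>R\<^sup>2 *\<^sub>R \<xi>\<close> by \<open>R *\<^sub>R \<eta>\<close>, so
  \<open>\<xi>\<close> itself changes by \<open>(1 / R) *\<^sub>R \<eta>\<close>. For large
  \<open>R\<close> this stays in the cone, and the hypothesis on the unmodulated window
  applies.\<close>

lemma modulated_window_decay:
  fixes \<phi> :: "'a \<Rightarrow> complex"
  assumes \<phi>: "schwartz \<phi>" and dec: "wp_decay \<phi> u K \<Gamma>" and K: "ball x0 r0 \<subseteq> K"
    and r: "0 < r" "r \<le> 1 / 4" "ball \<omega> (2 * r) \<subseteq> \<Gamma>"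
  shows "\<exists>C\<ge>0. \<forall>R x \<xi>. 1 \<le> R \<longrightarrow> x \<in> ball x0 r0 \<longrightarrow> norm \<xi> = 1 \<longrightarrow> \<xi> \<in> ball \<omega> r \<longrightarrow>
       norm (u (shift (\<lambda>y. cnj (\<phi> (R *\<^sub>R y)) * wave \<eta> (R *\<^sub>R y)) x (R\<^sup>2 *\<^sub>R \<xi>))) \<le> C / R ^ N"
proof -
  let ?f = "\<lambda>y. cnj (\<phi> y)"
  have f: "schwartz ?f" by (rule schwartz_cnj[OF \<phi>])
  have k: "schwartz (\<lambda>y. ?f y * wave \<eta> y)" using schwartz_shift[OF f, of 0 \<eta>] by (simp add: shift_def[abs_def])
  \<comment> \<open>Unit vectors perturbed by less than \<open>1 / 4\<close> have norm between
    \<open>inverse 2\<close> and 2, hence the choice 2 for \<open>a\<close>.\<close>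
  obtain C where C: "C > 0" "\<And>lam x \<xi>. 1 \<le> lam \<Longrightarrow> x \<in> K \<Longrightarrow> \<xi> \<in> \<Gamma> \<Longrightarrow> inverse 2 \<le> norm \<xi> \<Longrightarrow> norm \<xi> \<le> 2 \<Longrightarrow>
       norm (wave_packet (scaled lam \<phi>) u x (lam *\<^sub>R \<xi>)) \<le> C * lam powr (- real N)"
    using dec unfolding wp_decay_def by (meson one_le_numeral)
  obtain D where D: "0 \<le> D" "\<And>R x \<zeta>. 1 \<le> R \<Longrightarrow> norm (u (shift (\<lambda>y. ?f (R *\<^sub>R y) * wave \<eta> (R *\<^sub>R y)) x \<zeta>))
      \<le> D * R ^ m0 * (1 + norm x) ^ k0 * (1 + norm \<zeta>) ^ m0"
    using u_shift_dilate_bound[OF k] by metis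
  \<comment> \<open>For \<open>R > P\<close> the perturbation \<open>norm \<eta> / R\<close> is less
    than \<open>r\<close>; below this threshold \<open>R\<close> is bounded and the crude bound can
    be put into the required form.\<close>
  define P where "P = 1 + norm \<eta> / r"
  have P: "1 \<le> P" using r by (simp add: P_def)
  \<comment> \<open>\<open>3 * m0\<close> collects \<open>R ^ m0\<close> from the dilation and
    \<open>R ^ (2 * m0)\<close> from the frequency; \<open>N\<close> more powers compensate for
    \<open>1 / R ^ N\<close>.\<close>
  define D' where "D' = D * (1 + norm x0 + \<bar>r0\<bar>) ^ k0 * 2 ^ m0 * P ^ (3 * m0 + N)"
  have D': "0 \<le> D'" using D P by (simp add: D'_def)
  show ?thesis
  proof (intro exI[of _ "C + D'"] conjI allI impI)
    show "0 \<le> C + D'" using C D' by simp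
    fix R :: real and x \<xi> :: 'a
    assume R: "1 \<le> R" and x: "x \<in> ball x0 r0" and \<xi>: "norm \<xi> = 1" "\<xi> \<in> ball \<omega> r"
    let ?U = "u (shift (\<lambda>y. ?f (R *\<^sub>R y) * wave \<eta> (R *\<^sub>R y)) x (R\<^sup>2 *\<^sub>R \<xi>))"
    have R0: "0 < R" using R by simp
    show "norm ?U \<le> (C + D') / R ^ N"
    proof (cases "R \<le> P")
      case True
      have "1 + norm (R\<^sup>2 *\<^sub>R \<xi>) \<le> 2 * R\<^sup>2" using R \<xi> by (simp add: one_le_power)
      moreover have "norm x \<le> norm x0 + \<bar>r0\<bar>"
        using x norm_triangle_sub[of x x0] by (simp add: dist_norm norm_minus_commute)
      ultimately have "norm ?U \<le> D * R ^ m0 * (1 + norm x0 + \<bar>r0\<bar>) ^ k0 * (2 * R\<^sup>2) ^ m0"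
        using D(1) R0 by (intro order_trans[OF D(2)[OF R]] mult_mono power_mono) auto
      also have "\<dots> = D * (1 + norm x0 + \<bar>r0\<bar>) ^ k0 * 2 ^ m0 * (R ^ (3 * m0 + N) / R ^ N)"
        using R0 by (simp add: power_mult_distrib power_add power_mult power3_eq_cube power2_eq_square)
      also have "\<dots> \<le> D * (1 + norm x0 + \<bar>r0\<bar>) ^ k0 * 2 ^ m0 * (P ^ (3 * m0 + N) / R ^ N)"
        using True D(1) R0 by (intro mult_left_mono divide_right_mono power_mono) auto
      also have "\<dots> = D' / R ^ N" by (simp add: D'_def)
      also have "\<dots> \<le> (C + D') / R ^ N" using C R0 by (intro divide_right_mono) auto
      finally show ?thesis .
    next
      case False
      let ?\<xi> = "\<xi> + (1 / R) *\<^sub>R \<eta>"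
      have small: "norm ((1 / R) *\<^sub>R \<eta>) < r"
      proof -
        have "norm \<eta> / r < R" using False by (simp add: P_def)
        then show ?thesis using r R0 by (simp add: divide_less_eq mult.commute)
      qed
      have "norm (\<omega> - ?\<xi>) \<le> norm (\<omega> - \<xi>) + norm ((1 / R) *\<^sub>R \<eta>)"
        using norm_triangle_ineq4[of "\<omega> - \<xi>" "(1 / R) *\<^sub>R \<eta>"] by (simp add: diff_diff_eq)
      then have in\<Gamma>: "?\<xi> \<in> \<Gamma>" using \<xi>(2) small r(3) by (auto simp: dist_norm)
      have lo: "inverse 2 \<le> norm ?\<xi>"
        using norm_triangle_ineq2[of \<xi> "- ((1 / R) *\<^sub>R \<eta>)"] \<xi>(1) small r(2) by simp
      have hi: "norm ?\<xi> \<le> 2"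
        using norm_triangle_ineq[of \<xi> "(1 / R) *\<^sub>R \<eta>"] \<xi>(1) small r(2) by simp
      have R2: "1 \<le> R\<^sup>2" using R by (simp add: one_le_power)
      have w: "wave \<eta> (R *\<^sub>R (y - x)) = wave (- (R *\<^sub>R \<eta>)) x * wave (R *\<^sub>R \<eta>) y" for y
        unfolding wave_def exp_add[symmetric] by (simp add: inner_diff_left algebra_simps)
      have z: "R\<^sup>2 *\<^sub>R ?\<xi> = R *\<^sub>R \<eta> + R\<^sup>2 *\<^sub>R \<xi>"
        using R0 by (simp add: algebra_simps power2_eq_square)
      have eq: "shift (\<lambda>y. ?f (R *\<^sub>R y) * wave \<eta> (R *\<^sub>R y)) x (R\<^sup>2 *\<^sub>R \<xi>) =
         (\<lambda>y. wave (- (R *\<^sub>R \<eta>)) x * shift (\<lambda>y. ?f (R *\<^sub>R y)) x (R\<^sup>2 *\<^sub>R ?\<xi>) y)"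
        unfolding shift_def w z wave_add by (simp add: mult_ac)
      have "norm ?U = norm (u (shift (\<lambda>y. ?f (R *\<^sub>R y)) x (R\<^sup>2 *\<^sub>R ?\<xi>)))"
        unfolding eq by (subst u_cmult) (auto simp: norm_mult intro!: schwartz_shift schwartz_dilate f R)
      \<comment> \<open>The normalising factor is at least 1, so in this direction it can be
        inserted for free.\<close>
      also have "\<dots> \<le> (R\<^sup>2) powr (real DIM('a) / 4) * norm (u (shift (\<lambda>y. ?f (R *\<^sub>R y)) x (R\<^sup>2 *\<^sub>R ?\<xi>)))"
        using R2 by (intro mult_le_cancel_right1[THEN iffD2]) (auto simp: ge_one_powr_ge_zero)
      also have "\<dots> = norm (wave_packet (scaled (R\<^sup>2) \<phi>) u x (R\<^sup>2 *\<^sub>R ?\<xi>))"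
        using R0 by (simp add: wave_packet_scaled[OF \<phi> R2] norm_mult)
      also have "\<dots> \<le> C * (R\<^sup>2) powr (- real N)"
        using K x by (intro C(2) R2 in\<Gamma> lo hi) auto
      also have "\<dots> = C / (R\<^sup>2) ^ N" using R0 by (simp add: powr_minus_nat)
      also have "\<dots> \<le> C / R ^ N"
        using C(1) R0 R by (intro divide_left_mono power_mono self_le_power) auto
      also have "\<dots> \<le> (C + D') / R ^ N" using D' R0 by (intro divide_right_mono) auto
      finally show ?thesis .
    qed
  qed
qed

lemma decay_imp_not_in_WF:
  fixes \<phi> :: "'a \<Rightarrow> complex"
  assumes \<phi>: "schwartz \<phi>" "\<phi> \<noteq> (\<lambda>_. 0)" and K: "x0 \<in> interior K" and \<Gamma>: "conic_nbhd \<Gamma> \<xi>0"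
    and \<xi>0: "\<xi>0 \<noteq> 0" and dec: "wp_decay \<phi> u K \<Gamma>"
  shows "not_in_WF u x0 \<xi>0"
proof -
  let ?f = "\<lambda>y. cnj (\<phi> y)" and ?\<omega> = "(1 / norm \<xi>0) *\<^sub>R \<xi>0"
  have f: "schwartz ?f" by (rule schwartz_cnj[OF \<phi>(1)])
  have "?f \<noteq> (\<lambda>_. 0)" using \<phi>(2) by (auto simp: fun_eq_iff)
  then obtain \<eta> where \<eta>: "ft ?f \<eta> \<noteq> 0" using ex_ft_nonzero[OF f] by blast
  let ?k = "\<lambda>y. ?f y * wave \<eta> y"
  have k: "schwartz ?k" using schwartz_shift[OF f, of 0 \<eta>] by (simp add: shift_def[abs_def])
  obtain r0 where r0: "0 < r0" "ball x0 r0 \<subseteq> K"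
    using K by (meson mem_interior)
  obtain r where r: "0 < r" "r \<le> 1 / 4" "ball ?\<omega> (2 * r) \<subseteq> \<Gamma>" using conic_nbhd_ball[OF \<Gamma> \<xi>0] by blast
  \<comment> \<open>The cutoff of \<open>ex_cutoff\<close> is supported in radius
    \<open>2 * \<rho>\<close>, which must be below \<open>r0\<close>; that lemma also asks for a
    radius at most 1.\<close>
  define \<rho> where "\<rho> = min 1 (r0 / 3)"
  have \<rho>: "0 < \<rho>" "\<rho> \<le> 1" "2 * \<rho> < r0" using r0 by (auto simp: \<rho>_def)
  obtain chi :: "'a \<Rightarrow> complex" where chi: "schwartz chi" "\<And>y. y \<in> ball x0 \<rho> \<Longrightarrow> chi y = 1"
    "\<And>y. chi y \<noteq> 0 \<Longrightarrow> y \<in> cball x0 (2 * \<rho>)"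
    using ex_cutoff[OF \<rho>(1,2)] by metis
  \<comment> \<open>The condition \<open>norm s \<le> 0\<close> is the instance
    \<open>\<rho>' = 0\<close>: positive shifts have served their purpose inside the
    induction.\<close>
  have decay: "\<exists>C\<ge>0. \<forall>R s \<xi>. 1 \<le> R \<longrightarrow> norm s \<le> 0 \<longrightarrow> norm \<xi> = 1 \<longrightarrow> \<xi> \<in> ball ?\<omega> r \<longrightarrow>
     norm (u (shift chi s (R\<^sup>2 *\<^sub>R \<xi>))) \<le> C * R ^ (2 * m0) / R ^ N" for N
  proof (rule decay_by_induction[OF k _ _ chi(1,3)])
    show "(\<integral>y. ?k y \<partial>lborel) \<noteq> 0" using \<eta> by (simp add: ft_def)
    show "\<exists>C\<ge>0. \<forall>R x \<xi>. 1 \<le> R \<longrightarrow> x \<in> ball x0 r0 \<longrightarrow> norm \<xi> = 1 \<longrightarrow> \<xi> \<in> ball ?\<omega> r \<longrightarrow>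
       norm (u (shift (\<lambda>y. ?f (R *\<^sub>R y) * wave \<eta> (R *\<^sub>R y)) x (R\<^sup>2 *\<^sub>R \<xi>))) \<le> C / R ^ N" for N
      by (rule modulated_window_decay[OF \<phi>(1) dec r0(2) r])
  qed (use \<rho> in auto)
  obtain D where D: "0 \<le> D" "\<And>x \<zeta>. norm (u (shift chi x \<zeta>)) \<le> D * (1 + norm x) ^ k0 * (1 + norm \<zeta>) ^ m0"
    using u_shift_bound[OF chi(1)] by metis
  show ?thesis
    unfolding not_in_WF_def
  proof (intro exI[of _ chi] exI[of _ "sector ?\<omega> r"] conjI allI)
    show "test_fun chi"
      unfolding test_fun_def using chi(1,3) by (auto intro!: bounded_subset[OF bounded_cball, of _ x0 "2 * \<rho>"])
    show "\<exists>e>0. \<forall>y\<in>ball x0 e. chi y = 1" using \<rho>(1) chi(2) by blast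
    show "conic_nbhd (sector ?\<omega> r) \<xi>0" by (rule conic_nbhd_sector[OF \<xi>0 r(1)])
    fix N :: nat
    \<comment> \<open>Of this decay, \<open>2 * m0\<close> powers cancel the fixed loss, and
      \<open>2 * N\<close> powers of \<open>R = sqrt (norm \<zeta>)\<close> make
      \<open>norm \<zeta> ^ N\<close>.\<close>
    obtain C where C: "0 \<le> C" "\<And>R s \<xi>. 1 \<le> R \<Longrightarrow> norm s \<le> 0 \<Longrightarrow> norm \<xi> = 1 \<Longrightarrow> \<xi> \<in> ball ?\<omega> r \<Longrightarrow>
      norm (u (shift chi s (R\<^sup>2 *\<^sub>R \<xi>))) \<le> C * R ^ (2 * m0) / R ^ (2 * m0 + 2 * N)"
      using decay[of "2 * m0 + 2 * N"] by metis
    define C' where "C' = 1 + C * 2 ^ N + D * 2 ^ (m0 + N)"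
    show "\<exists>C>0. \<forall>\<xi>\<in>sector ?\<omega> r. norm (fourier_cutoff u chi \<xi>) \<le> C * (1 + norm \<xi>) powr (- real N)"
    proof (intro exI[of _ C'] conjI ballI)
      show "0 < C'" unfolding C'_def using C(1) D(1) by (simp add: add_pos_nonneg)
      fix \<zeta> assume \<zeta>: "\<zeta> \<in> sector ?\<omega> r"
      then have nz: "0 < norm \<zeta>" by (simp add: sector_def)
      have pw: "(1 + norm \<zeta>) powr (- real N) = 1 / (1 + norm \<zeta>) ^ N"
        by (intro powr_minus_nat add_pos_nonneg) auto
      have "norm (u (shift chi 0 \<zeta>)) \<le> C' / (1 + norm \<zeta>) ^ N"
      \<comment> \<open>\<open>sqrt (norm \<zeta>)\<close> is admissible as \<open>R\<close> only if
        it is at least 1; small frequencies are covered by temperedness.\<close>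
      proof (cases "1 \<le> norm \<zeta>")
        case True
        let ?R = "sqrt (norm \<zeta>)"
        have R: "1 \<le> ?R" "?R\<^sup>2 = norm \<zeta>" using True by auto
        have "norm (u (shift chi 0 (?R\<^sup>2 *\<^sub>R ((1 / norm \<zeta>) *\<^sub>R \<zeta>)))) \<le> C * ?R ^ (2 * m0) / ?R ^ (2 * m0 + 2 * N)"
          using \<zeta> nz by (intro C(2) R) (auto simp: sector_def)
        moreover have "?R\<^sup>2 *\<^sub>R ((1 / norm \<zeta>) *\<^sub>R \<zeta>) = \<zeta>" unfolding R(2) using nz by simp
        moreover have "C * ?R ^ (2 * m0) / ?R ^ (2 * m0 + 2 * N) = C / norm \<zeta> ^ N"
          using nz by (simp add: power_add power_mult)
        ultimately have "norm (u (shift chi 0 \<zeta>)) \<le> C / norm \<zeta> ^ N" by simp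
        also have "\<dots> = C * 2 ^ N / (2 * norm \<zeta>) ^ N" by (simp add: power_mult_distrib)
        also have "\<dots> \<le> C * 2 ^ N / (1 + norm \<zeta>) ^ N"
          using C(1) True by (intro divide_left_mono power_mono mult_pos_pos zero_less_power) auto
        also have "\<dots> \<le> C' / (1 + norm \<zeta>) ^ N"
          using D(1) by (intro divide_right_mono) (auto simp: C'_def)
        finally show ?thesis .
      next
        case False
        have "norm (u (shift chi 0 \<zeta>)) \<le> D * (1 + norm \<zeta>) ^ m0" using D(2)[of 0 \<zeta>] by simp
        also have "\<dots> = D * (1 + norm \<zeta>) ^ (m0 + N) / (1 + norm \<zeta>) ^ N"
        proof -
          have "1 + norm \<zeta> \<noteq> 0" using nz by linarith
          then show ?thesis by (simp add: power_add)
        qed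
        also have "\<dots> \<le> D * 2 ^ (m0 + N) / (1 + norm \<zeta>) ^ N"
          using D(1) False by (intro divide_right_mono mult_left_mono power_mono) auto
        also have "\<dots> \<le> C' / (1 + norm \<zeta>) ^ N"
          using C(1) by (intro divide_right_mono) (auto simp: C'_def)
        finally show ?thesis .
      qed
      then show "norm (fourier_cutoff u chi \<zeta>) \<le> C' * (1 + norm \<zeta>) powr (- real N)"
        unfolding pw by (simp add: fourier_cutoff_shift)
    qed
  qed
qed

section \<open>From decay of a localised Fourier transform to decay of all wave packets\<close>

text \<open>Outside \<open>ball x0 e\<close> the distance from \<open>x\<close> is at least
  \<open>e / 2\<close>, so the argument of the dilated window has norm at least
  \<open>R * e / 2\<close> and its rapid decay yields every power of \<open>1 / R\<close>. Inside
  that ball the difference vanishes identically.\<close>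

lemma away_from_cutoff_decay:
  fixes f chi :: "'a \<Rightarrow> complex"
  assumes f: "schwartz f" and chi: "schwartz chi" "\<And>y. y \<in> ball x0 e \<Longrightarrow> chi y = 1" and e: "0 < e" and a: "1 \<le> a"
  shows "\<exists>C\<ge>0. \<forall>R x \<xi>. 1 \<le> R \<longrightarrow> x \<in> ball x0 (e / 2) \<longrightarrow> norm \<xi> \<le> a \<longrightarrow>
    norm (u (\<lambda>y. shift (\<lambda>y. f (R *\<^sub>R y)) x (R\<^sup>2 *\<^sub>R \<xi>) y - shift (\<lambda>y. f (R *\<^sub>R y)) x (R\<^sup>2 *\<^sub>R \<xi>) y * chi y)) \<le> C / R ^ M"
proof -
  \<comment> \<open>\<open>M\<close> powers for the claim, \<open>m0\<close> for the derivatives of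
    the dilated window and \<open>2 * m0\<close> for those of the wave of frequency
    \<open>R\<^sup>2 *\<^sub>R \<xi>\<close>.\<close>
  define J where "J = 3 * m0 + M"
  obtain A where A: "0 \<le> A" "\<And>y. jet_bound m0 f y (A / (1 + norm y) ^ (k0 + J))" using schwartz_jet[OF f] by metis
  obtain B where B: "\<And>y. jet_bound m0 chi y B" using schwartz_bounded_jets[OF chi(1)] by blast
  have B0: "0 \<le> B" using jet_bound_nonneg[OF B[of 0]] .
  define D where "D = 2 ^ m0 * A * (2 * a) ^ m0 / (e / 2) ^ J"
  have D: "0 \<le> D" using A a e by (simp add: D_def)
  define E where "E = (1 + 2 ^ m0 * B) * D * (1 + norm x0 + e) ^ k0"
  have E: "0 \<le> E" using B0 D e by (simp add: E_def)
  show ?thesis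
  proof (intro exI[of _ "C0 * E"] conjI allI impI)
    show "0 \<le> C0 * E" using C0 E by simp
    fix R :: real and x \<xi> :: 'a
    assume R: "1 \<le> R" and x: "x \<in> ball x0 (e / 2)" and \<xi>: "norm \<xi> \<le> a"
    let ?g = "shift (\<lambda>y. f (R *\<^sub>R y)) x (R\<^sup>2 *\<^sub>R \<xi>)"
    have R0: "0 < R" using R by simp
    have sd: "schwartz (\<lambda>y. f (R *\<^sub>R y))" by (rule schwartz_dilate[OF f R])
    have sg: "schwartz ?g" by (rule schwartz_shift[OF sd])
    have sgc: "schwartz (\<lambda>y. ?g y * chi y)"
      by (rule schwartz_mult[OF sg schwartz_smooth[OF chi(1)] schwartz_bounded_jets[OF chi(1)]])
    have "jet_bound m0 (\<lambda>y. ?g y - ?g y * chi y) y ((E / R ^ M) / (1 + norm y) ^ k0)" for y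
    proof (cases "y \<in> ball x0 e")
      case True
      show ?thesis
        by (rule jet_bound_vanishing[of "ball x0 e"]) (use True chi(2) E R0 in \<open>auto simp: add_pos_nonneg\<close>)
    next
      case False
      have far: "e / 2 \<le> norm (y - x)"
        using False x norm_triangle_ineq[of "x0 - x" "x - y"] by (simp add: dist_norm norm_minus_commute)
      let ?G = "D / R ^ M / (1 + norm (y - x)) ^ k0"
      have j1: "jet_bound m0 (\<lambda>y. f (R *\<^sub>R y)) (y - x) (R ^ m0 * (A / (1 + norm (R *\<^sub>R (y - x))) ^ (k0 + J)))"
        by (rule jet_bound_dilate[OF schwartz_smooth[OF f] R A(2)])
      have j2: "jet_bound m0 ?g y (2 ^ m0 * (R ^ m0 * (A / (1 + norm (R *\<^sub>R (y - x))) ^ (k0 + J))) * (1 + norm (R\<^sup>2 *\<^sub>R \<xi>)) ^ m0)"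
        by (rule jet_bound_shift_local[OF schwartz_smooth[OF sd] j1])
      have l: "2 ^ m0 * (R ^ m0 * (A / (1 + norm (R *\<^sub>R (y - x))) ^ (k0 + J))) * (1 + norm (R\<^sup>2 *\<^sub>R \<xi>)) ^ m0 \<le> ?G"
      proof -
        have n1: "1 + norm (y - x) \<le> 1 + norm (R *\<^sub>R (y - x))"
          using R mult_right_mono[of 1 R "norm (y - x)"] by simp
        have n2: "R * (e / 2) \<le> 1 + norm (R *\<^sub>R (y - x))"
        proof -
          have "R * (e / 2) \<le> R * norm (y - x)" using far R0 by (intro mult_left_mono) auto
          moreover have "norm (R *\<^sub>R (y - x)) = R * norm (y - x)" using R0 by simp
          ultimately show ?thesis by linarith
        qed
        have "(1 + norm (y - x)) ^ k0 * (R * (e / 2)) ^ J \<le> (1 + norm (R *\<^sub>R (y - x))) ^ k0 * (1 + norm (R *\<^sub>R (y - x))) ^ J"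
          using n1 n2 R0 e by (intro mult_mono power_mono) auto
        then have q: "A / (1 + norm (R *\<^sub>R (y - x))) ^ (k0 + J) \<le> A / ((1 + norm (y - x)) ^ k0 * (R * (e / 2)) ^ J)"
          unfolding power_add using A(1) R0 e
          by (intro divide_left_mono mult_pos_pos zero_less_power add_pos_nonneg) auto
        have w: "1 + norm (R\<^sup>2 *\<^sub>R \<xi>) \<le> 2 * a * R\<^sup>2"
        proof -
          have "1 * 1 \<le> a * R\<^sup>2" using a R by (intro mult_mono one_le_power) auto
          moreover have "R\<^sup>2 * norm \<xi> \<le> R\<^sup>2 * a" using \<xi> by (intro mult_left_mono) auto
          ultimately show ?thesis by (simp add: algebra_simps)
        qed
        have "2 ^ m0 * (R ^ m0 * (A / (1 + norm (R *\<^sub>R (y - x))) ^ (k0 + J))) * (1 + norm (R\<^sup>2 *\<^sub>R \<xi>)) ^ m0 \<le>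
           2 ^ m0 * (R ^ m0 * (A / ((1 + norm (y - x)) ^ k0 * (R * (e / 2)) ^ J))) * (2 * a * R\<^sup>2) ^ m0"
          using q w R0 A(1) e by (intro mult_mono power_mono mult_left_mono) auto
        also have "\<dots> = ?G"
          unfolding D_def J_def using R0 e
          by (simp add: power_mult_distrib power_add power_mult power3_eq_cube power2_eq_square field_simps)
        finally show ?thesis .
      qed
      have j: "jet_bound m0 ?g y ?G" by (rule jet_bound_mono[OF j2 order_refl l])
      have "jet_bound m0 (\<lambda>y. ?g y - ?g y * chi y) y (?G + 2 ^ m0 * ?G * B)"
        by (intro jet_bound_diff jet_bound_mult schwartz_smooth[OF sg] schwartz_smooth[OF sgc] schwartz_smooth[OF chi(1)] j B)
      moreover have "?G + 2 ^ m0 * ?G * B \<le> (E / R ^ M) / (1 + norm y) ^ k0"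
      proof -
        have nx: "1 + norm x \<le> 1 + norm x0 + e"
          using x e norm_triangle_sub[of x x0] by (simp add: dist_norm norm_minus_commute)
        have "?G \<le> (1 + norm x) ^ k0 * (D / R ^ M) / (1 + norm y) ^ k0"
          using D R0 by (intro weight_shift) simp
        also have "\<dots> \<le> (1 + norm x0 + e) ^ k0 * (D / R ^ M) / (1 + norm y) ^ k0"
          using nx D R0 by (intro divide_right_mono mult_right_mono power_mono) auto
        finally have "(1 + 2 ^ m0 * B) * ?G \<le> (1 + 2 ^ m0 * B) * ((1 + norm x0 + e) ^ k0 * (D / R ^ M) / (1 + norm y) ^ k0)"
          using B0 by (intro mult_left_mono) auto
        also have "\<dots> = (E / R ^ M) / (1 + norm y) ^ k0" by (simp add: E_def mult_ac)
        finally show ?thesis by (simp only: distrib_right mult_1 mult_ac)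
      qed
      ultimately show ?thesis by (rule jet_bound_mono[OF _ order_refl])
    qed
    then have "norm (u (\<lambda>y. ?g y - ?g y * chi y)) \<le> C0 * (E / R ^ M)"
      by (intro u_bound schwartz_diff sg sgc)
    then show "norm (u (\<lambda>y. ?g y - ?g y * chi y)) \<le> C0 * E / R ^ M" by simp
  qed
qed

text \<open>Fourier inversion of the window at \<open>R *\<^sub>R (y - x)\<close> leads to the
  frequencies \<open>R\<^sup>2 *\<^sub>R \<xi> - R *\<^sub>R \<eta>\<close> of \<open>chi u\<close>.
  The position \<open>x\<close> enters through the unimodular factor
  \<open>wave (R *\<^sub>R x) \<eta>\<close> alone, which makes the bound uniform in all
  \<open>x\<close>.\<close>

lemma cutoff_decay:
  fixes f chi :: "'a \<Rightarrow> complex"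
  assumes f: "schwartz f" and chi: "schwartz chi" and \<Gamma>: "conic_nbhd \<Gamma> \<xi>0"
    and r: "0 < r" "r \<le> 1 / 4" "ball \<omega> (2 * r) \<subseteq> \<Gamma>" and a: "1 \<le> a"
    and dec: "\<And>N::nat. \<exists>C>0. \<forall>\<xi>\<in>\<Gamma>. norm (fourier_cutoff u chi \<xi>) \<le> C * (1 + norm \<xi>) powr (- real N)"
  shows "\<exists>C\<ge>0. \<forall>R x \<xi>. 1 \<le> R \<longrightarrow> \<xi> \<in> sector \<omega> r \<longrightarrow> inverse a \<le> norm \<xi> \<longrightarrow> norm \<xi> \<le> a \<longrightarrow>
    norm (u (\<lambda>y. shift (\<lambda>y. f (R *\<^sub>R y)) x (R\<^sup>2 *\<^sub>R \<xi>) y * chi y)) \<le> C / R ^ M"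
proof -
  let ?\<gamma> = "(ft gaussian (0::'a))\<^sup>2"
  have \<gamma>: "?\<gamma> \<noteq> 0" using ft_gaussian_0_nonzero by simp
  obtain C1 where C1: "0 < C1" "\<And>\<xi>. \<xi> \<in> \<Gamma> \<Longrightarrow> norm (u (shift chi 0 \<xi>)) \<le> C1 * (1 + norm \<xi>) powr (- real M)"
    using dec[of M] unfolding fourier_cutoff_shift by blast
  obtain C2 where C2: "0 \<le> C2" "\<And>x \<zeta>. norm (u (shift chi x \<zeta>)) \<le> C2 * (1 + norm x) ^ k0 * (1 + norm \<zeta>) ^ m0"
    using u_shift_bound[OF chi] by metis
  \<comment> \<open>Since \<open>norm \<xi> \<ge> 1 / a\<close>, the condition
    \<open>norm \<eta> \<le> \<epsilon> * R\<close> moves the frequency divided by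
    \<open>R\<^sup>2 * norm \<xi>\<close> by at most \<open>r\<close>.\<close>
  define \<epsilon> where "\<epsilon> = r / a"
  have \<epsilon>: "0 < \<epsilon>" using r a by (simp add: \<epsilon>_def)
  \<comment> \<open>On the tail \<open>norm \<eta> > \<epsilon> * R\<close> temperedness loses
    \<open>R ^ (2 * m0)\<close>, and \<open>M\<close> further powers are wanted; \<open>Q\<close> is
    the resulting growth in \<open>\<eta>\<close>.\<close>
  define L where "L = 2 * m0 + M"
  define Q where "Q = m0 + L"
  define D where "D = C1 * (2 * a) ^ M + C2 * (2 * a) ^ m0 / \<epsilon> ^ L"
  have D: "0 \<le> D" using C1 C2 a \<epsilon> by (simp add: D_def)
  define I where "I = (\<integral>\<eta>. norm (1 / ?\<gamma> * ft f \<eta>) * (1 + norm \<eta>) ^ Q \<partial>lborel)"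
  have I0: "0 \<le> I" unfolding I_def by (rule Bochner_Integration.integral_nonneg) auto
  have rf: "rapid (\<lambda>\<eta>. 1 / ?\<gamma> * ft f \<eta>)"
    using rapid_mult_bounded[OF rapid_ft[OF f], of "\<lambda>_. 1 / ?\<gamma>" "norm (1 / ?\<gamma>)"] by (simp add: mult.commute)
  show ?thesis
  proof (intro exI[of _ "D * I"] conjI allI impI)
    show "0 \<le> D * I" using D I0 by simp
    fix R :: real and x \<xi> :: 'a
    assume R: "1 \<le> R" and \<xi>: "\<xi> \<in> sector \<omega> r" "inverse a \<le> norm \<xi>" "norm \<xi> \<le> a"
    have R0: "0 < R" using R by simp
    have \<xi>n: "0 < norm \<xi>" using \<xi>(1) by (simp add: sector_def)
    let ?Z = "\<lambda>\<eta>. R\<^sup>2 *\<^sub>R \<xi> - R *\<^sub>R \<eta>"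
    have point: "norm (u (shift chi 0 (?Z \<eta>))) \<le> (D / R ^ M) * (1 + norm \<eta>) ^ Q" for \<eta>
    proof (cases "norm \<eta> \<le> \<epsilon> * R")
      case True
      let ?v = "(1 / norm \<xi>) *\<^sub>R \<xi> - (1 / (R * norm \<xi>)) *\<^sub>R \<eta>"
      have small: "norm ((1 / (R * norm \<xi>)) *\<^sub>R \<eta>) \<le> r"
      proof -
        have "1 \<le> a * norm \<xi>" using \<xi>(2) a by (simp add: inverse_eq_divide divide_le_eq mult.commute)
        have "norm \<eta> \<le> (r / a) * R * 1" using True by (simp add: \<epsilon>_def)
        also have "\<dots> \<le> (r / a) * R * (a * norm \<xi>)"
          using \<open>1 \<le> a * norm \<xi>\<close> r a R0 by (intro mult_left_mono) auto
        also have "\<dots> = r * (R * norm \<xi>)" using a by simp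
        finally show ?thesis using R0 \<xi>n by (simp add: divide_le_eq)
      qed
      have "norm (\<omega> - ?v) \<le> norm (\<omega> - (1 / norm \<xi>) *\<^sub>R \<xi>) + norm ((1 / (R * norm \<xi>)) *\<^sub>R \<eta>)"
        using norm_triangle_ineq[of "\<omega> - (1 / norm \<xi>) *\<^sub>R \<xi>" "(1 / (R * norm \<xi>)) *\<^sub>R \<eta>"] by (simp add: algebra_simps)
      moreover have "norm (\<omega> - (1 / norm \<xi>) *\<^sub>R \<xi>) < r" using \<xi>(1) by (simp add: sector_def dist_norm)
      ultimately have "?v \<in> ball \<omega> (2 * r)" using small by (simp add: dist_norm)
      then have v\<Gamma>: "?v \<in> \<Gamma>" using r(3) by blast
      have Zv: "?Z \<eta> = (R\<^sup>2 * norm \<xi>) *\<^sub>R ?v"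
        using R0 \<xi>n by (simp add: scaleR_diff_right power2_eq_square)
      have Z\<Gamma>: "?Z \<eta> \<in> \<Gamma>" unfolding Zv using \<Gamma> v\<Gamma> R0 \<xi>n unfolding conic_nbhd_def by simp
      have "1 - r \<le> norm ?v"
        using norm_triangle_ineq2[of "(1 / norm \<xi>) *\<^sub>R \<xi>" "(1 / (R * norm \<xi>)) *\<^sub>R \<eta>"] small \<xi>n by simp
      then have v2: "1 / 2 \<le> norm ?v" using r(2) by simp
      have "R / (2 * a) \<le> 1 + norm (?Z \<eta>)"
      proof -
        \<comment> \<open>Only one of the two powers of \<open>R\<close> in the size of the
          frequency is kept; this suffices for decay of order \<open>M\<close> in
          \<open>R\<close>.\<close>
        have "R * 1 \<le> R * R" using R R0 by (intro mult_left_mono) auto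
        then have "R * (1 / a) * (1 / 2) \<le> (R\<^sup>2) * norm \<xi> * norm ?v"
          using \<xi>(2) v2 R0 a by (intro mult_mono) (auto simp: power2_eq_square inverse_eq_divide)
        then show ?thesis unfolding Zv using R0 \<xi>n by simp
      qed
      then have "(R / (2 * a)) ^ M \<le> (1 + norm (?Z \<eta>)) ^ M" using R0 a by (intro power_mono) auto
      then have "C1 / (1 + norm (?Z \<eta>)) ^ M \<le> C1 / (R / (2 * a)) ^ M"
        using C1(1) R0 a by (intro divide_left_mono mult_pos_pos zero_less_power) (auto simp: add_pos_nonneg)
      moreover have "norm (u (shift chi 0 (?Z \<eta>))) \<le> C1 / (1 + norm (?Z \<eta>)) ^ M"
        using C1(2)[OF Z\<Gamma>] by (simp add: powr_minus_nat add_pos_nonneg)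
      moreover have "C1 / (R / (2 * a)) ^ M = C1 * (2 * a) ^ M / R ^ M" by (simp add: power_divide)
      ultimately have "norm (u (shift chi 0 (?Z \<eta>))) \<le> (C1 * (2 * a) ^ M / R ^ M) * 1" by simp
      also have "\<dots> \<le> (D / R ^ M) * (1 + norm \<eta>) ^ Q"
        using C1 C2 a \<epsilon> R0 unfolding D_def by (intro mult_mono divide_right_mono one_le_power) auto
      finally show ?thesis .
    next
      case False
      have big: "1 \<le> (norm \<eta> / (\<epsilon> * R)) ^ L"
        using False \<epsilon> R0 by (intro one_le_power) (simp add: le_divide_eq)
      have Z2: "1 + norm (?Z \<eta>) \<le> (2 * a * R\<^sup>2) * (1 + norm \<eta>)"
      proof -
        have "norm (?Z \<eta>) \<le> R\<^sup>2 * norm \<xi> + R * norm \<eta>"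
          using norm_triangle_ineq4[of "R\<^sup>2 *\<^sub>R \<xi>" "R *\<^sub>R \<eta>"] R0 by simp
        moreover have "R\<^sup>2 * norm \<xi> \<le> R\<^sup>2 * a" using \<xi>(3) by (intro mult_left_mono) auto
        moreover have "1 * 1 \<le> a * R\<^sup>2" using a R by (intro mult_mono one_le_power) auto
        moreover have "R * norm \<eta> \<le> (2 * a * R\<^sup>2) * norm \<eta>"
        proof (rule mult_right_mono)
          have "1 * (1 * R) \<le> 2 * a * (R * R)" using a R by (intro mult_mono) auto
          then show "R \<le> 2 * a * R\<^sup>2" by (simp add: power2_eq_square)
        qed simp
        ultimately show ?thesis by (simp add: algebra_simps)
      qed
      have "norm (u (shift chi 0 (?Z \<eta>))) \<le> C2 * (1 + norm (?Z \<eta>)) ^ m0" using C2(2)[of 0 "?Z \<eta>"] by simp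
      also have "\<dots> \<le> C2 * ((2 * a * R\<^sup>2) * (1 + norm \<eta>)) ^ m0 * 1"
        using C2(1) Z2 by (simp add: mult_left_mono power_mono)
      also have "\<dots> \<le> C2 * ((2 * a * R\<^sup>2) * (1 + norm \<eta>)) ^ m0 * (norm \<eta> / (\<epsilon> * R)) ^ L"
        using C2(1) a big by (intro mult_left_mono) auto
      also have "\<dots> = (C2 * (2 * a) ^ m0 / \<epsilon> ^ L / R ^ M) * ((1 + norm \<eta>) ^ m0 * norm \<eta> ^ L)"
      proof -
        have e1: "((2 * a * R\<^sup>2) * (1 + norm \<eta>)) ^ m0 = (2 * a) ^ m0 * R ^ (2 * m0) * (1 + norm \<eta>) ^ m0"
          by (simp only: power_mult_distrib power_mult)
        have e2: "(norm \<eta> / (\<epsilon> * R)) ^ L = norm \<eta> ^ L / (\<epsilon> ^ L * (R ^ (2 * m0) * R ^ M))"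
        proof -
          have "R ^ L = R ^ (2 * m0) * R ^ M" by (simp only: L_def power_add)
          then show ?thesis by (simp only: power_divide power_mult_distrib)
        qed
        show ?thesis unfolding e1 e2 using R0 by (simp add: mult_ac)
      qed
      also have "\<dots> \<le> (D / R ^ M) * ((1 + norm \<eta>) ^ m0 * (1 + norm \<eta>) ^ L)"
        using C1 C2 a \<epsilon> R0 unfolding D_def by (intro mult_mono divide_right_mono power_mono) auto
      finally show ?thesis by (simp add: Q_def power_add)
    qed
    let ?w = "\<lambda>\<eta>. (1 / ?\<gamma> * ft f \<eta>) * wave (R *\<^sub>R x) \<eta>"
    have rw: "rapid ?w" by (rule rapid_mult_bounded[OF rf, of _ 1]) auto
    have tameZ: "tame (\<lambda>\<eta>. shift chi 0 (?Z \<eta>))"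
    proof (rule tame_shift[OF chi, of "\<lambda>_. 0" R])
      fix \<eta> \<eta>' :: 'a
      have "?Z \<eta> - ?Z \<eta>' = R *\<^sub>R (\<eta>' - \<eta>)" by (simp add: algebra_simps)
      then show "norm (?Z \<eta> - ?Z \<eta>') \<le> R * norm (\<eta> - \<eta>')" using R0 by (simp add: norm_minus_commute)
    qed (use R0 in auto)
    have rep: "shift (\<lambda>y. f (R *\<^sub>R y)) x (R\<^sup>2 *\<^sub>R \<xi>) y * chi y = (\<integral>\<eta>. ?w \<eta> * shift chi 0 (?Z \<eta>) y \<partial>lborel)" for y
    proof -
      have "f (R *\<^sub>R (y - x)) = 1 / ?\<gamma> * (\<integral>\<eta>. ft f \<eta> * wave (- (R *\<^sub>R (y - x))) \<eta> \<partial>lborel)"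
        using ft_inversion[OF f, of "R *\<^sub>R (y - x)"] \<gamma> by simp
      then have "shift (\<lambda>y. f (R *\<^sub>R y)) x (R\<^sup>2 *\<^sub>R \<xi>) y * chi y =
         (1 / ?\<gamma> * (wave (R\<^sup>2 *\<^sub>R \<xi>) y * chi y)) * (\<integral>\<eta>. ft f \<eta> * wave (- (R *\<^sub>R (y - x))) \<eta> \<partial>lborel)"
        by (simp add: shift_def)
      also have "\<dots> = (\<integral>\<eta>. (1 / ?\<gamma> * (wave (R\<^sup>2 *\<^sub>R \<xi>) y * chi y)) * (ft f \<eta> * wave (- (R *\<^sub>R (y - x))) \<eta>) \<partial>lborel)"
        by (rule integral_mult_right_zero[symmetric])
      also have "\<dots> = (\<integral>\<eta>. ?w \<eta> * shift chi 0 (?Z \<eta>) y \<partial>lborel)"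
      proof (rule Bochner_Integration.integral_cong[OF refl])
        fix \<eta>
        have "wave (R\<^sup>2 *\<^sub>R \<xi>) y * wave (- (R *\<^sub>R (y - x))) \<eta> = wave (R *\<^sub>R x) \<eta> * wave (?Z \<eta>) y"
          unfolding wave_def exp_add[symmetric] by (simp add: inner_diff_left inner_diff_right inner_commute algebra_simps)
        then have "(1 / ?\<gamma> * ft f \<eta> * chi y) * (wave (R\<^sup>2 *\<^sub>R \<xi>) y * wave (- (R *\<^sub>R (y - x))) \<eta>)
          = (1 / ?\<gamma> * ft f \<eta> * chi y) * (wave (R *\<^sub>R x) \<eta> * wave (?Z \<eta>) y)" by (simp only:)
        then show "(1 / ?\<gamma> * (wave (R\<^sup>2 *\<^sub>R \<xi>) y * chi y)) * (ft f \<eta> * wave (- (R *\<^sub>R (y - x))) \<eta>) = ?w \<eta> * shift chi 0 (?Z \<eta>) y"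
          unfolding shift_def diff_zero by (simp only: mult_ac)
      qed
      finally show ?thesis .
    qed
    have "u (\<lambda>y. shift (\<lambda>y. f (R *\<^sub>R y)) x (R\<^sup>2 *\<^sub>R \<xi>) y * chi y) = (\<integral>\<eta>. ?w \<eta> * u (shift chi 0 (?Z \<eta>)) \<partial>lborel)"
      unfolding rep by (rule u_tame_integral[OF tameZ rw])
    also have "norm \<dots> \<le> (\<integral>\<eta>. (D / R ^ M) * (norm (1 / ?\<gamma> * ft f \<eta>) * (1 + norm \<eta>) ^ Q) \<partial>lborel)"
    proof (rule norm_integral_le)
      show "integrable lborel (\<lambda>\<eta>. (D / R ^ M) * (norm (1 / ?\<gamma> * ft f \<eta>) * (1 + norm \<eta>) ^ Q))"
        by (intro integrable_mult_right integrable_rapid_weight rf)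
      fix \<eta>
      have "norm (?w \<eta> * u (shift chi 0 (?Z \<eta>))) = norm (1 / ?\<gamma> * ft f \<eta>) * norm (u (shift chi 0 (?Z \<eta>)))"
        by (simp only: norm_mult norm_wave mult_1_right)
      also have "\<dots> \<le> norm (1 / ?\<gamma> * ft f \<eta>) * ((D / R ^ M) * (1 + norm \<eta>) ^ Q)"
        by (intro mult_left_mono point) auto
      finally show "norm (?w \<eta> * u (shift chi 0 (?Z \<eta>))) \<le> (D / R ^ M) * (norm (1 / ?\<gamma> * ft f \<eta>) * (1 + norm \<eta>) ^ Q)"
        by (simp only: mult_ac)
    qed
    also have "\<dots> = (D / R ^ M) * I" unfolding I_def by (rule integral_mult_right_zero)
    finally show "norm (u (\<lambda>y. shift (\<lambda>y. f (R *\<^sub>R y)) x (R\<^sup>2 *\<^sub>R \<xi>) y * chi y)) \<le> D * I / R ^ M" by simp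
  qed
qed

text \<open>\<open>K\<close> and the cone are fixed by \<open>chi\<close> and
  \<open>\<Gamma>\<close> before any window is chosen, which is the uniformity that (iii) demands.
  The radius \<open>e / 2\<close> leaves the margin for \<open>away_from_cutoff_decay\<close>, the
  sector of radius \<open>r\<close> that for \<open>cutoff_decay\<close>.\<close>

lemma not_in_WF_imp_decay:
  assumes WF: "not_in_WF u x0 \<xi>0" and \<xi>0: "\<xi>0 \<noteq> 0"
  shows "\<exists>K \<Gamma>. x0 \<in> interior K \<and> conic_nbhd \<Gamma> \<xi>0 \<and> (\<forall>\<phi>. schwartz \<phi> \<longrightarrow> wp_decay \<phi> u K \<Gamma>)"
proof -
  let ?\<omega> = "(1 / norm \<xi>0) *\<^sub>R \<xi>0"
  obtain chi \<Gamma> e where chi: "schwartz chi" and e: "0 < e" "\<And>y. y \<in> ball x0 e \<Longrightarrow> chi y = 1" and \<Gamma>: "conic_nbhd \<Gamma> \<xi>0"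
    and dec: "\<And>N::nat. \<exists>C>0. \<forall>\<xi>\<in>\<Gamma>. norm (fourier_cutoff u chi \<xi>) \<le> C * (1 + norm \<xi>) powr (- real N)"
    using WF unfolding not_in_WF_def test_fun_def by blast
  obtain r where r: "0 < r" "r \<le> 1 / 4" "ball ?\<omega> (2 * r) \<subseteq> \<Gamma>" using conic_nbhd_ball[OF \<Gamma> \<xi>0] by blast
  have "wp_decay \<phi> u (ball x0 (e / 2)) (sector ?\<omega> r)" if \<phi>: "schwartz \<phi>" for \<phi>
    unfolding wp_decay_def
  proof (intro allI impI)
    fix N :: nat and a :: real assume a: "1 \<le> a"
    let ?f = "\<lambda>y. cnj (\<phi> y)" and ?n = "DIM('a)"
    have f: "schwartz ?f" by (rule schwartz_cnj[OF \<phi>])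
    \<comment> \<open>\<open>?n\<close> powers of \<open>R\<close> absorb the normalisation, which
      is at most \<open>R ^ ?n\<close>, and \<open>2 * N\<close> powers of \<open>R\<close> make
      \<open>lam ^ N\<close>.\<close>
    let ?M = "?n + 2 * N"
    obtain A where A: "0 \<le> A" "\<And>R x \<xi>. 1 \<le> R \<Longrightarrow> x \<in> ball x0 (e / 2) \<Longrightarrow> norm \<xi> \<le> a \<Longrightarrow>
      norm (u (\<lambda>y. shift (\<lambda>y. ?f (R *\<^sub>R y)) x (R\<^sup>2 *\<^sub>R \<xi>) y - shift (\<lambda>y. ?f (R *\<^sub>R y)) x (R\<^sup>2 *\<^sub>R \<xi>) y * chi y)) \<le> A / R ^ ?M"
      using away_from_cutoff_decay[OF f chi e(2,1) a, where M="?M"] by blast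
    obtain B where B: "0 \<le> B" "\<And>R x \<xi>. 1 \<le> R \<Longrightarrow> \<xi> \<in> sector ?\<omega> r \<Longrightarrow> inverse a \<le> norm \<xi> \<Longrightarrow> norm \<xi> \<le> a \<Longrightarrow>
      norm (u (\<lambda>y. shift (\<lambda>y. ?f (R *\<^sub>R y)) x (R\<^sup>2 *\<^sub>R \<xi>) y * chi y)) \<le> B / R ^ ?M"
      using cutoff_decay[OF f chi \<Gamma> r a dec, where M="?M"] by blast
    show "\<exists>C>0. \<forall>lam x \<xi>. 1 \<le> lam \<longrightarrow> x \<in> ball x0 (e / 2) \<longrightarrow> \<xi> \<in> sector ?\<omega> r \<longrightarrow> inverse a \<le> norm \<xi> \<longrightarrow> norm \<xi> \<le> a \<longrightarrow>
       norm (wave_packet (scaled lam \<phi>) u x (lam *\<^sub>R \<xi>)) \<le> C * lam powr (- real N)"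
    proof (intro exI[of _ "1 + A + B"] conjI allI impI)
      show "0 < 1 + A + B" using A(1) B(1) by simp
      fix lam :: real and x \<xi> :: 'a
      assume lam: "1 \<le> lam" and x: "x \<in> ball x0 (e / 2)" and \<xi>: "\<xi> \<in> sector ?\<omega> r" "inverse a \<le> norm \<xi>" "norm \<xi> \<le> a"
      define R where "R = sqrt lam"
      have R: "1 \<le> R" "R\<^sup>2 = lam" "0 < R" using lam by (auto simp: R_def)
      let ?g = "shift (\<lambda>y. ?f (R *\<^sub>R y)) x (R\<^sup>2 *\<^sub>R \<xi>)"
      have sg: "schwartz ?g" by (intro schwartz_shift schwartz_dilate f R)
      have sgc: "schwartz (\<lambda>y. ?g y * chi y)"
        by (rule schwartz_mult[OF sg schwartz_smooth[OF chi] schwartz_bounded_jets[OF chi]])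
      have "u ?g = u (\<lambda>y. (?g y - ?g y * chi y) + ?g y * chi y)" by simp
      also have "\<dots> = u (\<lambda>y. ?g y - ?g y * chi y) + u (\<lambda>y. ?g y * chi y)"
        by (intro u_add schwartz_diff sg sgc)
      finally have "norm (u ?g) \<le> A / R ^ ?M + B / R ^ ?M"
        using A(2)[OF R(1) x \<xi>(3)] B(2)[OF R(1) \<xi>, of x] by (simp add: norm_triangle_mono)
      then have ug: "norm (u ?g) \<le> (A + B) / R ^ ?M" by (simp add: add_divide_distrib)
      have pw: "lam powr (real ?n / 4) \<le> R ^ ?n"
      proof -
        have "lam powr (real ?n / 4) \<le> lam powr (real ?n / 2)" using lam by (intro powr_mono) auto
        also have "\<dots> = (lam powr (1 / 2)) powr real ?n" by (simp add: powr_powr)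
        also have "\<dots> = R ^ ?n" using lam R by (simp add: powr_half_sqrt R_def powr_realpow)
        finally show ?thesis .
      qed
      have "norm (wave_packet (scaled lam \<phi>) u x (lam *\<^sub>R \<xi>)) = lam powr (real ?n / 4) * norm (u ?g)"
        unfolding wave_packet_scaled[OF \<phi> lam] R_def[symmetric] R(2) by (simp add: norm_mult)
      also have "\<dots> \<le> R ^ ?n * ((A + B) / R ^ ?M)"
        using pw ug R by (intro mult_mono) auto
      also have "\<dots> = (A + B) / (R\<^sup>2) ^ N" using R by (simp add: power_add power_mult)
      also have "\<dots> = (A + B) * lam powr (- real N)" using lam by (simp add: R(2) powr_minus_nat)
      also have "\<dots> \<le> (1 + A + B) * lam powr (- real N)" by (intro mult_right_mono) auto
      finally show "norm (wave_packet (scaled lam \<phi>) u x (lam *\<^sub>R \<xi>)) \<le> (1 + A + B) * lam powr (- real N)" .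
    qed
  qed
  moreover have "x0 \<in> interior (ball x0 (e / 2))" using e by (simp add: interior_open)
  ultimately show ?thesis using conic_nbhd_sector[OF \<xi>0 r(1)] by blast
qed

end

text \<open>Condition (iii) speaks of all nonzero windows; a concrete one turns it into an existence
  statement as in (ii).\<close>

lemma ex_schwartz_nonzero: "\<exists>\<phi> :: 'a::euclidean_space \<Rightarrow> complex. schwartz \<phi> \<and> \<phi> \<noteq> (\<lambda>_. 0)"
proof (intro exI conjI)
  show "schwartz (gaussian :: 'a \<Rightarrow> complex)" by (rule schwartz_gaussian)
  show "(gaussian :: 'a \<Rightarrow> complex) \<noteq> (\<lambda>_. 0)" by (auto simp: gaussian_def fun_eq_iff)
qed

theorem theorem1p1:
  fixes u :: "('a::euclidean_space \<Rightarrow> complex) \<Rightarrow> complex" and x0 \<xi>0 :: 'a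
  assumes "tempered u" and "\<xi>0 \<noteq> 0"
  shows "(not_in_WF u x0 \<xi>0 \<longleftrightarrow>
           (\<exists>\<phi> K \<Gamma>. schwartz \<phi> \<and> \<phi> \<noteq> (\<lambda>_. 0) \<and> x0 \<in> interior K \<and> conic_nbhd \<Gamma> \<xi>0 \<and>
              wp_decay \<phi> u K \<Gamma>))
       \<and> (not_in_WF u x0 \<xi>0 \<longleftrightarrow>
           (\<exists>K \<Gamma>. x0 \<in> interior K \<and> conic_nbhd \<Gamma> \<xi>0 \<and>
              (\<forall>\<phi>. schwartz \<phi> \<and> \<phi> \<noteq> (\<lambda>_. 0) \<longrightarrow> wp_decay \<phi> u K \<Gamma>)))"
proof -
  obtain C0 k0 m0 where "tempered_distribution u C0 k0 m0"
    using tempered_imp_distribution[OF assms(1)] by blast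
  then interpret tempered_distribution u C0 k0 m0 .
  obtain \<phi>0 :: "'a \<Rightarrow> complex" where \<phi>0: "schwartz \<phi>0" "\<phi>0 \<noteq> (\<lambda>_. 0)" using ex_schwartz_nonzero by blast
  note i_iii = not_in_WF_imp_decay[OF _ assms(2), of x0]
  note ii_i = decay_imp_not_in_WF[OF _ _ _ _ assms(2)]
  show ?thesis
  proof (intro conjI iffI)
    assume "not_in_WF u x0 \<xi>0"
    from i_iii[OF this] show
      "\<exists>\<phi> K \<Gamma>. schwartz \<phi> \<and> \<phi> \<noteq> (\<lambda>_. 0) \<and> x0 \<in> interior K \<and> conic_nbhd \<Gamma> \<xi>0 \<and> wp_decay \<phi> u K \<Gamma>"
      "\<exists>K \<Gamma>. x0 \<in> interior K \<and> conic_nbhd \<Gamma> \<xi>0 \<and> (\<forall>\<phi>. schwartz \<phi> \<and> \<phi> \<noteq> (\<lambda>_. 0) \<longrightarrow> wp_decay \<phi> u K \<Gamma>)"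
      using \<phi>0 by blast+
  next
    assume "\<exists>\<phi> K \<Gamma>. schwartz \<phi> \<and> \<phi> \<noteq> (\<lambda>_. 0) \<and> x0 \<in> interior K \<and> conic_nbhd \<Gamma> \<xi>0 \<and> wp_decay \<phi> u K \<Gamma>"
    then show "not_in_WF u x0 \<xi>0" using ii_i by blast
  next
    assume "\<exists>K \<Gamma>. x0 \<in> interior K \<and> conic_nbhd \<Gamma> \<xi>0 \<and> (\<forall>\<phi>. schwartz \<phi> \<and> \<phi> \<noteq> (\<lambda>_. 0) \<longrightarrow> wp_decay \<phi> u K \<Gamma>)"
    then show "not_in_WF u x0 \<xi>0" using ii_i \<phi>0 by blast
  qed
qed

end
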